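(* Let $n\in\mathbb{N}$ and let $\mathbf{k}$ be a commutative ring. Let $i\in[f_{n+1}]$ and consider the lacunar subset $Q_i$ of $[n-1]$. Write the set $Q_i\cup\{n+1\}$ as $\{i_1<i_2<\cdots<i_m\}$, so that $i_m=n+1$. Set $i_0:=1$ and $j_k:=i_k-i_{k-1}$ for each $k\in[m]$ (so $j_1\ge 0$, $j_2,j_3,\ldots,j_m>1$ and $j_1+j_2+\cdots+j_m=n$). Then $$F_i/F_{i-1}\cong\operatorname{Ind}_{S_{j_1}\times S_{j_2}\times\cdots\times S_{j_m}}^{S_n}\left(\mathcal{H}_{j_1}\otimes\mathcal{Z}_{j_2}\otimes\mathcal{Z}_{j_3}\otimes\cdots\otimes\mathcal{Z}_{j_m}\right)$$ as $S_n$-representations over $\mathbf{k}$ (the first tensorand is an $\mathcal{H}$, all others are $\mathcal{Z}$'s).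
   Context: Notation: $\mathbb{N}=\{0,1,2,\ldots\}$; $[a,b]=\{a,a+1,\ldots,b\}$ and $[k]=[1,k]$ (empty if the upper end is below the lower end). $S_n$ is the group of permutations of $[n]$, with product $(\pi\sigma)(i)=\pi(\sigma(i))$; $s_i\in S_n$ is the transposition of $i$ and $i+1$. Representations of $S_n$ are left $\mathbf{k}[S_n]$-modules, and $\otimes=\otimes_{\mathbf{k}}$. Fibonacci filtration: $f_0=0$, $f_1=1$, $f_m=f_{m-1}+f_{m-2}$ are the Fibonacci numbers. A set of integers is lacunar if it contains no two consecutive integers. There are $f_{n+1}$ lacunar subsets of $[n-1]$; fix a listing $Q_1,Q_2,\ldots,Q_{f_{n+1}}$ of all of them such that $\operatorname{sum}(Q_1)\le\operatorname{sum}(Q_2)\le\cdots\le\operatorname{sum}(Q_{f_{n+1}})$, where $\operatorname{sum}$ denotes the sum of the elements (ties broken arbitrarily). For $I\subseteq[n]$ let $I':=\{i\in[n-1]: i\notin I\text{ and } i+1\notin I\}$ and $$F(I):=\{q\in\mathbf{k}[S_n] : qs_i=q\text{ for all } i\in I'\}.$$ For $i\in[0,f_{n+1}]$ let $F_i:=F(Q_1)+F(Q_2)+\cdots+F(Q_i)$ (so $F_0=0$). Each $F_i$ is a left ideal of $\mathbf{k}[S_n]$, so $F_i/F_{i-1}$ is a left $\mathbf{k}[S_n]$-module. $\mathcal{H}_p$ ($p\in\mathbb{N}$) is the trivial representation of $S_p$ on $\mathbf{k}$. For $p>0$, $\mathcal{Z}_p$ is the reflection quotient representation of $S_p$: the free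 module $\mathbf{k}^p$ on which $S_p$ acts by permuting coordinates ($\sigma e_i=e_{\sigma(i)}$ on standard basis vectors), divided by the submodule $\{(a,a,\ldots,a): a\in\mathbf{k}\}$. $S_{j_1}\times\cdots\times S_{j_m}$ is embedded in $S_n$ by the parabolic embedding: the $k$-th factor permutes the interval $[j_1+\cdots+j_{k-1}+1,\ j_1+\cdots+j_k]$ (after shifting). For a subgroup $H\le G$ and an $H$-representation $V$, $\operatorname{Ind}_H^GV=\mathbf{k}[G]\otimes_{\mathbf{k}[H]}V$. *)

theory Defs
  imports
    "HOL-Algebra.Sym_Groups"
    "HOL-Algebra.Product_Groups"
    "HOL-Algebra.Module"
    "HOL-Algebra.AbelCoset"
    "HOL-Library.Function_Algebras"
    "HOL-Number_Theory.Fib"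
begin

text \<open>
  The base ring \<open>\<k>\<close> is a type \<open>'k\<close> of sort \<open>{comm_ring, comm_monoid_mult}\<close>, that is, a commutative
  ring with unit that (unlike in the class \<open>comm_ring_1\<close>) may be trivial.

  The record type \<^typ>\<open>('r, 'v) module\<close> is used for left modules over arbitrary rings: \<open>'r\<close> is
  \<open>'k\<close> for \<open>\<k>\<close>-modules, and \<^typ>\<open>'g \<Rightarrow> 'k\<close> for left \<open>\<k>[G]\<close>-modules, i.e. representations of a group
  \<open>G\<close>.  The inherited fields \<open>mult\<close> and \<open>one\<close> carry no meaning for a module.
\<close>

section \<open>Modules, quotients and free modules\<close>

definition coset_map :: "('r, 'v) module \<Rightarrow> 'v set \<Rightarrow> ('v \<Rightarrow> 'v) \<Rightarrow> 'v set \<Rightarrow> 'v set"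
  \<comment> \<open>the map \<open>x + N \<mapsto> f x + N\<close> on \<open>M/N\<close> induced by an additive \<open>f\<close> that preserves \<open>N\<close>\<close>
  where "coset_map M N f X = (\<Union>x\<in>X. N +>\<^bsub>M\<^esub> f x)"

definition quot_module :: "('r, 'v) module \<Rightarrow> 'v set \<Rightarrow> ('r, 'v set) module"
  where "quot_module M N =
    \<lparr>carrier = a_rcosets\<^bsub>M\<^esub> N, mult = undefined, one = undefined, zero = N, add = set_add M,
     smult = (\<lambda>r. coset_map M N (\<lambda>x. r \<odot>\<^bsub>M\<^esub> x))\<rparr>"

inductive_set lin_span :: "('r, 'v) module \<Rightarrow> 'v set \<Rightarrow> 'v set"
  \<comment> \<open>all finite sums of multiples \<open>c \<odot> s\<close> with \<open>s \<in> S\<close>, where \<open>c\<close> ranges over the whole type \<open>'r\<close>\<close>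
  for M :: "('r, 'v) module" and S :: "'v set" where
  zero: "\<zero>\<^bsub>M\<^esub> \<in> lin_span M S"
| step: "x \<in> lin_span M S \<Longrightarrow> s \<in> S \<Longrightarrow> x \<oplus>\<^bsub>M\<^esub> c \<odot>\<^bsub>M\<^esub> s \<in> lin_span M S"

definition ground_module :: "('k :: {comm_ring, comm_monoid_mult}, 'k) module"
  where "ground_module =
    \<lparr>carrier = UNIV, mult = (*), one = 1, zero = 0, add = (+), smult = (*)\<rparr>"

definition free_module :: "'x set \<Rightarrow> ('k :: {comm_ring, comm_monoid_mult}, 'x \<Rightarrow> 'k) module"
  where "free_module X =
    \<lparr>carrier = {f. finite {x. f x \<noteq> 0} \<and> {x. f x \<noteq> 0} \<subseteq> X},
     mult = undefined, one = undefined, zero = 0, add = (+), smult = (\<lambda>c f x. c * f x)\<rparr>"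

definition single :: "'x \<Rightarrow> 'x \<Rightarrow> 'k :: {comm_ring, comm_monoid_mult}"
  where "single x = (\<lambda>y. if y = x then 1 else 0)"

definition push :: "('x \<Rightarrow> 'y) \<Rightarrow> ('x \<Rightarrow> 'k) \<Rightarrow> 'y \<Rightarrow> 'k :: {comm_ring, comm_monoid_mult}"
  \<comment> \<open>the linear map between free modules that sends the basis element \<open>x\<close> to the basis element \<open>h x\<close>\<close>
  where "push h f = (\<lambda>y. \<Sum>x | f x \<noteq> 0 \<and> h x = y. f x)"

section \<open>Group algebras and representations\<close>

text \<open>
  The group algebra of a finite group, as a ring and at the same time as the left regular module
  over itself.
\<close>

definition group_alg ::
    "('g, 'b) monoid_scheme \<Rightarrow> ('g \<Rightarrow> 'k :: {comm_ring, comm_monoid_mult}, 'g \<Rightarrow> 'k) module"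
  where "group_alg G =
    (let conv = (\<lambda>p q x. \<Sum>(g, h) \<in> {(g, h) \<in> carrier G \<times> carrier G. g \<otimes>\<^bsub>G\<^esub> h = x}. p g * q h)
     in \<lparr>carrier = carrier (free_module (carrier G)), mult = conv, one = single \<one>\<^bsub>G\<^esub>,
         zero = 0, add = (+), smult = conv\<rparr>)"

definition linearize ::
    "('g, 'b) monoid_scheme \<Rightarrow> ('k :: {comm_ring, comm_monoid_mult}, 'v) module \<Rightarrow>
     ('g \<Rightarrow> 'v \<Rightarrow> 'v) \<Rightarrow> ('g \<Rightarrow> 'k, 'v) module"
  \<comment> \<open>the left \<open>\<k>[G]\<close>-module given by a linear action \<open>\<rho>\<close> of the finite group \<open>G\<close> on a \<open>\<k>\<close>-module\<close>
  where "linearize G M \<rho> =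
    \<lparr>carrier = carrier M, mult = undefined, one = undefined, zero = \<zero>\<^bsub>M\<^esub>, add = add M,
     smult = (\<lambda>r v. \<Oplus>\<^bsub>M\<^esub>g\<in>carrier G. r g \<odot>\<^bsub>M\<^esub> \<rho> g v)\<rparr>"

definition underlying ::
    "('g, 'b) monoid_scheme \<Rightarrow> ('g \<Rightarrow> 'k :: {comm_ring, comm_monoid_mult}, 'v) module \<Rightarrow>
     ('k, 'v) module"
  \<comment> \<open>the \<open>\<k>\<close>-module underlying a left \<open>\<k>[G]\<close>-module\<close>
  where "underlying G V =
    \<lparr>carrier = carrier V, mult = undefined, one = undefined, zero = \<zero>\<^bsub>V\<^esub>, add = add V,
     smult = (\<lambda>c v. (\<lambda>g. c * single \<one>\<^bsub>G\<^esub> g) \<odot>\<^bsub>V\<^esub> v)\<rparr>"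

definition rep_iso ::
    "('g, 'b) monoid_scheme \<Rightarrow> ('g \<Rightarrow> 'k :: {comm_ring, comm_monoid_mult}, 'v) module \<Rightarrow>
     ('g \<Rightarrow> 'k, 'w) module \<Rightarrow> bool"
  where "rep_iso G V W \<longleftrightarrow>
    (\<exists>f \<in> iso (add_monoid V) (add_monoid W).
       \<forall>r \<in> carrier (group_alg G :: ('g \<Rightarrow> 'k, _) module). \<forall>v \<in> carrier V.
         f (r \<odot>\<^bsub>V\<^esub> v) = r \<odot>\<^bsub>W\<^esub> f v)"

section \<open>Tensor products\<close>

text \<open>
  The tensor product \<open>M \<otimes>\<^sub>A N\<close> over a \<open>\<k>\<close>-algebra \<open>A\<close> (given by its carrier), where \<open>A\<close> acts on the
  \<open>\<k>\<close>-module \<open>M\<close> from the right via \<open>\<rho>\<close> and \<open>N\<close> is a left \<open>A\<close>-module.  It is the quotient of the free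
  \<open>\<k>\<close>-module on \<open>M \<times> N\<close> by the submodule \<open>tensor_null A M \<rho> N\<close>.  The \<open>\<k>\<close>-linearity in the second
  argument follows from balancedness, as \<open>A\<close> contains the multiples of its unity.
\<close>

definition tensor_free ::
    "('k :: {comm_ring, comm_monoid_mult}, 'm) module \<Rightarrow> ('a, 'n) module \<Rightarrow>
     ('k, 'm \<times> 'n \<Rightarrow> 'k) module"
  where "tensor_free M N = free_module (carrier M \<times> carrier N)"

definition tensor_null ::
    "'a set \<Rightarrow> ('k :: {comm_ring, comm_monoid_mult}, 'm) module \<Rightarrow> ('m \<Rightarrow> 'a \<Rightarrow> 'm) \<Rightarrow>
     ('a, 'n) module \<Rightarrow> ('m \<times> 'n \<Rightarrow> 'k) set"
  where "tensor_null A M \<rho> N = lin_span (tensor_free M N)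
    ({single (x \<oplus>\<^bsub>M\<^esub> x', y) - single (x, y) - single (x', y) | x x' y.
        x \<in> carrier M \<and> x' \<in> carrier M \<and> y \<in> carrier N} \<union>
     {single (x, y \<oplus>\<^bsub>N\<^esub> y') - single (x, y) - single (x, y') | x y y'.
        x \<in> carrier M \<and> y \<in> carrier N \<and> y' \<in> carrier N} \<union>
     {single (c \<odot>\<^bsub>M\<^esub> x, y) - (\<lambda>z. c * single (x, y) z) | c x y.
        x \<in> carrier M \<and> y \<in> carrier N} \<union>
     {single (\<rho> x a, y) - single (x, a \<odot>\<^bsub>N\<^esub> y) | x a y.
        x \<in> carrier M \<and> a \<in> A \<and> y \<in> carrier N})"

definition tensor ::
    "'a set \<Rightarrow> ('k :: {comm_ring, comm_monoid_mult}, 'm) module \<Rightarrow> ('m \<Rightarrow> 'a \<Rightarrow> 'm) \<Rightarrow>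
     ('a, 'n) module \<Rightarrow> ('k, ('m \<times> 'n \<Rightarrow> 'k) set) module"
  where "tensor A M \<rho> N = quot_module (tensor_free M N) (tensor_null A M \<rho> N)"

definition tensor_map ::
    "'a set \<Rightarrow> ('k :: {comm_ring, comm_monoid_mult}, 'm) module \<Rightarrow> ('m \<Rightarrow> 'a \<Rightarrow> 'm) \<Rightarrow>
     ('a, 'n) module \<Rightarrow> ('m \<Rightarrow> 'm) \<Rightarrow> ('n \<Rightarrow> 'n) \<Rightarrow> ('m \<times> 'n \<Rightarrow> 'k) set \<Rightarrow> ('m \<times> 'n \<Rightarrow> 'k) set"
  where "tensor_map A M \<rho> N f h =
    coset_map (tensor_free M N) (tensor_null A M \<rho> N) (push (\<lambda>(x, y). (f x, h y)))"

text \<open>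
  The tensor product over \<open>\<k>\<close> of a family of \<open>\<k>\<close>-modules, as the quotient of the free \<open>\<k>\<close>-module on
  the tuples by the multilinearity relations.  For \<open>I = {}\<close> this is the free module on the empty
  tuple, i.e. \<open>\<k>\<close>.
\<close>

definition mtensor_free ::
    "'i set \<Rightarrow> ('i \<Rightarrow> ('k :: {comm_ring, comm_monoid_mult}, 'v) module) \<Rightarrow>
     ('k, ('i \<Rightarrow> 'v) \<Rightarrow> 'k) module"
  where "mtensor_free I M = free_module (\<Pi>\<^sub>E i\<in>I. carrier (M i))"

definition mtensor_null ::
    "'i set \<Rightarrow> ('i \<Rightarrow> ('k :: {comm_ring, comm_monoid_mult}, 'v) module) \<Rightarrow> (('i \<Rightarrow> 'v) \<Rightarrow> 'k) set"
  where "mtensor_null I M = lin_span (mtensor_free I M)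
    ({single (x(i := u \<oplus>\<^bsub>M i\<^esub> v)) - single (x(i := u)) - single (x(i := v)) | x i u v.
        x \<in> (\<Pi>\<^sub>E i\<in>I. carrier (M i)) \<and> i \<in> I \<and> u \<in> carrier (M i) \<and> v \<in> carrier (M i)} \<union>
     {single (x(i := c \<odot>\<^bsub>M i\<^esub> u)) - (\<lambda>z. c * single (x(i := u)) z) | c x i u.
        x \<in> (\<Pi>\<^sub>E i\<in>I. carrier (M i)) \<and> i \<in> I \<and> u \<in> carrier (M i)})"

definition mtensor ::
    "'i set \<Rightarrow> ('i \<Rightarrow> ('k :: {comm_ring, comm_monoid_mult}, 'v) module) \<Rightarrow>
     ('k, (('i \<Rightarrow> 'v) \<Rightarrow> 'k) set) module"
  where "mtensor I M = quot_module (mtensor_free I M) (mtensor_null I M)"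

definition mtensor_map ::
    "'i set \<Rightarrow> ('i \<Rightarrow> ('k :: {comm_ring, comm_monoid_mult}, 'v) module) \<Rightarrow> ('i \<Rightarrow> 'v \<Rightarrow> 'v) \<Rightarrow>
     (('i \<Rightarrow> 'v) \<Rightarrow> 'k) set \<Rightarrow> (('i \<Rightarrow> 'v) \<Rightarrow> 'k) set"
  where "mtensor_map I M f =
    coset_map (mtensor_free I M) (mtensor_null I M) (push (\<lambda>x. \<lambda>i\<in>I. f i (x i)))"

section \<open>External tensor products and induction of representations\<close>

definition rep_tensor ::
    "('g, 'b) monoid_scheme \<Rightarrow> ('h, 'c) monoid_scheme \<Rightarrow>
     ('g \<Rightarrow> 'k :: {comm_ring, comm_monoid_mult}, 'v) module \<Rightarrow> ('h \<Rightarrow> 'k, 'w) module \<Rightarrow>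
     ('g \<times> 'h \<Rightarrow> 'k, ('v \<times> 'w \<Rightarrow> 'k) set) module"
  \<comment> \<open>the representation \<open>V \<otimes> W\<close> of \<open>G \<times> H\<close>\<close>
  where "rep_tensor G H V W =
    (let M = underlying G V; N = underlying H W; \<rho> = (\<lambda>v c. c \<odot>\<^bsub>M\<^esub> v)
     in linearize (G \<times>\<times> H) (tensor UNIV M \<rho> N)
          (\<lambda>(g, h). tensor_map UNIV M \<rho> N (\<lambda>v. single g \<odot>\<^bsub>V\<^esub> v) (\<lambda>w. single h \<odot>\<^bsub>W\<^esub> w)))"

definition rep_mtensor ::
    "'i set \<Rightarrow> ('i \<Rightarrow> ('g, 'b) monoid_scheme) \<Rightarrow>
     ('i \<Rightarrow> ('g \<Rightarrow> 'k :: {comm_ring, comm_monoid_mult}, 'v) module) \<Rightarrow>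
     (('i \<Rightarrow> 'g) \<Rightarrow> 'k, (('i \<Rightarrow> 'v) \<Rightarrow> 'k) set) module"
  \<comment> \<open>the representation \<open>\<Otimes>\<^sub>i V i\<close> of the direct product of the groups \<open>G i\<close>\<close>
  where "rep_mtensor I G V =
    (let M = (\<lambda>i. underlying (G i) (V i))
     in linearize (product_group I G) (mtensor I M)
          (\<lambda>g. mtensor_map I M (\<lambda>i v. single (g i) \<odot>\<^bsub>V i\<^esub> v)))"

text \<open>
  \<open>\<k>[G] \<otimes>\<^bsub>\<k>[H]\<^esub> V\<close>, where \<open>H\<close> is embedded in \<open>G\<close> by the injective homomorphism \<open>\<phi>\<close>: the right action
  of \<open>r \<in> \<k>[H]\<close> on \<open>\<k>[G]\<close> is the multiplication by the image of \<open>r\<close> in \<open>\<k>[G]\<close>.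
\<close>

definition Ind ::
    "('h, 'b) monoid_scheme \<Rightarrow> ('g, 'c) monoid_scheme \<Rightarrow> ('h \<Rightarrow> 'g) \<Rightarrow>
     ('h \<Rightarrow> 'k :: {comm_ring, comm_monoid_mult}, 'v) module \<Rightarrow>
     ('g \<Rightarrow> 'k, (('g \<Rightarrow> 'k) \<times> 'v \<Rightarrow> 'k) set) module"
  where "Ind H G \<phi> V =
    (let A = carrier (group_alg H);
         M = underlying G (group_alg G);
         \<rho> = (\<lambda>q r. q \<otimes>\<^bsub>group_alg G\<^esub> push \<phi> r);
         T = tensor A M \<rho> V
     in \<lparr>carrier = carrier T, mult = undefined, one = undefined, zero = \<zero>\<^bsub>T\<^esub>, add = add T,
         smult = (\<lambda>r. tensor_map A M \<rho> V (\<lambda>q. r \<otimes>\<^bsub>group_alg G\<^esub> q) (\<lambda>v. v))\<rparr>)"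

section \<open>Representations of symmetric groups\<close>

definition triv_rep :: "nat \<Rightarrow> ((nat \<Rightarrow> nat) \<Rightarrow> 'k :: {comm_ring, comm_monoid_mult}, 'k) module"
  where "triv_rep p = linearize (sym_group p) ground_module (\<lambda>_ v. v)"

definition perm_rep ::
    "nat \<Rightarrow> ((nat \<Rightarrow> nat) \<Rightarrow> 'k :: {comm_ring, comm_monoid_mult}, nat \<Rightarrow> 'k) module"
  where "perm_rep p = linearize (sym_group p) (free_module {1..p}) push"

definition refl_quot_rep ::
    "nat \<Rightarrow> ((nat \<Rightarrow> nat) \<Rightarrow> 'k :: {comm_ring, comm_monoid_mult}, (nat \<Rightarrow> 'k) set) module"
  where "refl_quot_rep p =
    quot_module (perm_rep p) {(\<lambda>i. if i \<in> {1..p} then a else 0) | a. True}"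

definition block_offset :: "(nat \<Rightarrow> nat) \<Rightarrow> nat \<Rightarrow> nat"
  where "block_offset j k = (\<Sum>t\<in>{1..<k}. j t)"

definition block :: "(nat \<Rightarrow> nat) \<Rightarrow> nat \<Rightarrow> nat set"
  where "block j k = {block_offset j k + 1..block_offset j k + j k}"

definition parabolic :: "nat \<Rightarrow> (nat \<Rightarrow> nat) \<Rightarrow> (nat \<Rightarrow> nat \<Rightarrow> nat) \<Rightarrow> nat \<Rightarrow> nat"
  \<comment> \<open>the blocks are disjoint, so \<open>k\<close> is unique if it exists\<close>
  where "parabolic m j \<sigma> x =
    (if \<exists>k\<in>{1..m}. x \<in> block j k
     then let k = (THE k. k \<in> {1..m} \<and> x \<in> block j k)
          in block_offset j k + \<sigma> k (x - block_offset j k)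
     else x)"

section \<open>The Fibonacci filtration\<close>

definition lacunar :: "nat set \<Rightarrow> bool"
  where "lacunar I \<longleftrightarrow> (\<forall>i. \<not> (i \<in> I \<and> i + 1 \<in> I))"

definition nonshadow :: "nat \<Rightarrow> nat set \<Rightarrow> nat set"
  where "nonshadow n I = {i \<in> {1..n - 1}. i \<notin> I \<and> i + 1 \<notin> I}"

definition F :: "nat \<Rightarrow> nat set \<Rightarrow> ((nat \<Rightarrow> nat) \<Rightarrow> 'k :: {comm_ring, comm_monoid_mult}) set"
  where "F n I = {q \<in> carrier (group_alg (sym_group n)).
    \<forall>i \<in> nonshadow n I. q \<otimes>\<^bsub>group_alg (sym_group n)\<^esub> single (transpose i (i + 1)) = q}"

definition F_filt ::
    "nat \<Rightarrow> (nat \<Rightarrow> nat set) \<Rightarrow> nat \<Rightarrow> ((nat \<Rightarrow> nat) \<Rightarrow> 'k :: {comm_ring, comm_monoid_mult}) set"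
  \<comment> \<open>the sum \<open>F(Q\<^sub>1) + \<cdots> + F(Q\<^sub>i)\<close> of submodules\<close>
  where "F_filt n Q i = {\<Sum>t\<in>{1..i}. q t | q. \<forall>t\<in>{1..i}. q t \<in> F n (Q t)}"

end

theory Submission
  imports Defs
begin

text \<open>
  Let \<open>A = \<k>[S\<^sub>n]\<close> and \<open>I = Q\<^sub>i\<close>.  A permutation \<open>w\<close> is read as the word \<open>w(1) \<dots> w(n)\<close>, so that right
  multiplication by \<open>s\<^sub>l\<close> exchanges the letters at the positions \<open>l\<close> and \<open>l + 1\<close>.  The elements of \<open>I\<close> are
  the first positions of all blocks \<open>[i\<^sub>k\<^sub>-\<^sub>1, i\<^sub>k - 1]\<close> with \<open>k \<ge> 2\<close>, and \<open>F(I)\<close> consists of the functions on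
  words that do not change when letters are permuted within a block, the letters at the positions
  in \<open>I\<close> staying in place.

  The proof exhibits both sides as cyclic \<open>A\<close>-modules and shows that the two generators have the same
  annihilator, namely \<open>{p. p\<xi> = 0}\<close> with
  \<open>\<xi> = e \<Prod>\<^bsub>i \<in> I\<^esub> (1 - s\<^sub>i)\<close>, where \<open>e\<close> is the sum of the Young subgroup that fixes \<open>F(I)\<close>.

  \<^item> The filtration.  Here \<open>F(I) = Ae\<close>, so the class of \<open>e\<close> generates \<open>F\<^sub>i/F\<^sub>i\<^sub>-\<^sub>1\<close>.  Right multiplication by
    \<open>\<Prod>\<^bsub>i \<in> I\<^esub> (1 - s\<^sub>i)\<close> kills \<open>F(J)\<close> for every lacunar \<open>J \<noteq> I\<close> with \<open>sum J \<le> sum I\<close>: otherwise every \<open>i \<in> I\<close> would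
    satisfy \<open>i \<in> J\<close> or \<open>i + 1 \<in> J\<close>, and this forces \<open>sum I < sum J\<close> (\<open>lacunar_sum_less\<close>).  Hence
    \<open>pe \<in> F\<^sub>i\<^sub>-\<^sub>1\<close> implies \<open>p\<xi> = 0\<close>.

  \<^item> The induced representation.  It is generated by \<open>1 \<otimes> (1 \<otimes> e\<^sub>1 \<otimes> \<dots> \<otimes> e\<^sub>1)\<close>, since the factors of the
    parabolic subgroup move \<open>e\<^sub>1\<close> to all basis vectors.  A difference \<open>v(a) - v(b)\<close> of two coordinates is
    well defined on a reflection quotient; products of such differences yield an \<open>A\<close>-linear map to
    \<open>A\<close> that takes the generator to \<open>\<xi>\<close>.  So \<open>p\<xi> = 0\<close> for every \<open>p\<close> that annihilates the generator.

  \<^item> The converse is the same argument on both sides (\<open>annihilator_eq\<close>).  Both annihilators contain the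
    elements \<open>g - g s\<^sub>l\<close> where neither \<open>l\<close> nor \<open>l + 1\<close> is in \<open>I\<close>, and the sums \<open>\<Sum>\<^sub>a g (i a)\<close> over the block with
    first position \<open>i \<in> I\<close>.  In the induced representation the latter holds because \<open>e\<^sub>1 + \<dots> + e\<^sub>p = 0\<close> in
    \<open>Z\<^sub>p\<close>, in the filtration because \<open>\<Sum>\<^sub>a (i a) e\<close> is also fixed by \<open>s\<^sub>i\<close> and hence lies in some \<open>F(L)\<close> with
    \<open>L\<close> lacunar and \<open>sum L < sum I\<close> (\<open>lacunar_refinement\<close>).  Modulo these elements, every \<open>p \<in> A\<close> is congruent
    to a combination of words that increase at all positions \<open>l\<close> as above and decrease at all
    \<open>i \<in> I\<close> (\<open>reduction\<close>).  For such a combination the coefficient of every such word in \<open>p\<xi>\<close> equals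
    its coefficient in \<open>p\<close> (\<open>conv_xi_B\<close>), so \<open>p\<xi> = 0\<close> only if the reduced \<open>p\<close> is \<open>0\<close>.
\<close>

section \<open>Free modules\<close>

lemma free_module_simps [simp]:
  "zero (free_module X) = 0" "add (free_module X) = (+)"
  "smult (free_module X) = (\<lambda>c f x. c * f x)"
  by (simp_all add: free_module_def)

abbreviation free :: "'x set \<Rightarrow> ('x \<Rightarrow> 'k :: {comm_ring, comm_monoid_mult}) set"
  where "free X \<equiv> carrier (free_module X)"

lemma mem_free_module:
  "f \<in> free X \<longleftrightarrow> finite {x. f x \<noteq> 0} \<and> {x. f x \<noteq> 0} \<subseteq> X"
  by (simp add: free_module_def)

lemma zero_in_free [simp]: "0 \<in> free X"
  by (simp add: mem_free_module)

lemma single_in_free [simp]: "x \<in> X \<Longrightarrow> single x \<in> free X"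
  by (auto simp: mem_free_module single_def intro: finite_subset[of _ "{x}"])

lemma add_in_free [simp]:
  assumes "f \<in> free X" "g \<in> free X"
  shows "f + g \<in> free X"
proof -
  have "{x. (f + g) x \<noteq> 0} \<subseteq> {x. f x \<noteq> 0} \<union> {x. g x \<noteq> 0}" by auto
  then show ?thesis using assms unfolding mem_free_module by (meson finite_Un finite_subset le_sup_iff order_trans)
qed

lemma diff_in_free [simp]:
  assumes "f \<in> free X" "g \<in> free X"
  shows "f - g \<in> free X"
proof -
  have "{x. (f - g) x \<noteq> 0} \<subseteq> {x. f x \<noteq> 0} \<union> {x. g x \<noteq> 0}" by auto
  then show ?thesis using assms unfolding mem_free_module by (meson finite_Un finite_subset le_sup_iff order_trans)
qed

lemma scale_in_free [simp]:
  assumes "f \<in> free X"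
  shows "(\<lambda>x. c * f x) \<in> free X"
  using assms unfolding mem_free_module by (auto intro: finite_subset[of _ "{x. f x \<noteq> 0}"])

lemma sum_in_free:
  assumes "\<And>a. a \<in> D \<Longrightarrow> f a \<in> free X"
  shows "(\<Sum>a\<in>D. f a) \<in> free X"
  using assms by (induction D rule: infinite_finite_induct) (simp_all del: plus_fun_apply zero_fun_apply)

text \<open>
  The step adds one multiple of a basis element, which is the form in which additivity and
  homogeneity of a construction are available.
\<close>

lemma free_induct [consumes 1, case_names zero step]:
  fixes f :: "'x \<Rightarrow> 'k :: {comm_ring, comm_monoid_mult}"
  assumes f: "f \<in> free X" and z: "P 0"
    and step: "\<And>f x c. f \<in> free X \<Longrightarrow> P f \<Longrightarrow> x \<in> X \<Longrightarrow> P (f + (\<lambda>y. c * single x y))"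
  shows "P f"
proof -
  have "P f" if "finite D" "{x. f x \<noteq> 0} \<subseteq> D" "D \<subseteq> X" for D and f :: "'x \<Rightarrow> 'k"
    using that
  proof (induction D arbitrary: f rule: finite_induct)
    case empty
    then have "f = 0" by (auto simp: fun_eq_iff)
    then show "P f" using z by simp
  next
    case (insert a D)
    (* Splitting off the value at a leaves a function with smaller support. *)
    let ?g = "f(a := 0)"
    have g: "{x. ?g x \<noteq> 0} \<subseteq> D" using insert.prems by auto
    have "P ?g" by (rule insert.IH) (use g insert.prems in auto)
    moreover have "?g \<in> free X"
      unfolding mem_free_module
    proof
      show "finite {x. ?g x \<noteq> 0}" using finite_subset[OF g insert.hyps(1)] .
      show "{x. ?g x \<noteq> 0} \<subseteq> X" using g insert.prems(2) by blast
    qed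
    ultimately have "P (?g + (\<lambda>y. f a * single a y))" using step insert.prems by simp
    moreover have "?g + (\<lambda>y. f a * single a y) = f" by (auto simp: fun_eq_iff single_def)
    ultimately show "P f" by simp
  qed
  from this[of "{x. f x \<noteq> 0}" f] show ?thesis using f by (simp add: mem_free_module)
qed

text \<open>
  All maps out of tensor products that occur below are assembled from linear functionals with values
  in \<open>\<k>\<close>; so linear extension is needed only for \<open>\<k>\<close>-valued functions on the basis.
\<close>

definition lin_ext :: "('x \<Rightarrow> 'k) \<Rightarrow> ('x \<Rightarrow> 'k) \<Rightarrow> 'k :: {comm_ring, comm_monoid_mult}"
  where "lin_ext \<phi> f = (\<Sum>x | f x \<noteq> 0. f x * \<phi> x)"

lemma lin_ext_superset:
  assumes "finite D" "{x. f x \<noteq> 0} \<subseteq> D"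
  shows "lin_ext \<phi> f = (\<Sum>x\<in>D. f x * \<phi> x)"
  unfolding lin_ext_def by (rule sum.mono_neutral_left) (use assms in auto)

lemma lin_ext_zero [simp]: "lin_ext \<phi> 0 = 0"
  by (simp add: lin_ext_def)

lemma lin_ext_add:
  assumes "f \<in> free X" "g \<in> free X"
  shows "lin_ext \<phi> (f + g) = lin_ext \<phi> f + lin_ext \<phi> g"
proof -
  let ?D = "{x. f x \<noteq> 0} \<union> {x. g x \<noteq> 0}"
  have D: "finite ?D" using assms by (simp add: mem_free_module)
  have "lin_ext \<phi> (f + g) = (\<Sum>x\<in>?D. (f + g) x * \<phi> x)" by (rule lin_ext_superset[OF D]) auto
  also have "\<dots> = (\<Sum>x\<in>?D. f x * \<phi> x) + (\<Sum>x\<in>?D. g x * \<phi> x)"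
    by (simp add: distrib_right sum.distrib)
  also have "(\<Sum>x\<in>?D. f x * \<phi> x) = lin_ext \<phi> f" by (rule lin_ext_superset[OF D, symmetric]) auto
  also have "(\<Sum>x\<in>?D. g x * \<phi> x) = lin_ext \<phi> g" by (rule lin_ext_superset[OF D, symmetric]) auto
  finally show ?thesis .
qed

lemma lin_ext_scale:
  assumes "f \<in> free X"
  shows "lin_ext \<phi> (\<lambda>x. c * f x) = c * lin_ext \<phi> f"
proof -
  let ?D = "{x. f x \<noteq> 0}"
  have D: "finite ?D" using assms by (simp add: mem_free_module)
  have "lin_ext \<phi> (\<lambda>x. c * f x) = (\<Sum>x\<in>?D. c * f x * \<phi> x)" by (rule lin_ext_superset[OF D]) auto
  then show ?thesis by (simp add: lin_ext_def sum_distrib_left mult.assoc)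
qed

lemma lin_ext_diff:
  assumes "f \<in> free X" "g \<in> free X"
  shows "lin_ext \<phi> (f - g) = lin_ext \<phi> f - lin_ext \<phi> g"
  using lin_ext_add[of "f - g" X g \<phi>] assms by simp

lemma lin_ext_single [simp]: "lin_ext \<phi> (single x) = \<phi> x"
proof -
  have "lin_ext \<phi> (single x) = (\<Sum>y\<in>{x}. single x y * \<phi> y)"
    by (rule lin_ext_superset) (auto simp: single_def)
  then show ?thesis by (simp add: single_def)
qed

text \<open>
  Reduces the properties of \<^const>\<open>push\<close> to those of linear extension.
\<close>

lemma push_eq_lin_ext: "push h f y = lin_ext (\<lambda>x. single (h x) y) f" if "f \<in> free X"
proof -
  have fin: "finite {x. f x \<noteq> 0}" using that by (simp add: mem_free_module)
  have "push h f y = (\<Sum>x | f x \<noteq> 0. if h x = y then f x else 0)"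
    unfolding push_def by (subst sum.If_cases[OF fin]) (simp add: Collect_conj_eq)
  also have "\<dots> = lin_ext (\<lambda>x. single (h x) y) f"
    unfolding lin_ext_def by (rule sum.cong) (auto simp: single_def)
  finally show ?thesis .
qed

lemma push_single [simp]: "push h (single x :: _ \<Rightarrow> 'k :: {comm_ring, comm_monoid_mult}) = single (h x)"
  by (rule ext) (subst push_eq_lin_ext[of _ UNIV], auto)

lemma push_zero [simp]: "push h 0 = 0"
  by (simp add: push_def fun_eq_iff)

lemma push_add:
  assumes "f \<in> free X" "g \<in> free X"
  shows "push h (f + g) = push h f + push h g"
  by (rule ext) (simp add: push_eq_lin_ext[of _ X] lin_ext_add[of _ X] assms)

lemma push_diff:
  assumes "f \<in> free X" "g \<in> free X"
  shows "push h (f - g) = push h f - push h g"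
  by (rule ext) (simp add: push_eq_lin_ext[of _ X] lin_ext_diff[of _ X] assms)

lemma push_scale:
  assumes "f \<in> free X"
  shows "push h (\<lambda>x. c * f x) = (\<lambda>x. c * push h f x)"
  by (rule ext) (simp add: push_eq_lin_ext[of _ X] lin_ext_scale[of _ X] assms)

lemma push_in_free:
  assumes f: "f \<in> free X" and h: "\<And>x. x \<in> X \<Longrightarrow> h x \<in> Y"
  shows "push h f \<in> free Y"
  using f
proof (induction rule: free_induct)
  case zero
  show "push h 0 \<in> free Y" by simp
next
  case (step f x c)
  then show "push h (f + (\<lambda>y. c * single x y)) \<in> free Y"
    by (simp add: push_add[of _ X] push_scale[of _ X] h)
qed

lemma lin_ext_push:
  assumes f: "f \<in> free X"
  shows "lin_ext \<phi> (push h f) = lin_ext (\<lambda>x. \<phi> (h x)) f"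
  using f
proof (induction rule: free_induct)
  case (step f x c)
  have "push h f \<in> free UNIV" using push_in_free[OF step(1)] by blast
  then show "lin_ext \<phi> (push h (f + (\<lambda>y. c * single x y))) = lin_ext (\<lambda>x. \<phi> (h x)) (f + (\<lambda>y. c * single x y))"
    using step
    by (simp add: push_add[of _ X] push_scale[of _ X] lin_ext_add[of _ X] lin_ext_add[of _ UNIV]
        lin_ext_scale[of _ X] lin_ext_scale[of _ UNIV])
next
  case zero
  show "lin_ext \<phi> (push h 0) = lin_ext (\<lambda>x. \<phi> (h x)) 0" by simp
qed

lemma lin_ext_cong:
  assumes "\<And>x. x \<in> X \<Longrightarrow> \<phi> x = \<psi> x" and "f \<in> free X"
  shows "lin_ext \<phi> f = lin_ext \<psi> f"
  using assms unfolding lin_ext_def mem_free_module by (auto intro!: sum.cong)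

section \<open>Additive subgroups and their cosets\<close>

definition add_subgp :: "'v :: ab_group_add set \<Rightarrow> bool"
  where "add_subgp N \<longleftrightarrow> 0 \<in> N \<and> (\<forall>x\<in>N. \<forall>y\<in>N. x - y \<in> N)"

lemma add_subgpD:
  assumes "add_subgp N"
  shows "0 \<in> N" "x \<in> N \<Longrightarrow> y \<in> N \<Longrightarrow> x - y \<in> N" "x \<in> N \<Longrightarrow> y \<in> N \<Longrightarrow> x + y \<in> N"
    "x \<in> N \<Longrightarrow> - x \<in> N"
proof -
  show z: "0 \<in> N" and d: "\<And>x y. x \<in> N \<Longrightarrow> y \<in> N \<Longrightarrow> x - y \<in> N"
    using assms by (auto simp: add_subgp_def)
  show n: "- x \<in> N" if "x \<in> N" for x using d[OF z that] by simp
  show "x + y \<in> N" if "x \<in> N" "y \<in> N" using d[OF that(1) n[OF that(2)]] by simp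
qed

text \<open>
  All quotients are taken in modules whose addition is pointwise addition of functions; for them
  this set is the coset \<open>N + x\<close> of the record-based theory (\<open>a_r_coset_coset\<close>), and \<open>N\<close> itself is the zero.
\<close>

definition coset :: "'v :: ab_group_add set \<Rightarrow> 'v \<Rightarrow> 'v set"
  where "coset N x = (\<lambda>h. h + x) ` N"

lemma mem_coset: "y \<in> coset N x \<longleftrightarrow> y - x \<in> N"
  unfolding coset_def by (force simp: image_iff algebra_simps)

lemma coset_eq_iff: "add_subgp N \<Longrightarrow> coset N x = coset N y \<longleftrightarrow> x - y \<in> N"
proof
  assume N: "add_subgp N" and "coset N x = coset N y"
  then show "x - y \<in> N" by (metis add_subgpD(1) cancel_comm_monoid_add_class.diff_cancel mem_coset)
next
  assume N: "add_subgp N" and xy: "x - y \<in> N"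
  have "z - x \<in> N \<longleftrightarrow> z - y \<in> N" for z
    using add_subgpD(3)[OF N xy, of "z - x"] add_subgpD(2)[OF N _ xy, of "z - y"]
    by (auto simp: algebra_simps)
  then show "coset N x = coset N y" by (auto simp: mem_coset)
qed

lemma coset_zero [simp]: "coset N 0 = N"
  by (auto simp: coset_def)

lemma a_r_coset_coset: "add M = (+) \<Longrightarrow> N +>\<^bsub>M\<^esub> x = coset N x"
  by (auto simp: a_r_coset_def r_coset_def coset_def)

lemma quot_carrier:
  assumes "add M = (+)"
  shows "carrier (quot_module M N) = coset N ` carrier M"
  using a_r_coset_coset[OF assms, of N]
  unfolding quot_module_def A_RCOSETS_def RCOSETS_def a_r_coset_def by auto

lemma quot_zero: "zero (quot_module M N) = N"
  by (simp add: quot_module_def)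

lemma quot_add:
  assumes N: "add_subgp N" and M: "add M = (+)"
  shows "coset N x \<oplus>\<^bsub>quot_module M N\<^esub> coset N y = coset N (x + y)"
proof -
  have "set_add M (coset N x) (coset N y) = coset N (x + y)" (is "?l = ?r")
  proof (intro equalityI subsetI)
    fix z assume "z \<in> ?l"
    then obtain a b where "a \<in> N" "b \<in> N" "z = (a + x) + (b + y)"
      by (auto simp: set_add_def set_mult_def M coset_def)
    then have "z - (x + y) = a + b" by (simp add: algebra_simps)
    then show "z \<in> ?r" using add_subgpD(3)[OF N \<open>a \<in> N\<close> \<open>b \<in> N\<close>] by (simp add: mem_coset)
  next
    fix z assume "z \<in> ?r"
    then obtain a where "a \<in> N" "z = a + (x + y)" by (auto simp: coset_def)
    then have "z = (a + x) + (0 + y)" by (simp add: algebra_simps)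
    moreover have "a + x \<in> coset N x" "0 + y \<in> coset N y"
      using \<open>a \<in> N\<close> add_subgpD(1)[OF N] by (simp_all add: mem_coset)
    ultimately show "z \<in> ?l" unfolding set_add_def set_mult_def by (auto simp: M)
  qed
  then show ?thesis by (simp add: quot_module_def)
qed

text \<open>
  The induced map on cosets takes a union over the whole coset; it collapses to one coset as soon as
  \<open>f\<close> moves by elements of \<open>N\<close> along the coset of \<open>x\<close>.
\<close>

lemma coset_map_coset:
  assumes N: "add_subgp N" and M: "add M = (+)"
    and f: "\<And>h. h \<in> N \<Longrightarrow> f (h + x) - f x \<in> N"
  shows "coset_map M N f (coset N x) = coset N (f x)"
proof -
  have "N +>\<^bsub>M\<^esub> f y = coset N (f x)" if "y \<in> coset N x" for y
  proof -
    from that obtain h where "h \<in> N" "y = h + x" by (auto simp: coset_def)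
    then show ?thesis using f[of h] by (simp add: a_r_coset_coset[OF M] coset_eq_iff[OF N])
  qed
  moreover have "x \<in> coset N x" using add_subgpD(1)[OF N] by (simp add: mem_coset)
  ultimately show ?thesis unfolding coset_map_def by blast
qed

lemma quot_smult_coset:
  assumes N: "add_subgp N" and M: "add M = (+)"
    and f: "\<And>h. h \<in> N \<Longrightarrow> (r \<odot>\<^bsub>M\<^esub> (h + x)) - (r \<odot>\<^bsub>M\<^esub> x) \<in> N"
  shows "r \<odot>\<^bsub>quot_module M N\<^esub> coset N x = coset N (r \<odot>\<^bsub>M\<^esub> x)"
  using coset_map_coset[OF N M, of "\<lambda>x. r \<odot>\<^bsub>M\<^esub> x"] f by (simp add: quot_module_def)

lemma quot_abelian_monoid:
  assumes N: "add_subgp N" and M: "add M = (+)"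
    and cl: "0 \<in> carrier M" "\<And>x y. x \<in> carrier M \<Longrightarrow> y \<in> carrier M \<Longrightarrow> x + y \<in> carrier M"
  shows "abelian_monoid (quot_module M N)"
proof (rule abelian_monoidI)
  let ?Q = "quot_module M N"
  note qc = quot_carrier[OF M] and qa = quot_add[OF N M]
  have z: "\<zero>\<^bsub>?Q\<^esub> = coset N 0" by (simp add: quot_zero)
  show "\<zero>\<^bsub>?Q\<^esub> \<in> carrier ?Q" unfolding z qc using cl(1) by blast
  show "x \<oplus>\<^bsub>?Q\<^esub> y \<in> carrier ?Q" if "x \<in> carrier ?Q" "y \<in> carrier ?Q" for x y
    using that cl(2) unfolding qc by (auto simp: qa)
  show "x \<oplus>\<^bsub>?Q\<^esub> y \<oplus>\<^bsub>?Q\<^esub> w = x \<oplus>\<^bsub>?Q\<^esub> (y \<oplus>\<^bsub>?Q\<^esub> w)"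
    if "x \<in> carrier ?Q" "y \<in> carrier ?Q" "w \<in> carrier ?Q" for x y w
    using that unfolding qc by (auto simp: qa add.assoc)
  show "\<zero>\<^bsub>?Q\<^esub> \<oplus>\<^bsub>?Q\<^esub> x = x" if "x \<in> carrier ?Q" for x
    using that unfolding qc z by (auto simp: qa simp del: coset_zero)
  show "x \<oplus>\<^bsub>?Q\<^esub> y = y \<oplus>\<^bsub>?Q\<^esub> x" if "x \<in> carrier ?Q" "y \<in> carrier ?Q" for x y
    using that unfolding qc by (auto simp: qa add.commute)
qed

text \<open>
  Evaluates \<open>f\<close> at an arbitrary representative, so it is the map induced by \<open>f\<close> on those cosets on which
  \<open>f\<close> is constant.
\<close>

definition coset_val :: "('v \<Rightarrow> 'w) \<Rightarrow> 'v set \<Rightarrow> 'w"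
  where "coset_val f X = f (SOME x. x \<in> X)"

lemma coset_val_coset:
  assumes N: "add_subgp N" and f: "\<And>h. h \<in> N \<Longrightarrow> f (h + x) = f x"
  shows "coset_val f (coset N x) = f x"
proof -
  have "x \<in> coset N x" using add_subgpD(1)[OF N] by (simp add: mem_coset)
  then have "(SOME x'. x' \<in> coset N x) \<in> coset N x" by (rule someI)
  then show ?thesis using f unfolding coset_val_def coset_def by auto
qed

section \<open>Spans in free modules\<close>

lemma lin_span_free:
  assumes "S \<subseteq> free X"
  shows "lin_span (free_module X) S \<subseteq> free X"
proof
  fix x assume "x \<in> lin_span (free_module X) S"
  then show "x \<in> free X"
  proof induction
    case zero
    show "\<zero>\<^bsub>free_module X\<^esub> \<in> free X" by simp
  next
    case (step x s c)
    then show "x \<oplus>\<^bsub>free_module X\<^esub> c \<odot>\<^bsub>free_module X\<^esub> s \<in> free X"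
      using assms by auto
  qed
qed

lemma lin_span_base:
  assumes "s \<in> S"
  shows "s \<in> lin_span (free_module X) S"
  using lin_span.step[OF lin_span.zero assms, of "free_module X" 1] by simp

lemma lin_span_add:
  assumes "x \<in> lin_span (free_module X) S" "y \<in> lin_span (free_module X) S"
  shows "x + y \<in> lin_span (free_module X) S"
  using assms(2)
proof induction
  case zero
  then show "x + \<zero>\<^bsub>free_module X\<^esub> \<in> lin_span (free_module X) S" using assms(1) by simp
next
  case (step y s c)
  have "x + y \<in> lin_span (free_module X) S" by (rule step(3))
  from lin_span.step[OF this step(2), of c]
  show "x + (y \<oplus>\<^bsub>free_module X\<^esub> c \<odot>\<^bsub>free_module X\<^esub> s) \<in> lin_span (free_module X) S"
    by (simp add: add.assoc)
qed

lemma lin_span_scale: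
  assumes "x \<in> lin_span (free_module X) S"
  shows "(\<lambda>z. c * x z) \<in> lin_span (free_module X) S"
  using assms
proof induction
  case zero
  have "(\<lambda>z. c * (0 :: 'a \<Rightarrow> 'b) z) = 0" by (simp add: fun_eq_iff)
  then show "(\<lambda>z. c * (\<zero>\<^bsub>free_module X\<^esub> :: 'a \<Rightarrow> 'b) z) \<in> lin_span (free_module X) S"
    using lin_span.zero[of "free_module X" S] by simp
next
  case (step x s d)
  have "(\<lambda>z. c * (x + (\<lambda>z. d * s z)) z) = (\<lambda>z. c * x z) + (\<lambda>z. (c * d) * s z)"
    by (simp add: fun_eq_iff distrib_left mult.assoc)
  then show "(\<lambda>z. c * (x \<oplus>\<^bsub>free_module X\<^esub> d \<odot>\<^bsub>free_module X\<^esub> s) z) \<in> lin_span (free_module X) S"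
    using lin_span.step[OF step(3,2), of "c * d"] by simp
qed

text \<open>
  The coefficients run through the whole ring, so negation is scaling by \<open>- 1\<close>.
\<close>

lemma lin_span_subgp: "add_subgp (lin_span (free_module X) S)"
  unfolding add_subgp_def
proof (intro conjI ballI)
  show "0 \<in> lin_span (free_module X) S" using lin_span.zero[of "free_module X" S] by simp
  fix x y assume "x \<in> lin_span (free_module X) S" and y: "y \<in> lin_span (free_module X) S"
  moreover have "- y = (\<lambda>z. (- 1) * y z)" by (simp add: fun_eq_iff)
  ultimately show "x - y \<in> lin_span (free_module X) S"
    using lin_span_add lin_span_scale[OF y, of "- 1"] by (metis diff_conv_add_uminus)
qed

lemma lin_span_lin_ext:
  assumes "S \<subseteq> free X" and "\<And>s. s \<in> S \<Longrightarrow> lin_ext \<phi> s = 0"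
    and "x \<in> lin_span (free_module X) S"
  shows "lin_ext \<phi> x = 0"
  using assms(3)
proof induction
  case (step x s c)
  then have "x \<in> free X" "s \<in> free X"
    using lin_span_free assms(1) by blast+
  then show "lin_ext \<phi> (x \<oplus>\<^bsub>free_module X\<^esub> c \<odot>\<^bsub>free_module X\<^esub> s) = 0"
    using step assms(2) by (simp add: lin_ext_add[of _ X] lin_ext_scale[of _ X])
next
  case zero
  show "lin_ext \<phi> \<zero>\<^bsub>free_module X\<^esub> = 0" by simp
qed

lemma lin_span_push:
  assumes S: "S \<subseteq> free X" and "\<And>s. s \<in> S \<Longrightarrow> push h s \<in> lin_span (free_module Y) S'"
    and "x \<in> lin_span (free_module X) S"
  shows "push h x \<in> lin_span (free_module Y) S'"
  using assms(3)
proof induction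
  case zero
  then show "push h \<zero>\<^bsub>free_module X\<^esub> \<in> lin_span (free_module Y) S'"
    using lin_span.zero[of "free_module Y" S'] by simp
next
  case (step x s c)
  then have "x \<in> free X" "s \<in> free X"
    using lin_span_free S by blast+
  then show "push h (x \<oplus>\<^bsub>free_module X\<^esub> c \<odot>\<^bsub>free_module X\<^esub> s) \<in> lin_span (free_module Y) S'"
    using step assms(2)
    by (simp add: push_add[of _ X] push_scale[of _ X] lin_span_add lin_span_scale)
qed

lemma coset_val_lin_ext_coset:
  assumes "S \<subseteq> free X" and "\<And>s. s \<in> S \<Longrightarrow> lin_ext \<phi> s = 0"
    and "f \<in> free X"
  shows "coset_val (lin_ext \<phi>) (coset (lin_span (free_module X) S) f) = lin_ext \<phi> f"
proof (rule coset_val_coset[OF lin_span_subgp])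
  fix h assume h: "h \<in> lin_span (free_module X) S"
  then have "h \<in> free X" using lin_span_free[OF assms(1)] by blast
  then show "lin_ext \<phi> (h + f) = lin_ext \<phi> f"
    using lin_span_lin_ext[OF assms(1,2) h] assms(3) by (simp add: lin_ext_add[of _ X])
qed

lemma coset_map_push:
  assumes S: "S \<subseteq> free X"
    and h: "\<And>s. s \<in> S \<Longrightarrow> push h s \<in> lin_span (free_module X) S"
    and f: "f \<in> free X"
  shows "coset_map (free_module X) (lin_span (free_module X) S) (push h)
      (coset (lin_span (free_module X) S) f) = coset (lin_span (free_module X) S) (push h f)"
proof (rule coset_map_coset[OF lin_span_subgp])
  fix z assume z: "z \<in> lin_span (free_module X) S"
  then have "z \<in> free X" using lin_span_free[OF S] by blast
  then show "push h (z + f) - push h f \<in> lin_span (free_module X) S"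
    using lin_span_push[OF S h z] f by (simp add: push_add[of _ X])
qed simp

lemma quot_smult_free:
  "c \<odot>\<^bsub>quot_module (free_module X) (lin_span (free_module X) S)\<^esub> coset (lin_span (free_module X) S) f
   = coset (lin_span (free_module X) S) (\<lambda>x. c * f x)"
proof -
  have "(\<lambda>x. c * (h + f) x) - (\<lambda>x. c * f x) = (\<lambda>x. c * h x)" for h
    by (simp add: fun_eq_iff algebra_simps)
  then show ?thesis
    by (subst quot_smult_coset[OF lin_span_subgp]) (auto intro: lin_span_scale)
qed

section \<open>Linearized group actions\<close>

lemma finsum_single:
  assumes M: "abelian_monoid M" and fin: "finite D" and g: "g \<in> D" and v: "v \<in> carrier M"
    and f: "\<And>h. h \<in> D \<Longrightarrow> f h = (if h = g then v else \<zero>\<^bsub>M\<^esub>)"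
  shows "finsum M f D = v"
proof -
  interpret abelian_monoid M by (rule M)
  have "finsum M f D = finsum M (\<lambda>h. if g = h then v else \<zero>\<^bsub>M\<^esub>) D"
    by (rule finsum_cong') (use f v in auto)
  also have "\<dots> = v" using finsum_singleton[OF g fin, of "\<lambda>_. v"] v by simp
  finally show ?thesis .
qed

text \<open>
  A multiple of a single group element acts by that group element alone, because the finite sum that
  defines the action has at most one nonzero term.
\<close>

lemma linearize_single:
  fixes G :: "('g, 'b) monoid_scheme"
  assumes M: "abelian_monoid M" and fin: "finite (carrier G)" and g: "g \<in> carrier G"
    and z: "\<And>h. h \<in> carrier G \<Longrightarrow> 0 \<odot>\<^bsub>M\<^esub> \<rho> h v = \<zero>\<^bsub>M\<^esub>"
    and cl: "c \<odot>\<^bsub>M\<^esub> \<rho> g v \<in> carrier M"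
  shows "(\<lambda>h. c * single g h) \<odot>\<^bsub>linearize G M \<rho>\<^esub> v = c \<odot>\<^bsub>M\<^esub> \<rho> g v"
  unfolding linearize_def
  by simp (rule finsum_single[OF M fin g cl], auto simp: single_def z)

lemma finsum_additive:
  fixes \<Phi> :: "'v \<Rightarrow> 'k :: {comm_ring, comm_monoid_mult}"
  assumes M: "abelian_monoid M" and "finite D" and "\<And>h. h \<in> D \<Longrightarrow> f h \<in> carrier M"
    and z: "\<Phi> \<zero>\<^bsub>M\<^esub> = 0"
    and a: "\<And>x y. x \<in> carrier M \<Longrightarrow> y \<in> carrier M \<Longrightarrow> \<Phi> (x \<oplus>\<^bsub>M\<^esub> y) = \<Phi> x + \<Phi> y"
  shows "\<Phi> (finsum M f D) = (\<Sum>h\<in>D. \<Phi> (f h))"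
proof -
  interpret abelian_monoid M by (rule M)
  show ?thesis using assms(2,3)
  proof (induction D rule: finite_induct)
    case empty
    then show ?case using z by simp
  next
    case (insert d D)
    then have "f \<in> D \<rightarrow> carrier M" "f d \<in> carrier M" by auto
    then show ?case using insert by (simp add: finsum_insert a)
  qed
qed

section \<open>The group algebra of the symmetric group\<close>

abbreviation Sym :: "nat \<Rightarrow> (nat \<Rightarrow> nat) set"
  where "Sym n \<equiv> carrier (sym_group n)"

lemma mem_Sym: "w \<in> Sym n \<longleftrightarrow> w permutes {1..n}"
  by (rule sym_group_carrier)

lemma finite_Sym [simp]: "finite (Sym n)"
proof -
  have "Sym n = {w. w permutes {1..n}}" by (auto simp: mem_Sym)
  then show ?thesis by (simp add: finite_permutations)
qed

lemma Sym_id [simp]: "id \<in> Sym n"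
  by (simp add: mem_Sym permutes_id)

lemma Sym_comp [simp]: "v \<in> Sym n \<Longrightarrow> w \<in> Sym n \<Longrightarrow> v \<circ> w \<in> Sym n"
  by (simp add: mem_Sym permutes_compose)

lemma Sym_inv [simp]: "w \<in> Sym n \<Longrightarrow> inv' w \<in> Sym n"
  by (simp add: mem_Sym permutes_inv)

lemma Sym_inv_o:
  assumes "w \<in> Sym n"
  shows "inv' w \<circ> w = id" "w \<circ> inv' w = id" "inv' w \<circ> (w \<circ> v) = v" "w \<circ> (inv' w \<circ> v) = v"
  using permutes_inv_o[of w "{1..n}"] assms by (simp_all add: mem_Sym comp_assoc[symmetric])

lemma Sym_transpose [simp]: "a \<in> {1..n} \<Longrightarrow> b \<in> {1..n} \<Longrightarrow> transpose a b \<in> Sym n"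
  by (simp add: mem_Sym permutes_swap_id)

lemma Sym_inj: "w \<in> Sym n \<Longrightarrow> w x = w y \<longleftrightarrow> x = y"
  using permutes_inj[of w "{1..n}"] by (auto simp: mem_Sym inj_eq)

lemma Sym_in: "w \<in> Sym n \<Longrightarrow> w x \<in> {1..n} \<longleftrightarrow> x \<in> {1..n}"
  using permutes_in_image[of w "{1..n}"] by (simp add: mem_Sym)

lemma Sym_out: "w \<in> Sym n \<Longrightarrow> x \<notin> {1..n} \<Longrightarrow> w x = x"
  using permutes_not_in[of w "{1..n}"] by (simp add: mem_Sym)

text \<open>
  The product of the group algebra with the second factor determined by the first, which avoids sums
  over pairs.
\<close>

definition conv ::
    "nat \<Rightarrow> ((nat \<Rightarrow> nat) \<Rightarrow> 'k) \<Rightarrow> ((nat \<Rightarrow> nat) \<Rightarrow> 'k) \<Rightarrow> (nat \<Rightarrow> nat) \<Rightarrow> 'k :: {comm_ring, comm_monoid_mult}"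
  where "conv n p q x = (if x \<in> Sym n then \<Sum>g\<in>Sym n. p g * q (inv' g \<circ> x) else 0)"

lemma group_alg_mult: "mult (group_alg (sym_group n)) = conv n"
proof (intro ext)
  fix p q :: "(nat \<Rightarrow> nat) \<Rightarrow> 'a" and x
  let ?D = "{(g, h). (g, h) \<in> Sym n \<times> Sym n \<and> g \<circ> h = x}"
  have "(\<Sum>(g, h)\<in>?D. p g * q h) = conv n p q x"
  proof (cases "x \<in> Sym n")
    case True
    have "(\<Sum>(g, h)\<in>?D. p g * q h) = (\<Sum>g\<in>Sym n. p g * q (inv' g \<circ> x))"
      by (rule sum.reindex_bij_witness[of _ "\<lambda>g. (g, inv' g \<circ> x)" fst])
        (use True in \<open>auto simp: Sym_inv_o\<close>)
    then show ?thesis using True by (simp add: conv_def)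
  next
    case False
    then have "?D = {}" by auto
    then have "(\<Sum>(g, h)\<in>?D. p g * q h) = 0" by (simp only: sum.empty)
    with False show ?thesis by (simp add: conv_def)
  qed
  then show "(p \<otimes>\<^bsub>group_alg (sym_group n)\<^esub> q) x = conv n p q x"
    by (simp add: group_alg_def sym_group_mult)
qed

lemma group_alg_smult: "smult (group_alg (sym_group n)) = conv n"
  using group_alg_mult by (simp add: group_alg_def)

lemma group_alg_simps [simp]:
  "carrier (group_alg G) = free (carrier G)"
  "add (group_alg G) = (+)" "zero (group_alg G) = 0"
  by (simp_all add: group_alg_def)

lemma mem_alg: "p \<in> free (Sym n) \<longleftrightarrow> (\<forall>x. x \<notin> Sym n \<longrightarrow> p x = 0)"
proof
  assume *: "\<forall>x. x \<notin> Sym n \<longrightarrow> p x = 0"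
  then have "{x. p x \<noteq> 0} \<subseteq> Sym n" by blast
  then show "p \<in> free (Sym n)"
    by (simp add: mem_free_module finite_subset[OF _ finite_Sym])
qed (auto simp: mem_free_module)

lemma conv_in_alg [simp]: "conv n p q \<in> free (Sym n)"
  by (simp add: mem_alg conv_def)

lemma conv_add_left: "conv n (p + p') q = conv n p q + conv n p' q"
  by (simp add: fun_eq_iff conv_def distrib_right sum.distrib)

lemma conv_diff_left: "conv n (p - p') q = conv n p q - conv n p' q"
  by (simp add: fun_eq_iff conv_def left_diff_distrib sum_subtractf)

lemma conv_add_right: "conv n p (q + q') = conv n p q + conv n p q'"
  by (simp add: fun_eq_iff conv_def distrib_left sum.distrib)

lemma conv_zero [simp]: "conv n 0 q = 0" "conv n p 0 = 0"
  by (simp_all add: fun_eq_iff conv_def)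

lemma conv_scale_left: "conv n (\<lambda>x. c * p x) q = (\<lambda>x. c * conv n p q x)"
  by (simp add: fun_eq_iff conv_def sum_distrib_left mult.assoc)

lemma conv_scale_right: "conv n p (\<lambda>x. c * q x) = (\<lambda>x. c * conv n p q x)"
  by (simp add: fun_eq_iff conv_def sum_distrib_left mult.left_commute)

lemma conv_single_left:
  assumes "g \<in> Sym n"
  shows "conv n (single g) q x = (if x \<in> Sym n then q (inv' g \<circ> x) else 0)"
proof -
  have "(\<Sum>h\<in>Sym n. single g h * q (inv' h \<circ> x)) = (\<Sum>h\<in>Sym n. if h = g then q (inv' g \<circ> x) else 0)"
    by (rule sum.cong) (auto simp: single_def)
  then show ?thesis using assms by (simp add: conv_def)
qed

lemma conv_single_right:
  assumes "s \<in> Sym n" "x \<in> Sym n"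
  shows "conv n p (single s) x = p (x \<circ> inv' s)"
proof -
  have *: "inv' h \<circ> x = s \<longleftrightarrow> h = x \<circ> inv' s" if "h \<in> Sym n" for h
    using that assms by (metis Sym_inv_o(1,2,4) comp_assoc comp_id)
  have "(\<Sum>h\<in>Sym n. p h * single s (inv' h \<circ> x)) = (\<Sum>h\<in>Sym n. if h = x \<circ> inv' s then p (x \<circ> inv' s) else 0)"
    by (rule sum.cong) (auto simp: single_def *)
  also have "\<dots> = p (x \<circ> inv' s)" using assms by simp
  finally show ?thesis using assms by (simp add: conv_def)
qed

lemma conv_single_single:
  assumes "g \<in> Sym n" "h \<in> Sym n"
  shows "conv n (single g) (single h) = (single (g \<circ> h) :: _ \<Rightarrow> 'k :: {comm_ring, comm_monoid_mult})"
proof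
  fix x
  have "inv' g \<circ> x = h \<longleftrightarrow> x = g \<circ> h" using assms by (metis Sym_inv_o(3,4))
  then have "(single h (inv' g \<circ> x) :: 'k) = single (g \<circ> h) x" by (simp add: single_def)
  moreover have "x \<notin> Sym n \<Longrightarrow> single (g \<circ> h) x = (0 :: 'k)"
    using Sym_comp[OF assms] by (auto simp: single_def)
  ultimately show "conv n (single g) (single h) x = (single (g \<circ> h) x :: 'k)"
    using assms(1) by (simp add: conv_single_left)
qed

lemma conv_assoc: "conv n (conv n p q) r = conv n p (conv n q r)"
proof
  fix x
  show "conv n (conv n p q) r x = conv n p (conv n q r) x"
  proof (cases "x \<in> Sym n")
    case True
    have "conv n (conv n p q) r x
        = (\<Sum>g\<in>Sym n. \<Sum>h\<in>Sym n. p h * q (inv' h \<circ> g) * r (inv' g \<circ> x))"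
      using True by (simp add: conv_def sum_distrib_right)
    also have "\<dots> = (\<Sum>h\<in>Sym n. \<Sum>g\<in>Sym n. p h * q (inv' h \<circ> g) * r (inv' g \<circ> x))"
      by (rule sum.swap)
    also have "\<dots> = (\<Sum>h\<in>Sym n. \<Sum>g\<in>Sym n. p h * (q g * r (inv' g \<circ> (inv' h \<circ> x))))"
    proof (rule sum.cong[OF refl])
      fix h assume h: "h \<in> Sym n"
      have inv_comp: "inv' (inv' h \<circ> g) \<circ> (inv' h \<circ> x) = inv' g \<circ> x" if "g \<in> Sym n" for g
      proof -
        have "bij g" "bij h" using that h by (auto simp: mem_Sym intro: permutes_bij)
        then have "inv' (inv' h \<circ> g) = inv' g \<circ> h"
          by (simp add: o_inv_distrib bij_imp_bij_inv inv_inv_eq)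
        then show ?thesis using Sym_inv_o(4)[OF h, of x] by (simp add: comp_assoc)
      qed
      show "(\<Sum>g\<in>Sym n. p h * q (inv' h \<circ> g) * r (inv' g \<circ> x))
          = (\<Sum>g\<in>Sym n. p h * (q g * r (inv' g \<circ> (inv' h \<circ> x))))"
        by (rule sum.reindex_bij_witness[of _ "\<lambda>g. h \<circ> g" "\<lambda>g. inv' h \<circ> g"])
          (use h in \<open>simp_all add: mult.assoc inv_comp Sym_inv_o\<close>)
    qed
    also have "\<dots> = conv n p (conv n q r) x"
      using True by (simp add: conv_def sum_distrib_left)
    finally show ?thesis .
  qed (simp add: conv_def)
qed

lemma conv_id_left [simp]:
  assumes "p \<in> free (Sym n)"
  shows "conv n (single id) p = p"
  using assms by (auto simp: fun_eq_iff conv_single_left mem_alg)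

section \<open>Parabolic subgroups\<close>

text \<open>
  The parabolic subgroup generated by the \<open>s\<^sub>l\<close> with \<open>l \<in> J\<close>.  It is described through the initial segments
  that it preserves, so that membership can be checked without writing a permutation as a product
  of generators.
\<close>

definition W :: "nat \<Rightarrow> nat set \<Rightarrow> (nat \<Rightarrow> nat) set"
  where "W n J = {u \<in> Sym n. \<forall>d\<in>{1..n - 1} - J. \<forall>x\<in>{1..d}. u x \<in> {1..d}}"

lemma W_le_iff:
  assumes "u \<in> W n J" "d \<in> {1..n - 1} - J" "1 \<le> x"
  shows "u x \<le> d \<longleftrightarrow> x \<le> d"
proof
  assume "u x \<le> d"
  have u: "u \<in> Sym n" and "u ` {1..d} \<subseteq> {1..d}"
    using assms(1,2) unfolding W_def by blast+
  moreover have "inj_on u {1..d}" using Sym_inj[OF u] by (auto simp: inj_on_def)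
  ultimately have eq: "u ` {1..d} = {1..d}" by (simp add: endo_inj_surj)
  have "d \<le> n" using assms(2) by auto
  have "1 \<le> u x" using Sym_in[OF u, of x] Sym_out[OF u, of x] assms(3) by fastforce
  then have "u x \<in> u ` {1..d}" using eq \<open>u x \<le> d\<close> by auto
  then show "x \<le> d" using Sym_inj[OF u] by auto
next
  assume "x \<le> d"
  then have "x \<in> {1..d}" using assms(3) by simp
  then have "u x \<in> {1..d}" using assms(1,2) unfolding W_def by blast
  then show "u x \<le> d" by simp
qed

lemma W_Sym: "u \<in> W n J \<Longrightarrow> u \<in> Sym n"
  by (simp add: W_def)

lemma W_id [simp]: "id \<in> W n J"
  by (simp add: W_def)

lemma W_comp: "u \<in> W n J \<Longrightarrow> v \<in> W n J \<Longrightarrow> u \<circ> v \<in> W n J"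
  unfolding W_def by (simp del: atLeastAtMost_iff)

lemma W_inv:
  assumes "u \<in> W n J"
  shows "inv' u \<in> W n J"
  unfolding W_def
proof (intro CollectI conjI ballI)
  have u: "u \<in> Sym n" using assms by (rule W_Sym)
  then show iu: "inv' u \<in> Sym n" by simp
  fix d x assume d: "d \<in> {1..n - 1} - J" and x: "x \<in> {1..d}"
  have xx: "u (inv' u x) = x" using Sym_inv_o(2)[OF u] by (metis comp_apply id_apply)
  have "x \<in> {1..n}" using d x by auto
  then have "1 \<le> inv' u x" using Sym_in[OF iu, of x] by auto
  then show "inv' u x \<in> {1..d}" using W_le_iff[OF assms d, of "inv' u x"] x xx by auto
qed

lemma W_mono: "J \<subseteq> K \<Longrightarrow> W n J \<subseteq> W n K"
  unfolding W_def by blast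

lemma W_transpose:
  assumes "1 \<le> a" "a \<le> b" "b \<le> n" "{a..<b} \<subseteq> J"
  shows "transpose a b \<in> W n J"
  unfolding W_def
proof (intro CollectI conjI ballI)
  show "transpose a b \<in> Sym n" using assms by simp
  fix d x assume d: "d \<in> {1..n - 1} - J" and x: "x \<in> {1..d}"
  have "d < a \<or> b \<le> d" using d assms(4) by (meson DiffD2 atLeastLessThan_iff not_le subset_iff)
  then show "transpose a b x \<in> {1..d}"
    using x assms by (auto simp: transpose_def)
qed

definition asc :: "nat set \<Rightarrow> (nat \<Rightarrow> nat) \<Rightarrow> bool"
  where "asc J w \<longleftrightarrow> (\<forall>l\<in>J. w l < w (l + 1))"

lemma asc_less:
  assumes "asc J w" "x < y" "{x..<y} \<subseteq> J"
  shows "w x < w y"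
  using assms(2,3)
proof (induction y)
  case (Suc y)
  have "y \<in> J" using Suc.prems by auto
  then have "w y < w (Suc y)" using assms(1) by (simp add: asc_def)
  moreover have "w x \<le> w y"
  proof (cases "x = y")
    case False
    then show ?thesis using Suc by fastforce
  qed simp
  ultimately show ?case by simp
qed simp

text \<open>
  If \<open>u\<close> moved anything, let \<open>x\<close> be the least point that it moves.  Then \<open>u\<close> takes some \<open>y > x\<close> of the
  same block to \<open>x\<close>, and \<open>u x > x\<close>; comparing \<open>w\<close> and \<open>w \<circ> u\<close> at these points gives opposite
  inequalities between \<open>w x\<close> and \<open>w (u x)\<close>.  So every right orbit of a parabolic subgroup contains at
  most one sorted word.
\<close>

lemma asc_unique:
  assumes u: "u \<in> W n J" and w: "asc J w" and wu: "asc J (w \<circ> u)"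
  shows "u = id"
proof (rule ccontr)
  assume "u \<noteq> id"
  then have ex: "\<exists>x. u x \<noteq> x" by (auto simp: fun_eq_iff)
  define x where "x = (LEAST x. u x \<noteq> x)"
  have ux: "u x \<noteq> x" unfolding x_def using ex by (rule LeastI_ex)
  have least: "u y = y" if "y < x" for y using not_less_Least[of y "\<lambda>x. u x \<noteq> x"] that x_def by auto
  have uS: "u \<in> Sym n" using u by (rule W_Sym)
  have xn: "x \<in> {1..n}" using ux Sym_out[OF uS] by blast
  (* The points x, y and u x lie in one block: no boundary separates u y = x from y, or x from u x. *)
  define y where "y = inv' u x"
  have uy: "u y = x" unfolding y_def using Sym_inv_o(2)[OF uS] by (metis comp_apply id_apply)
  have yn: "y \<in> {1..n}" using Sym_in[OF uS, of y] uy xn by simp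
  have xy: "x < y" using uy ux least[of y] by (metis linorder_neqE_nat)
  have xz: "x < u x" using least[of "u x"] ux Sym_inj[OF uS, of "u x" x] by (metis linorder_neqE_nat)
  have zn: "u x \<in> {1..n}" using Sym_in[OF uS, of x] xn by simp
  have "{x..<y} \<subseteq> J"
  proof
    fix d assume d: "d \<in> {x..<y}"
    show "d \<in> J"
    proof (rule ccontr)
      assume "d \<notin> J"
      then have "d \<in> {1..n - 1} - J" using d xn yn by auto
      from W_le_iff[OF u this, of y] show False using uy d yn by auto
    qed
  qed
  from asc_less[OF wu xy this] have 1: "w (u x) < w x" by (simp add: uy)
  have "{x..<u x} \<subseteq> J"
  proof
    fix d assume d: "d \<in> {x..<u x}"
    show "d \<in> J"
    proof (rule ccontr)
      assume "d \<notin> J"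
      then have "d \<in> {1..n - 1} - J" using d xn zn by auto
      from W_le_iff[OF u this, of x] show False using d xn by auto
    qed
  qed
  from asc_less[OF w xz this] 1 show False by simp
qed

text \<open>
  Exchanging two adjacent letters in descending order decreases this quantity, because the larger one
  moves to the position with the smaller weight.
\<close>

definition sort_measure :: "nat \<Rightarrow> (nat \<Rightarrow> nat) \<Rightarrow> nat"
  where "sort_measure n w = (\<Sum>x\<in>{1..n}. (n - x) * w x)"

lemma sort_measure_less:
  assumes "l \<in> {1..n - 1}" "w (l + 1) < w l"
  shows "sort_measure n (w \<circ> transpose l (l + 1)) < sort_measure n w"
proof -
  let ?D = "{1..n} - {l, l + 1}"
  have split: "(\<Sum>x\<in>{1..n}. h x) = h l + h (l + 1) + (\<Sum>x\<in>?D. h x)" for h :: "nat \<Rightarrow> nat"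
  proof -
    have "{1..n} = insert l (insert (l + 1) ?D)" using assms(1) by auto
    then have "(\<Sum>x\<in>{1..n}. h x) = (\<Sum>x\<in>insert l (insert (l + 1) ?D). h x)" by simp
    then show ?thesis by simp
  qed
  have D: "(\<Sum>x\<in>?D. (n - x) * w (transpose l (l + 1) x)) = (\<Sum>x\<in>?D. (n - x) * w x)"
    by (rule sum.cong) (auto simp: transpose_def)
  (* The weights of the two exchanged letters differ by 1. *)
  obtain t where t: "n - l = Suc t" "n - (l + 1) = t" using assms(1) by (cases "n - l") auto
  show ?thesis using assms(2)
    unfolding sort_measure_def split o_apply D t by simp
qed

text \<open>
  Every word can be sorted within the blocks by exchanges that preserve the values of \<open>f\<close> and \<open>g\<close>.
\<close>

lemma invariant_determined:
  assumes J: "J \<subseteq> {1..n - 1}"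
    and f: "\<And>w l. w \<in> Sym n \<Longrightarrow> l \<in> J \<Longrightarrow> f (w \<circ> transpose l (l + 1)) = f w"
    and g: "\<And>w l. w \<in> Sym n \<Longrightarrow> l \<in> J \<Longrightarrow> g (w \<circ> transpose l (l + 1)) = g w"
    and eq: "\<And>w. w \<in> Sym n \<Longrightarrow> asc J w \<Longrightarrow> f w = g w"
    and w: "w \<in> Sym n"
  shows "f w = g w"
  using w
proof (induction "sort_measure n w" arbitrary: w rule: less_induct)
  case less
  show ?case
  proof (cases "asc J w")
    case False
    then obtain l where l: "l \<in> J" "\<not> w l < w (l + 1)" by (auto simp: asc_def)
    have ln: "l \<in> {1..n - 1}" using l J by blast
    have "w (l + 1) \<noteq> w l" using Sym_inj[OF less.prems] by simp
    then have "sort_measure n (w \<circ> transpose l (l + 1)) < sort_measure n w"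
      using sort_measure_less[OF ln] l(2) by simp
    moreover have "w \<circ> transpose l (l + 1) \<in> Sym n" using less.prems ln by (intro Sym_comp) auto
    ultimately have "f (w \<circ> transpose l (l + 1)) = g (w \<circ> transpose l (l + 1))" using less.hyps by blast
    then show ?thesis using f g less.prems l(1) by simp
  qed (use eq less.prems in simp)
qed

section \<open>Lacunar sets\<close>

text \<open>
  Sending \<open>i \<in> I\<close> to whichever of \<open>i\<close> and \<open>i + 1\<close> lies in \<open>J\<close> defines an injection from \<open>I\<close> to \<open>J\<close>, because \<open>I\<close> is
  lacunar, and this injection does not decrease elements.  It is strict somewhere, or else it is
  the inclusion of \<open>I\<close> in \<open>J\<close> and \<open>J\<close> has further, positive elements.
\<close>

lemma lacunar_sum_less:
  assumes I: "finite I" "lacunar I" and J: "finite J" "lacunar J" "0 \<notin> J"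
    and cov: "\<And>i. i \<in> I \<Longrightarrow> i \<in> J \<or> i + 1 \<in> J" and ne: "I \<noteq> J"
  shows "\<Sum>I < \<Sum>J"
proof -
  (* If i is not in J then i + 1 is, so the image lies in J. *)
  define \<phi> where "\<phi> i = (if i \<in> J then i else i + 1)" for i
  have inj: "inj_on \<phi> I"
    using I(2) unfolding inj_on_def \<phi>_def lacunar_def by (auto split: if_splits)
  have im: "\<phi> ` I \<subseteq> J" using cov by (auto simp: \<phi>_def)
  have le: "(\<Sum>i\<in>I. \<phi> i) \<le> \<Sum>J"
    using sum_mono2[OF J(1) im, of "\<lambda>x. x"] by (simp add: sum.reindex[OF inj])
  have le2: "\<Sum>I \<le> (\<Sum>i\<in>I. \<phi> i)" by (rule sum_mono) (simp add: \<phi>_def)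
  show ?thesis
  proof (cases "I \<subseteq> J")
    case True
    then obtain x where x: "x \<in> J" "x \<notin> I" using ne by blast
    have "\<Sum>I < \<Sum>I + x" using x J(3) by (cases x) auto
    also have "\<dots> = \<Sum>(insert x I)" using x I(1) by simp
    also have "\<dots> \<le> \<Sum>J" by (rule sum_mono2) (use J(1) True x in auto)
    finally show ?thesis .
  next
    case False
    then obtain i where "i \<in> I" "i \<notin> J" by blast
    then have "\<Sum>I < (\<Sum>i\<in>I. \<phi> i)"
      by (intro sum_strict_mono_ex1) (use I(1) in \<open>auto simp: \<phi>_def\<close>)
    with le show ?thesis by simp
  qed
qed

text \<open>
  If \<open>K\<close> contains \<open>i\<close> and \<open>i + 1\<close>, replace \<open>i\<close> by \<open>i - 1\<close>, or drop it if \<open>i = 1\<close>.  The pairs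
  \<open>{l, l + 1}\<close> that contain \<open>i\<close> and have \<open>l \<ge> 1\<close> still meet the new set, so no new position enters
  \<^const>\<open>nonshadow\<close>, and the sum has become smaller.
\<close>

lemma lacunar_refinement:
  assumes "K \<subseteq> {1..n - 1}"
  shows "\<exists>L \<subseteq> {1..n - 1}. lacunar L \<and> \<Sum>L \<le> \<Sum>K \<and> nonshadow n L \<subseteq> nonshadow n K"
  using assms
proof (induction "\<Sum>K" arbitrary: K rule: less_induct)
  case less
  have fin: "finite K" using less.prems finite_subset by blast
  show ?case
  proof (cases "lacunar K")
    case False
    then obtain i where i: "i \<in> K" "i + 1 \<in> K" by (auto simp: lacunar_def)
    then have i1: "1 \<le> i" using less.prems by auto
    (* The intersection discards the position 0. *)
    define L where "L = (K - {i}) \<union> ({i - 1} \<inter> {1..})"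
    have "\<Sum>L \<le> \<Sum>(K - {i}) + \<Sum>({i - 1} \<inter> {1..})"
      unfolding L_def using fin sum_Un_nat[of "K - {i}" "{i - 1} \<inter> {1..}" "\<lambda>x. x"] by simp
    moreover have "\<Sum>({i - 1} \<inter> {1..}) \<le> i - 1" by (cases "i - 1 = 0") auto
    moreover have "\<Sum>K = i + \<Sum>(K - {i})" using fin i(1) by (simp add: sum.remove)
    ultimately have lt: "\<Sum>L < \<Sum>K" using i1 by linarith
    have "L \<subseteq> {1..n - 1}" using less.prems i unfolding L_def by auto
    from less.hyps[OF lt this] obtain M where M: "M \<subseteq> {1..n - 1}" "lacunar M" "\<Sum>M \<le> \<Sum>L"
      "nonshadow n M \<subseteq> nonshadow n L" by blast
    have "nonshadow n L \<subseteq> nonshadow n K"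
      using i unfolding nonshadow_def L_def by fastforce
    with M lt show ?thesis by (meson less_imp_le_nat order_trans)
  qed (use less.prems in blast)
qed

section \<open>Submodules of the filtration\<close>

abbreviation adj :: "nat \<Rightarrow> nat \<Rightarrow> nat"
  where "adj l \<equiv> transpose l (l + 1)"

lemma adj_Sym: "l \<in> {1..n - 1} \<Longrightarrow> adj l \<in> Sym n"
  by (rule Sym_transpose) auto

lemma adj_adj [simp]: "w \<circ> adj l \<circ> adj l = w"
  by (simp add: comp_assoc)

lemma Sym_adj_iff: "l \<in> {1..n - 1} \<Longrightarrow> w \<circ> adj l \<in> Sym n \<longleftrightarrow> w \<in> Sym n"
  by (metis Sym_comp adj_Sym adj_adj)

lemma nonshadow_subset: "nonshadow n J \<subseteq> {1..n - 1}"
  by (auto simp: nonshadow_def)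

lemma F_iff:
  "q \<in> F n J \<longleftrightarrow> q \<in> free (Sym n) \<and> (\<forall>l\<in>nonshadow n J. \<forall>w. q (w \<circ> adj l) = q w)"
proof -
  have "conv n q (single (adj l)) = q \<longleftrightarrow> (\<forall>w. q (w \<circ> adj l) = q w)"
    if q: "q \<in> free (Sym n)" and l: "l \<in> {1..n - 1}" for l
  proof -
    have "conv n q (single (adj l)) w = q (w \<circ> adj l)" for w
    proof (cases "w \<in> Sym n")
      case True
      then show ?thesis using adj_Sym[OF l] by (simp add: conv_single_right)
    next
      case False
      then show ?thesis using q Sym_adj_iff[OF l] by (simp add: mem_alg conv_def)
    qed
    then show ?thesis by (auto simp: fun_eq_iff)
  qed
  then show ?thesis unfolding F_def using nonshadow_subset by (force simp: group_alg_mult)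
qed

lemma F_antimono: "nonshadow n L \<subseteq> nonshadow n K \<Longrightarrow> F n K \<subseteq> F n L"
  unfolding subset_iff F_iff by blast

lemma F_subgp: "add_subgp (F n J)"
  unfolding add_subgp_def by (auto simp: F_iff)

lemma conv_right_invariant:
  assumes "l \<in> {1..n - 1}" "\<And>w. q (w \<circ> adj l) = q w"
  shows "conv n p q (w \<circ> adj l) = conv n p q w"
  using assms(2) Sym_adj_iff[OF assms(1), of w]
  by (simp add: conv_def comp_assoc[symmetric])

lemma F_conv: "q \<in> F n J \<Longrightarrow> conv n p q \<in> F n J"
  using nonshadow_subset[of n J] conv_right_invariant[of _ n q p]
  by (auto simp: F_iff)

lemma F_filt_subgp:
  "add_subgp (F_filt n Q i :: ((nat \<Rightarrow> nat) \<Rightarrow> 'k :: {comm_ring, comm_monoid_mult}) set)"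
  unfolding add_subgp_def
proof (intro conjI ballI)
  have "0 = (\<Sum>t\<in>{1..i}. (\<lambda>_. 0) t)" by simp
  then show "0 \<in> F_filt n Q i"
    using add_subgpD(1)[OF F_subgp] unfolding F_filt_def by blast
  fix x y :: "(nat \<Rightarrow> nat) \<Rightarrow> 'k"
  assume "x \<in> F_filt n Q i" "y \<in> F_filt n Q i"
  then obtain q r where q: "x = (\<Sum>t\<in>{1..i}. q t)" "\<forall>t\<in>{1..i}. q t \<in> F n (Q t)"
    and r: "y = (\<Sum>t\<in>{1..i}. r t)" "\<forall>t\<in>{1..i}. r t \<in> F n (Q t)" unfolding F_filt_def by blast
  have "x - y = (\<Sum>t\<in>{1..i}. q t - r t)" by (simp add: q r sum_subtractf)
  then show "x - y \<in> F_filt n Q i"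
    using q(2) r(2) add_subgpD(2)[OF F_subgp] unfolding F_filt_def by blast
qed

lemma conv_sum_right: "conv n p (\<Sum>t\<in>D. q t) = (\<Sum>t\<in>D. conv n p (q t))"
  by (induction D rule: infinite_finite_induct) (simp_all add: conv_add_right del: plus_fun_apply zero_fun_apply)

lemma conv_sum_left: "conv n (\<Sum>t\<in>D. q t) p = (\<Sum>t\<in>D. conv n (q t) p)"
  by (induction D rule: infinite_finite_induct) (simp_all add: conv_add_left del: plus_fun_apply zero_fun_apply)

lemma F_filt_conv:
  assumes "x \<in> F_filt n Q i"
  shows "conv n p x \<in> F_filt n Q i"
proof -
  from assms obtain q where q: "x = (\<Sum>t\<in>{1..i}. q t)" "\<forall>t\<in>{1..i}. q t \<in> F n (Q t)"
    unfolding F_filt_def by blast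
  have "conv n p x = (\<Sum>t\<in>{1..i}. conv n p (q t))" by (simp add: q conv_sum_right)
  then show ?thesis using q(2) F_conv unfolding F_filt_def by blast
qed

lemma F_subset_F_filt:
  assumes "t \<in> {1..i}"
  shows "F n (Q t) \<subseteq> F_filt n Q i"
proof
  fix x assume x: "x \<in> F n (Q t)"
  have "x = (\<Sum>s\<in>{1..i}. if s = t then x else 0)" using assms by simp
  moreover have "\<forall>s\<in>{1..i}. (if s = t then x else 0) \<in> F n (Q s)"
    using x add_subgpD(1)[OF F_subgp] by auto
  ultimately show "x \<in> F_filt n Q i" unfolding F_filt_def by blast
qed

lemma F_filt_step:
  assumes "1 \<le> i"
  shows "x \<in> F_filt n Q i \<longleftrightarrow> (\<exists>y\<in>F_filt n Q (i - 1). \<exists>z\<in>F n (Q i). x = y + z)"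
proof -
  have iv: "{1..i} = insert i {1..i - 1}" "i \<notin> {1..i - 1}" using assms by auto
  show ?thesis
  proof
    assume "x \<in> F_filt n Q i"
    then obtain q where q: "x = (\<Sum>t\<in>{1..i}. q t)" "\<forall>t\<in>{1..i}. q t \<in> F n (Q t)"
      unfolding F_filt_def by blast
    have "x = (\<Sum>t\<in>{1..i - 1}. q t) + q i"
      using iv(2) unfolding q(1) iv(1) by (simp add: add.commute)
    moreover have "(\<Sum>t\<in>{1..i - 1}. q t) \<in> F_filt n Q (i - 1)" "q i \<in> F n (Q i)"
      using q(2) iv(1) unfolding F_filt_def by auto
    ultimately show "\<exists>y\<in>F_filt n Q (i - 1). \<exists>z\<in>F n (Q i). x = y + z" by blast
  next
    assume "\<exists>y\<in>F_filt n Q (i - 1). \<exists>z\<in>F n (Q i). x = y + z"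
    then obtain q z where q: "\<forall>t\<in>{1..i - 1}. q t \<in> F n (Q t)" and z: "z \<in> F n (Q i)"
      and x: "x = (\<Sum>t\<in>{1..i - 1}. q t) + z" unfolding F_filt_def by blast
    have "(\<Sum>t\<in>{1..i - 1}. q t) = (\<Sum>t\<in>{1..i - 1}. (q(i := z)) t)"
      by (rule sum.cong) auto
    then have "x = (\<Sum>t\<in>{1..i}. (q(i := z)) t)"
      using iv(2) unfolding x iv(1) by (simp add: add.commute)
    moreover have "\<forall>t\<in>{1..i}. (q(i := z)) t \<in> F n (Q t)" using q z iv(1) by auto
    ultimately show "x \<in> F_filt n Q i" unfolding F_filt_def by blast
  qed
qed

section \<open>Right multiplication by \<open>1 - s\<^sub>l\<close>\<close>

text \<open>
  The product \<open>q (1 - s\<^sub>l)\<close>, as an operation on functions.  The product of the commuting factors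
  \<open>1 - s\<^sub>i\<close>, \<open>i \<in> I\<close>, becomes an iteration along a list.
\<close>

definition rdiff :: "nat \<Rightarrow> ((nat \<Rightarrow> nat) \<Rightarrow> 'k) \<Rightarrow> (nat \<Rightarrow> nat) \<Rightarrow> 'k :: ab_group_add"
  where "rdiff l q w = q w - q (w \<circ> adj l)"

lemma rdiff_add: "rdiff l (p + q) = rdiff l p + rdiff l q"
  by (simp add: rdiff_def fun_eq_iff)

lemma rdiff_zero: "rdiff l 0 = 0"
  by (simp add: rdiff_def fun_eq_iff)

lemma foldr_rdiff_add: "foldr rdiff xs (p + q) = foldr rdiff xs p + foldr rdiff xs q"
  by (induction xs) (simp_all add: rdiff_add del: plus_fun_apply)

lemma foldr_rdiff_zero [simp]: "foldr rdiff xs 0 = 0"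
  by (induction xs) (simp_all add: rdiff_zero del: zero_fun_apply)

lemma foldr_rdiff_conv:
  assumes "set xs \<subseteq> {1..n - 1}"
  shows "foldr rdiff xs (conv n p q) = conv n p (foldr rdiff xs q)"
proof -
  have *: "rdiff l (conv n p q) = conv n p (rdiff l q)" if "l \<in> {1..n - 1}" for l q
    using Sym_adj_iff[OF that]
    by (auto simp: rdiff_def fun_eq_iff conv_def comp_assoc right_diff_distrib sum_subtractf)
  show ?thesis using assms by (induction xs) (simp_all add: *)
qed

text \<open>
  The factor \<open>1 - s\<^sub>l\<close> kills \<open>q\<close>, and the factors applied before it commute with \<open>s\<^sub>l\<close> and so preserve the
  invariance of \<open>q\<close> under \<open>s\<^sub>l\<close>.
\<close>

lemma foldr_rdiff_kill:
  assumes l: "l \<in> set xs" and lac: "lacunar (set xs)" and q: "\<And>w. q (w \<circ> adj l) = q w"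
  shows "foldr rdiff xs q = 0"
proof -
  have comm: "w \<circ> adj l' \<circ> adj l = w \<circ> adj l \<circ> adj l'" if "l' \<in> set xs" "l' \<noteq> l" for l' w
  proof -
    have "l' + 1 \<noteq> l" "l + 1 \<noteq> l'" using lac l that(1) by (auto simp: lacunar_def)
    then have "adj l' \<circ> adj l = adj l \<circ> adj l'" using that(2)
      by (auto simp: fun_eq_iff transpose_def)
    then show ?thesis by (metis comp_assoc)
  qed
  have "(\<forall>w. foldr rdiff ys q (w \<circ> adj l) = foldr rdiff ys q w) \<and> (l \<in> set ys \<longrightarrow> foldr rdiff ys q = 0)"
    if "set ys \<subseteq> set xs" for ys
    using that
  proof (induction ys)
    case (Cons y ys)
    then have IH: "\<forall>w. foldr rdiff ys q (w \<circ> adj l) = foldr rdiff ys q w"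
      and z: "l \<in> set ys \<longrightarrow> foldr rdiff ys q = 0" by (simp_all add: zero_fun_def del: o_apply)
    show ?case
    proof (cases "y = l")
      case True
      then have "foldr rdiff (y # ys) q = 0" using IH by (simp add: rdiff_def fun_eq_iff)
      then show ?thesis by simp
    next
      case False
      have "foldr rdiff (y # ys) q (w \<circ> adj l) = foldr rdiff (y # ys) q w" for w
      proof -
        have "w \<circ> adj l \<circ> adj y = w \<circ> adj y \<circ> adj l" using comm[of y w] Cons.prems False by simp
        then show ?thesis
          using spec[OF IH, of w] spec[OF IH, of "w \<circ> adj y"]
          by (simp only: foldr.simps o_apply rdiff_def)
      qed
      moreover have "l \<in> set (y # ys) \<longrightarrow> foldr rdiff (y # ys) q = 0"
        using z False by (simp add: rdiff_zero del: zero_fun_apply)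
      ultimately show ?thesis by blast
    qed
  qed (use q in simp)
  then show ?thesis using l by blast
qed

section \<open>Compositions of \<open>n\<close> into blocks\<close>

text \<open>
  The combinatorial data of one subquotient: block sizes \<open>j 1, \<dots>, j m\<close>, all but the first at least \<open>2\<close>.
  The bounds on the sizes make the set \<open>I\<close> of first positions lacunar.
\<close>

locale blocks =
  fixes n m :: nat and j :: "nat \<Rightarrow> nat"
  assumes m: "1 \<le> m" and total: "block_offset j (m + 1) = n"
    and j2: "\<And>k. k \<in> {2..m} \<Longrightarrow> 2 \<le> j k"
begin

abbreviation off :: "nat \<Rightarrow> nat"
  where "off \<equiv> block_offset j"

definition I :: "nat set"
  where "I = (\<lambda>k. off k + 1) ` {2..m}"

abbreviation unshadowed :: "nat set"
  where "unshadowed \<equiv> nonshadow n I"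

lemma off_1 [simp]: "off (Suc 0) = 0"
  by (simp add: block_offset_def)

lemma off_Suc: "1 \<le> k \<Longrightarrow> off (Suc k) = off k + j k"
  by (simp add: block_offset_def)

lemma off_mono: "k \<le> k' \<Longrightarrow> off k \<le> off k'"
  unfolding block_offset_def by (rule sum_mono2) auto

lemma off_gap:
  assumes "2 \<le> k" "k < k'" "k' \<le> m + 1"
  shows "off k + 2 \<le> off k'"
proof -
  have "off k + 2 \<le> off k + j k" using j2[of k] assms by simp
  also have "\<dots> = off (k + 1)" using off_Suc assms by simp
  also have "\<dots> \<le> off k'" using off_mono assms by simp
  finally show ?thesis .
qed

lemma off_inj:
  assumes "k \<in> {2..m}" "k' \<in> {2..m}" "off k = off k'"
  shows "k = k'"
  using off_gap[of k k'] off_gap[of k' k] assms by (cases k k' rule: linorder_cases) auto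

lemma off_n: "k \<in> {2..m} \<Longrightarrow> off k + 2 \<le> n"
  using off_gap[of k "m + 1"] total by simp

lemma off_le_n: "k \<in> {1..m + 1} \<Longrightarrow> off k \<le> n"
  using off_mono[of k "m + 1"] total by simp

lemma I_sub: "I \<subseteq> {1..n - 1}"
  using off_n by (fastforce simp: I_def)

lemma finite_I [simp]: "finite I"
  by (simp add: I_def)

lemma I_lacunar: "lacunar I"
  unfolding lacunar_def
proof (intro allI notI)
  fix i assume "i \<in> I \<and> i + 1 \<in> I"
  then obtain k k' where "k \<in> {2..m}" "k' \<in> {2..m}" "off k' = off k + 1" by (auto simp: I_def)
  then show False
    using off_gap[of k k'] off_gap[of k' k] by (cases k k' rule: linorder_cases) auto
qed

lemma block_eq: "1 \<le> k \<Longrightarrow> block j k = {off k + 1..off (k + 1)}"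
  by (simp add: block_def off_Suc)

lemma block_sub: "k \<in> {1..m} \<Longrightarrow> block j k \<subseteq> {1..n}"
  using off_le_n[of "k + 1"] by (auto simp: block_eq)

lemma block_disjoint:
  assumes "k \<in> {1..m}" "k' \<in> {1..m}" "x \<in> block j k" "x \<in> block j k'"
  shows "k = k'"
  using assms off_mono[of "k + 1" k'] off_mono[of "k' + 1" k]
  by (cases k k' rule: linorder_cases) (auto simp: block_eq)

lemma block_unshadowed:
  assumes k: "k \<in> {1..m}" and l: "l \<in> block j k" "l + 1 \<in> block j k"
  shows "l \<in> unshadowed \<or> l \<in> I"
proof -
  have "l + 1 \<notin> I"
  proof
    assume "l + 1 \<in> I"
    then obtain k' where k': "k' \<in> {2..m}" "l = off k'" by (auto simp: I_def)
    have "l + 1 \<in> block j k'" using k' off_gap[of k' "k' + 1"] by (simp add: block_eq)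
    then have "k = k'" using block_disjoint[OF k _ l(2)] k' by simp
    then show False using l k' by (simp add: block_def)
  qed
  moreover have "l \<in> {1..n - 1}" using l block_sub[OF k] by fastforce
  ultimately show ?thesis by (auto simp: nonshadow_def)
qed

lemma block_rest_unshadowed:
  assumes k: "k \<in> {2..m}" and l: "l \<in> {off k + 1<..<off (k + 1)}"
  shows "l \<in> unshadowed"
proof -
  have lk: "l \<in> block j k" "l + 1 \<in> block j k" using k l by (auto simp: block_eq)
  have "l \<notin> I"
  proof
    assume "l \<in> I"
    then obtain k' where k': "k' \<in> {2..m}" "l = off k' + 1" by (auto simp: I_def)
    then have "l \<in> block j k'" using off_gap[of k' "k' + 1"] by (simp add: block_eq)
    then have "k = k'" using block_disjoint[OF _ _ lk(1)] k k' by simp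
    then show False using l k' by simp
  qed
  then show ?thesis using block_unshadowed[OF _ lk] k by auto
qed

lemma block_first: "k \<in> {2..m} \<Longrightarrow> off k + 1 \<in> block j k \<and> off k + 2 \<in> block j k"
  using off_gap[of k "k + 1"] by (simp add: block_eq)

lemma off_notin_unshadowed: "k \<in> {2..m} \<Longrightarrow> off k \<notin> unshadowed \<and> off k \<notin> I"
proof -
  assume "k \<in> {2..m}"
  then have "off k + 1 \<in> I" by (simp add: I_def)
  then show ?thesis using I_lacunar by (auto simp: nonshadow_def lacunar_def)
qed

text \<open>
  The image of the parabolic embedding: only the block boundaries are preserved.
\<close>

definition H :: "(nat \<Rightarrow> nat) set"
  where "H = W n ({1..n - 1} - off ` {2..m})"

lemma W_block:
  assumes w: "w \<in> W n J" and J: "J \<inter> off ` {2..m} = {}" and k: "k \<in> {1..m}" and x: "x \<in> block j k"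
  shows "w x \<in> block j k"
proof -
  have wS: "w \<in> Sym n" using w by (rule W_Sym)
  have xn: "x \<in> {1..n}" using x block_sub[OF k] by blast
  then have wn: "w x \<in> {1..n}" using Sym_in[OF wS] by blast
  have *: "w x \<le> off k' \<longleftrightarrow> x \<le> off k'" if "k' \<in> {1..m + 1}" for k'
  proof -
    consider "k' = 1" | "k' = m + 1" | "off k' = 0" | "k' \<in> {2..m}" "1 \<le> off k'"
      using \<open>k' \<in> {1..m + 1}\<close> by (cases "k' = 1"; cases "k' = m + 1"; cases "off k' = 0") auto
    then show ?thesis
    proof cases
      case 4
      then have "off k' \<in> {1..n - 1} - J" using J off_n[OF 4(1)] by auto
      then show ?thesis using W_le_iff[OF w, of "off k'" x] xn by simp
    qed (use xn wn total in auto)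
  qed
  show ?thesis using *[of k] *[of "k + 1"] x k by (auto simp: block_eq)
qed

lemma H_block: "w \<in> H \<Longrightarrow> k \<in> {1..m} \<Longrightarrow> x \<in> block j k \<Longrightarrow> w x \<in> block j k"
  unfolding H_def by (rule W_block) auto

lemma unshadowed_W_H: "W n unshadowed \<subseteq> H"
  unfolding H_def using off_notin_unshadowed nonshadow_subset by (intro W_mono) auto

text \<open>
  Since \<open>off k\<close> is a boundary, fixing the first position \<open>off k + 1\<close> of a block creates a new boundary behind
  it.
\<close>

lemma fix_in_W:
  assumes v: "v \<in> W n J" and J: "J \<inter> off ` {2..m} = {}" and fx: "\<And>i. i \<in> I \<inter> J \<Longrightarrow> v i = i"
  shows "v \<in> W n (J - I)"
  unfolding W_def
proof (intro CollectI conjI ballI)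
  show "v \<in> Sym n" using v by (rule W_Sym)
  fix d x assume d: "d \<in> {1..n - 1} - (J - I)" and x: "x \<in> {1..d}"
  show "v x \<in> {1..d}"
  proof (cases "d \<in> J")
    case False
    then show ?thesis using d x v unfolding W_def by blast
  next
    case True
    then have dI: "d \<in> I \<inter> J" using d by auto
    then obtain k where k: "k \<in> {2..m}" "d = off k + 1" by (auto simp: I_def)
    show ?thesis
    proof (cases "x = d")
      case True
      then show ?thesis using fx[OF dI] x by simp
    next
      case False
      then have x': "x \<in> {1..off k}" using x k by simp
      then have "off k \<in> {1..n - 1} - J" using J k off_n[OF k(1)] by auto
      then have "v x \<in> {1..off k}" using v x' unfolding W_def by blast
      then show ?thesis using k by simp
    qed
  qed
qed

lemma fixes_first:
  assumes v: "v \<in> W n unshadowed" and i: "i \<in> I"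
  shows "v i = i"
proof -
  obtain k where k: "k \<in> {2..m}" "i = off k + 1" using i by (auto simp: I_def)
  have "v i \<in> block j k"
    by (rule W_block[OF v]) (use off_notin_unshadowed k block_first[OF k(1)] in auto)
  moreover have "i \<in> {1..n - 1} - unshadowed" using i I_sub by (auto simp: nonshadow_def)
  from W_le_iff[OF v this, of i] have "v i \<le> i" using k by simp
  ultimately show ?thesis using k by (simp add: block_def)
qed

text \<open>
  For \<open>i \<in> I\<close>, both \<open>i - 1\<close> and \<open>i\<close> are boundaries for the left-hand side; they enclose the single
  position \<open>i\<close>.
\<close>

lemma W_unshadowed_eq: "W n unshadowed = {w \<in> H. \<forall>i\<in>I. w i = i}"
proof (intro equalityI subsetI)
  fix w assume "w \<in> {w \<in> H. \<forall>i\<in>I. w i = i}"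
  then have "w \<in> W n ({1..n - 1} - off ` {2..m} - I)"
    using fix_in_W[of w "{1..n - 1} - off ` {2..m}"] unfolding H_def by auto
  moreover have "{1..n - 1} - off ` {2..m} - I \<subseteq> unshadowed"
    by (auto simp: nonshadow_def I_def)
  ultimately show "w \<in> W n unshadowed" using W_mono by blast
qed (use unshadowed_W_H fixes_first in auto)

lemma H_Sym: "w \<in> H \<Longrightarrow> w \<in> Sym n"
  unfolding H_def by (rule W_Sym)

lemma H_transpose:
  assumes k: "k \<in> {1..m}" and ab: "a \<in> block j k" "b \<in> block j k" "a \<le> b"
  shows "transpose a b \<in> H"
  unfolding H_def
proof (rule W_transpose)
  show "1 \<le> a" "b \<le> n" using ab block_sub[OF k] by auto
  show "{a..<b} \<subseteq> {1..n - 1} - off ` {2..m}"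
  proof
    fix d assume d: "d \<in> {a..<b}"
    then have dk: "d \<in> block j k" "d + 1 \<in> block j k" using ab by (auto simp: block_def)
    then have "d \<in> unshadowed \<or> d \<in> I" by (rule block_unshadowed[OF k])
    then show "d \<in> {1..n - 1} - off ` {2..m}"
      using off_notin_unshadowed nonshadow_subset I_sub by blast
  qed
qed (use ab in simp)

section \<open>The elements \<open>e\<close> and \<open>\<xi>\<close> of the group algebra\<close>

text \<open>
  Intermediate stages between \<open>e\<close> and \<open>\<xi>\<close>: the factors \<open>1 - s\<^sub>i\<close> have been applied for \<open>i \<in> K\<close> only.  The
  product form makes it visible that each of them affects one factor.
\<close>

definition xi_part :: "nat set \<Rightarrow> (nat \<Rightarrow> nat) \<Rightarrow> 'k :: {comm_ring, comm_monoid_mult}"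
  where "xi_part K w = (if w \<in> H then \<Prod>i\<in>I. if i \<in> K then single i (w i) - single i (w (i + 1))
                                      else single i (w i) else 0)"

text \<open>
  The product \<open>e \<Prod>\<^bsub>i \<in> I\<^esub> (1 - s\<^sub>i)\<close>, evaluated (\<open>antisym_young_sum\<close>).
\<close>

definition xi :: "(nat \<Rightarrow> nat) \<Rightarrow> 'k :: {comm_ring, comm_monoid_mult}"
  where "xi w = (if w \<in> H then \<Prod>i\<in>I. single i (w i) - single i (w (i + 1)) else 0)"

definition young_sum :: "(nat \<Rightarrow> nat) \<Rightarrow> 'k :: {comm_ring, comm_monoid_mult}"
  where "young_sum w = (if w \<in> W n unshadowed then 1 else 0)"

lemma prod_zero_factor:
  assumes "finite D" "i \<in> D" "f i = 0"
  shows "prod f D = (0 :: 'k :: {comm_ring, comm_monoid_mult})"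
  using prod.remove[OF assms(1,2), of f] assms(3) by simp

lemma xi_part_empty: "xi_part {} = (young_sum :: _ \<Rightarrow> 'k :: {comm_ring, comm_monoid_mult})"
proof
  fix w
  show "xi_part {} w = (young_sum w :: 'k)"
  proof (cases "w \<in> H \<and> (\<forall>i\<in>I. w i = i)")
    case True
    then show ?thesis by (simp add: xi_part_def young_sum_def W_unshadowed_eq single_def)
  next
    case False
    then have "w \<in> H \<Longrightarrow> \<exists>i\<in>I. single i (w i) = (0 :: 'k)" by (auto simp: single_def)
    then have "xi_part {} w = (0 :: 'k)"
      using prod_zero_factor[OF finite_I, of _ "\<lambda>i. single i (w i) :: 'k"] by (auto simp: xi_part_def)
    then show ?thesis using False by (auto simp: young_sum_def W_unshadowed_eq)
  qed
qed

lemma adj_H: "i \<in> I \<Longrightarrow> adj i \<in> H"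
proof -
  assume "i \<in> I"
  then obtain k where "k \<in> {2..m}" "i = off k + 1" by (auto simp: I_def)
  then show ?thesis using block_first[of k] by (intro H_transpose[of k]) auto
qed

text \<open>
  The transposition \<open>s\<^sub>i\<close> preserves the blocks, and it leaves the factors of all other elements of \<open>I\<close>
  unchanged because \<open>I\<close> is lacunar.
\<close>

lemma rdiff_xi_part:
  fixes K :: "nat set"
  assumes i: "i \<in> I" and K: "i \<notin> K"
  shows "rdiff i (xi_part K) = (xi_part (insert i K) :: _ \<Rightarrow> 'k :: {comm_ring, comm_monoid_mult})"
proof
  fix w
  have "w \<circ> adj i \<in> H \<longleftrightarrow> w \<in> H"
    using adj_H[OF i] unfolding H_def by (metis W_comp adj_adj)
  moreover have "rdiff i (xi_part K) w = (xi_part (insert i K) w :: 'k)"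
    if "w \<in> H" "w \<circ> adj i \<in> H"
  proof -
    let ?f = "\<lambda>K w l. if l \<in> K then single l (w l) - single l (w (l + 1)) else single l (w l) :: 'k"
    let ?P = "\<Prod>l\<in>I - {i}. ?f K w l"
    have eq: "?f K (w \<circ> adj i) l = ?f K w l" if "l \<in> I - {i}" for l
    proof -
      have "l \<noteq> i" "l + 1 \<noteq> i" "l \<noteq> i + 1" using that i I_lacunar by (auto simp: lacunar_def)
      then show ?thesis by (auto simp: transpose_def)
    qed
    have 1: "xi_part K w = single i (w i) * ?P" using that(1) i K
      unfolding xi_part_def by (subst prod.remove[of _ i]) auto
    have 2: "xi_part K (w \<circ> adj i) = single i (w (i + 1)) * ?P"
    proof -
      have "xi_part K (w \<circ> adj i) = (\<Prod>l\<in>I. ?f K (w \<circ> adj i) l)" using that(2)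
        unfolding xi_part_def by (simp only: if_True)
      also have "\<dots> = ?f K (w \<circ> adj i) i * (\<Prod>l\<in>I - {i}. ?f K (w \<circ> adj i) l)"
        using i by (simp add: prod.remove)
      also have "(\<Prod>l\<in>I - {i}. ?f K (w \<circ> adj i) l) = ?P" by (rule prod.cong[OF refl eq])
      finally have "xi_part K (w \<circ> adj i) = ?f K (w \<circ> adj i) i * ?P" .
      then show ?thesis using K by simp
    qed
    have 3: "xi_part (insert i K) w = (single i (w i) - single i (w (i + 1))) * ?P"
    proof -
      have "xi_part (insert i K) w = ?f (insert i K) w i * (\<Prod>l\<in>I - {i}. ?f (insert i K) w l)"
        using that(1) i by (simp add: xi_part_def prod.remove)
      also have "(\<Prod>l\<in>I - {i}. ?f (insert i K) w l) = ?P" by (rule prod.cong) auto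
      finally show ?thesis by simp
    qed
    show ?thesis unfolding rdiff_def 1 2 3 by (simp add: left_diff_distrib)
  qed
  ultimately show "rdiff i (xi_part K) w = (xi_part (insert i K) w :: 'k)"
    by (cases "w \<in> H") (auto simp: rdiff_def xi_part_def)
qed

text \<open>
  Right multiplication by \<open>\<Prod>\<^bsub>i \<in> I\<^esub> (1 - s\<^sub>i)\<close>.
\<close>

definition antisym :: "((nat \<Rightarrow> nat) \<Rightarrow> 'k) \<Rightarrow> (nat \<Rightarrow> nat) \<Rightarrow> 'k :: {comm_ring, comm_monoid_mult}"
  where "antisym = foldr rdiff (sorted_list_of_set I)"

lemma antisym_young_sum: "antisym young_sum = (xi :: _ \<Rightarrow> 'k :: {comm_ring, comm_monoid_mult})"
proof -
  have "foldr rdiff xs (xi_part {}) = (xi_part (set xs) :: _ \<Rightarrow> 'k)" if "distinct xs" "set xs \<subseteq> I" for xs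
    using that by (induction xs) (simp_all add: rdiff_xi_part)
  from this[of "sorted_list_of_set I"] have "antisym (xi_part {}) = (xi_part I :: _ \<Rightarrow> 'k)" by (simp add: antisym_def)
  moreover have "xi_part I = (xi :: _ \<Rightarrow> 'k)" by (simp add: fun_eq_iff xi_part_def xi_def)
  ultimately show ?thesis by (simp add: xi_part_empty)
qed

lemma antisym_conv: "antisym (conv n p q) = conv n p (antisym q)"
  unfolding antisym_def by (rule foldr_rdiff_conv) (use I_sub in simp)

section \<open>Reduction modulo the common annihilator\<close>

text \<open>
  The normal forms of the reduction: sorted within the blocks apart from the first letters, and with
  a first letter that is not the least letter of its block.
\<close>

definition B :: "(nat \<Rightarrow> nat) set"
  where "B = {w \<in> Sym n. asc unshadowed w \<and> (\<forall>i\<in>I. w (i + 1) < w i)}"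

lemma asc_block:
  assumes w: "asc unshadowed w" and k: "k \<in> {2..m}" and x: "x \<in> {off k + 2..off (k + 1)}"
  shows "w (off k + 2) \<le> w x"
proof (cases "x = off k + 2")
  case False
  have "{off k + 2..<x} \<subseteq> unshadowed" using block_rest_unshadowed[OF k] x by auto
  then show ?thesis using asc_less[OF w, of "off k + 2" x] x False by simp
qed simp

text \<open>
  If \<open>u = g h\<close> with \<open>g, u \<in> B\<close> and \<open>\<xi>(h) \<noteq> 0\<close>, then \<open>h = 1\<close>.  Indeed for \<open>i \<in> I\<close> either \<open>h(i) = i\<close> or
  \<open>h(i + 1) = i\<close>.  In the second case \<open>g(i) = u(i + 1)\<close> is the least letter of its block, which is excluded
  for \<open>g \<in> B\<close>.  So \<open>h\<close> fixes \<open>I\<close>, and \<open>asc_unique\<close> applies.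
\<close>

lemma conv_xi_B:
  fixes p :: "(nat \<Rightarrow> nat) \<Rightarrow> 'k :: {comm_ring, comm_monoid_mult}"
  assumes p: "\<And>x. x \<notin> B \<Longrightarrow> p x = 0" and u: "u \<in> B"
  shows "conv n p xi u = p u"
proof -
  have uS: "u \<in> Sym n" using u by (simp add: B_def)
  have 1: "xi id = (1 :: 'k)"
    by (simp add: xi_def H_def single_def)
  have "g = u" if g: "g \<in> B" and nz: "xi (inv' g \<circ> u) \<noteq> (0 :: 'k)" for g
  proof -
    have gS: "g \<in> Sym n" using g by (simp add: B_def)
    define h where "h = inv' g \<circ> u"
    have gh: "u = g \<circ> h" unfolding h_def by (rule Sym_inv_o(4)[OF gS, symmetric])
    have hH: "h \<in> H" using nz unfolding h_def[symmetric] xi_def by (auto split: if_splits)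
    then have hW: "h \<in> W n ({1..n - 1} - off ` {2..m})" by (simp add: H_def)
    have cases: "h i = i \<or> h (i + 1) = i" if "i \<in> I" for i
    proof (rule ccontr)
      assume "\<not> ?thesis"
      then have "single i (h i) - single i (h (i + 1)) = (0 :: 'k)" by (simp add: single_def)
      then have "xi h = (0 :: 'k)" unfolding xi_def
        using hH prod_zero_factor[OF finite_I that, of "\<lambda>i. single i (h i) - single i (h (i + 1))"]
        by simp
      then show False using nz h_def by simp
    qed
    have fx: "h i = i" if i: "i \<in> I" for i
    proof (rule ccontr)
      assume "h i \<noteq> i"
      then have h1: "h (i + 1) = i" using cases[OF i] by simp
      obtain k where k: "k \<in> {2..m}" "i = off k + 1" using i by (auto simp: I_def)
      define y where "y = inv' h (i + 1)"
      have hy: "h y = i + 1" unfolding y_def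
        using Sym_inv_o(2)[OF H_Sym[OF hH]] by (metis comp_apply id_apply)
      have "inv' h \<in> H" using W_inv[OF hW] by (simp add: H_def)
      then have y: "y \<in> block j k" unfolding y_def
        using H_block[of "inv' h" k "i + 1"] block_first[OF k(1)] k by simp
      have "u y = g (i + 1)" "u (i + 1) = g i" by (simp_all only: gh o_apply hy h1)
      then have lt: "u y < u (i + 1)" using g i by (simp add: B_def)
      have "u (i + 1) < u i" using u i by (simp add: B_def)
      moreover have "u (i + 1) \<le> u y" if "y \<noteq> i"
      proof -
        have "y \<in> {off k + 2..off (k + 1)}" using y that k by (auto simp: block_eq)
        from asc_block[OF _ k(1) this, of u] show ?thesis using u k by (simp add: B_def)
      qed
      ultimately show False using lt by (cases "y = i") auto
    qed
    have "h \<in> W n unshadowed" using hH fx by (simp add: W_unshadowed_eq)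
    from asc_unique[OF this, of g] have "h = id" using g u by (simp add: B_def gh)
    then show ?thesis using gh by simp
  qed
  then have supp: "xi (inv' g \<circ> u) = (0 :: 'k)" if "g \<in> B" "g \<noteq> u" for g using that by blast
  have eq: "p g * xi (inv' g \<circ> u) = (if g = u then p u else 0)" for g
    using p[of g] 1 Sym_inv_o(1)[OF uS] supp[of g] by (cases "g \<in> B"; cases "g = u") auto
  have "conv n p xi u = (\<Sum>g\<in>Sym n. if g = u then p u else 0)"
    using uS by (simp add: conv_def eq)
  then show ?thesis using uS by simp
qed

text \<open>
  A word that is not sorted is replaced by a better sorted one.  A sorted word whose first letter in
  some block is the least letter of that block is replaced, up to sign, by the words that have
  another letter of that block in front.  The latter step increases the first letters and the former does not
  change them, so a lexicographic measure decreases.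
\<close>

lemma reduction:
  fixes L :: "((nat \<Rightarrow> nat) \<Rightarrow> 'k :: {comm_ring, comm_monoid_mult}) set"
  assumes L: "add_subgp L" "\<And>c p. p \<in> L \<Longrightarrow> (\<lambda>x. c * p x) \<in> L"
    and r1: "\<And>g l. g \<in> Sym n \<Longrightarrow> l \<in> unshadowed \<Longrightarrow> single g - single (g \<circ> adj l) \<in> L"
    and r2: "\<And>g k. g \<in> Sym n \<Longrightarrow> k \<in> {2..m}
               \<Longrightarrow> (\<Sum>a\<in>block j k. single (g \<circ> transpose (off k + 1) a)) \<in> L"
    and p: "p \<in> free (Sym n)"
  shows "\<exists>q. (\<forall>x. x \<notin> B \<longrightarrow> q x = 0) \<and> p - q \<in> L"
proof -
  (* M is the set of elements that can be reduced; it is closed under linear combinations. *)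
  define M where "M = {p. \<exists>q :: (nat \<Rightarrow> nat) \<Rightarrow> 'k. (\<forall>x. x \<notin> B \<longrightarrow> q x = 0) \<and> p - q \<in> L}"
  have M_L: "p \<in> M" if "p \<in> L" for p
    unfolding M_def using that by (intro CollectI exI[of _ 0]) simp
  have M_add: "p + p' \<in> M" if "p \<in> M" "p' \<in> M" for p p'
  proof -
    from that obtain q q' where q: "\<forall>x. x \<notin> B \<longrightarrow> q x = 0" "p - q \<in> L"
      "\<forall>x. x \<notin> B \<longrightarrow> q' x = 0" "p' - q' \<in> L" unfolding M_def by blast
    have "(p + p') - (q + q') = (p - q) + (p' - q')" by (simp add: algebra_simps)
    then have "(p + p') - (q + q') \<in> L" using add_subgpD(3)[OF L(1) q(2,4)] by (simp only:)
    then show ?thesis unfolding M_def using q(1,3)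
      by (intro CollectI exI[of _ "q + q'"]) simp
  qed
  have M_scale: "(\<lambda>x. c * p x) \<in> M" if "p \<in> M" for p c
  proof -
    from that obtain q where q: "\<forall>x. x \<notin> B \<longrightarrow> q x = 0" "p - q \<in> L" unfolding M_def by blast
    have "(\<lambda>x. c * p x) - (\<lambda>x. c * q x) = (\<lambda>x. c * (p - q) x)"
      by (simp add: fun_eq_iff right_diff_distrib)
    then have "(\<lambda>x. c * p x) - (\<lambda>x. c * q x) \<in> L" using L(2)[OF q(2), of c] by (simp only:)
    then show ?thesis unfolding M_def using q(1)
      by (intro CollectI exI[of _ "\<lambda>x. c * q x"]) simp
  qed
  have M_diff: "p - p' \<in> M" if "p \<in> M" "p' \<in> M" for p p'
  proof -
    have "p - p' = p + (\<lambda>x. (- 1) * p' x)" by (simp add: fun_eq_iff)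
    then show ?thesis using M_add[OF that(1) M_scale[OF that(2), of "- 1"]] by (simp only:)
  qed
  have M_sum: "(\<Sum>a\<in>D. f a) \<in> M" if "finite D" "\<And>a. a \<in> D \<Longrightarrow> f a \<in> M" for D :: "nat set" and f
    using that
    by (induction D rule: finite_induct) (use M_L[OF add_subgpD(1)[OF L(1)]] M_add in auto)
  have single_M: "single g \<in> M" if "g \<in> Sym n" for g
    using that
  (* The letters at the positions in I have priority over the order of the other letters. *)
  proof (induction g rule: wf_induct[OF wf_measures[of "[\<lambda>g. \<Sum>i\<in>I. n - g i, sort_measure n]"]])
    case (1 g)
    have IH: "single h \<in> M" if "h \<in> Sym n" "(\<Sum>i\<in>I. n - h i) < (\<Sum>i\<in>I. n - g i) \<or>
        (\<Sum>i\<in>I. n - h i) = (\<Sum>i\<in>I. n - g i) \<and> sort_measure n h < sort_measure n g" for h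
      using 1 that by (auto simp: measures_def)
    show ?case
    proof (cases "asc unshadowed g")
      case False
      then obtain l where l: "l \<in> unshadowed" "\<not> g l < g (l + 1)" by (auto simp: asc_def)
      have ln: "l \<in> {1..n - 1}" using l(1) nonshadow_subset by blast
      have "g (l + 1) \<noteq> g l" using Sym_inj[OF 1(2)] by simp
      then have "sort_measure n (g \<circ> adj l) < sort_measure n g"
        using sort_measure_less[OF ln] l(2) by simp
      moreover have "(\<Sum>i\<in>I. n - (g \<circ> adj l) i) = (\<Sum>i\<in>I. n - g i)"
        by (rule sum.cong) (use l(1) in \<open>auto simp: nonshadow_def transpose_def\<close>)
      ultimately have "single (g \<circ> adj l) \<in> M" using IH 1(2) Sym_adj_iff[OF ln] by simp
      moreover have "single g = (single g - single (g \<circ> adj l)) + single (g \<circ> adj l)" by simp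
      ultimately show ?thesis using M_add M_L[OF r1[OF 1(2) l(1)]] by metis
    next
      case True
      show ?thesis
      proof (cases "\<forall>i\<in>I. g (i + 1) < g i")
        case B: True
        then have "g \<in> B" using True 1(2) by (simp add: B_def)
        then show ?thesis unfolding M_def using add_subgpD(1)[OF L(1)]
          by (intro CollectI exI[of _ "single g"]) (auto simp: single_def)
      next
        case False
        then obtain k where k: "k \<in> {2..m}" and ng: "\<not> g (off k + 2) < g (off k + 1)"
          by (auto simp: I_def)
        let ?i = "off k + 1"
        have iI: "?i \<in> I" using k by (simp add: I_def)
        have lt: "g ?i < g (off k + 2)"
          using ng Sym_inj[OF 1(2), of ?i "off k + 2"] by (metis linorder_neqE_nat add_left_cancel
              one_eq_numeral_iff semiring_norm(85))
        let ?D = "block j k - {?i}"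
        have D: "single (g \<circ> transpose ?i a) \<in> M" if a: "a \<in> ?D" for a
        proof (rule IH)
          have an: "a \<in> {1..n}" and i_n: "?i \<in> {1..n}"
            using a block_sub[of k] block_first[OF k] k by auto
          then show "g \<circ> transpose ?i a \<in> Sym n" using 1(2) by (intro Sym_comp Sym_transpose)
          have "a \<in> {off k + 2..off (k + 1)}" using a k by (auto simp: block_eq)
          from asc_block[OF True k this] have ga: "g ?i < g a" using lt by simp
          have aI: "a \<notin> I"
          proof
            assume "a \<in> I"
            then obtain k' where k': "k' \<in> {2..m}" "a = off k' + 1" by (auto simp: I_def)
            then have "k' = k" using block_disjoint[of k' k a] block_first[OF k'(1)] a k by simp
            then show False using a k' by simp
          qed
          have "g a \<le> n" using Sym_in[OF 1(2), of a] an by simp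
          then have "(\<Sum>i\<in>I. n - (g \<circ> transpose ?i a) i) < (\<Sum>i\<in>I. n - g i)"
            by (intro sum_strict_mono_ex1) (use ga aI iI in \<open>auto simp: transpose_def intro!: bexI[of _ ?i]\<close>)
          then show "(\<Sum>i\<in>I. n - (g \<circ> transpose ?i a) i) < (\<Sum>i\<in>I. n - g i) \<or>
            (\<Sum>i\<in>I. n - (g \<circ> transpose ?i a) i) = (\<Sum>i\<in>I. n - g i) \<and>
            sort_measure n (g \<circ> transpose ?i a) < sort_measure n g" by simp
        qed
        have fin: "finite (block j k)" by (simp add: block_def)
        have "(\<Sum>a\<in>block j k. single (g \<circ> transpose ?i a)) =
            (single g :: _ \<Rightarrow> 'k) + (\<Sum>a\<in>?D. single (g \<circ> transpose ?i a))"
          using block_first[OF k] by (simp add: sum.remove[OF fin, of ?i])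
        then have eq: "(single g :: _ \<Rightarrow> 'k) = (\<Sum>a\<in>block j k. single (g \<circ> transpose ?i a))
            - (\<Sum>a\<in>?D. single (g \<circ> transpose ?i a))" by simp
        have "(\<Sum>a\<in>?D. single (g \<circ> transpose ?i a)) \<in> M" by (rule M_sum[OF _ D]) (use fin in auto)
        from M_diff[OF M_L[OF r2[OF 1(2) k]] this] show ?thesis by (simp only: eq)
      qed
    qed
  qed
  have "p \<in> M" using p
  proof (induction rule: free_induct)
    case zero
    show "0 \<in> M" using M_L add_subgpD(1)[OF L(1)] by blast
  next
    case (step f x c)
    show "f + (\<lambda>y. c * single x y) \<in> M" using step(3) M_add M_scale[OF single_M[OF step(2)]] by blast
  qed
  then show ?thesis by (simp add: M_def)
qed

text \<open>
  For the two cyclic modules, \<open>L\<close> is the annihilator of the generator.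
\<close>

lemma annihilator_eq:
  fixes L :: "((nat \<Rightarrow> nat) \<Rightarrow> 'k :: {comm_ring, comm_monoid_mult}) set"
  assumes L: "add_subgp L" "\<And>c p. p \<in> L \<Longrightarrow> (\<lambda>x. c * p x) \<in> L"
    and r1: "\<And>g l. g \<in> Sym n \<Longrightarrow> l \<in> unshadowed \<Longrightarrow> single g - single (g \<circ> adj l) \<in> L"
    and r2: "\<And>g k. g \<in> Sym n \<Longrightarrow> k \<in> {2..m}
               \<Longrightarrow> (\<Sum>a\<in>block j k. single (g \<circ> transpose (off k + 1) a)) \<in> L"
    and xi: "\<And>p. p \<in> L \<Longrightarrow> conv n p xi = 0"
    and p: "p \<in> free (Sym n)"
  shows "p \<in> L \<longleftrightarrow> conv n p xi = 0"
proof
  assume p0: "conv n p xi = 0"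
  obtain q where q: "\<forall>x. x \<notin> B \<longrightarrow> q x = 0" "p - q \<in> L"
    using reduction[OF L r1 r2 p] by blast
  have "conv n q xi = 0" using xi[OF q(2)] p0 by (simp add: conv_diff_left)
  then have "q u = 0" if "u \<in> B" for u using conv_xi_B[of q u] q(1) that by simp
  then have "q = 0" using q(1) by (auto simp: fun_eq_iff)
  then show "p \<in> L" using q(2) by simp
qed (rule xi)

section \<open>Generators of \<open>F(I)\<close>\<close>

lemma young_sum_F: "young_sum \<in> F n I"
  unfolding F_iff
proof (intro conjI ballI allI)
  show "young_sum \<in> free (Sym n)" by (auto simp: mem_alg young_sum_def dest: W_Sym)
  fix l w assume l: "l \<in> unshadowed"
  then have "l \<in> {1..n - 1}" using nonshadow_subset by blast
  then have "adj l \<in> W n unshadowed" using l by (intro W_transpose) auto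
  then have "w \<circ> adj l \<in> W n unshadowed \<longleftrightarrow> w \<in> W n unshadowed" by (metis W_comp adj_adj)
  then show "young_sum (w \<circ> adj l) = young_sum w" by (simp add: young_sum_def)
qed

text \<open>
  An invariant function is determined by its values at the sorted words, and multiplying its
  restriction to the sorted words by \<open>e\<close> reproduces these values by \<open>asc_unique\<close>.
\<close>

lemma F_generated:
  assumes q: "q \<in> F n I"
  shows "\<exists>p\<in>free (Sym n). q = conv n p young_sum"
proof (intro bexI ext)
  (* Each orbit under the Young subgroup keeps only its sorted word. *)
  define p where "p = (\<lambda>w. if w \<in> Sym n \<and> asc unshadowed w then q w else 0)"
  show "p \<in> free (Sym n)" by (simp add: mem_alg p_def)
  fix w
  show "q w = conv n p young_sum w"
  proof (cases "w \<in> Sym n")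
    case True
    show ?thesis
    proof (rule invariant_determined[of unshadowed n, OF nonshadow_subset _ _ _ True])
      fix w l assume "l \<in> unshadowed"
      then show "q (w \<circ> adj l) = q w" "conv n p young_sum (w \<circ> adj l) = conv n p young_sum w"
        using q F_conv[OF young_sum_F] by (auto simp: F_iff)
    next
      fix w assume w: "w \<in> Sym n" "asc unshadowed w"
      have "p g * young_sum (inv' g \<circ> w) = (if g = w then q w else 0)" if g: "g \<in> Sym n" for g
      proof (cases "asc unshadowed g \<and> inv' g \<circ> w \<in> W n unshadowed")
        case True
        have "g \<circ> (inv' g \<circ> w) = w" using Sym_inv_o(4)[OF g] .
        then have "inv' g \<circ> w = id" using asc_unique[of "inv' g \<circ> w" n unshadowed g] True w by simp
        then show ?thesis using \<open>g \<circ> (inv' g \<circ> w) = w\<close> True g by (auto simp: p_def young_sum_def)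
      next
        case False
        then have "g \<noteq> w" using w Sym_inv_o(1) by auto
        then show ?thesis using False by (auto simp: p_def young_sum_def)
      qed
      then show "q w = conv n p young_sum w" using w(1) by (simp add: conv_def)
    qed
  next
    case False
    then show ?thesis using q by (simp add: F_iff mem_alg conv_def)
  qed
qed

lemma conv_single_young_sum:
  assumes "s \<in> W n unshadowed"
  shows "conv n (single s) young_sum = young_sum"
proof
  fix w
  have s: "s \<in> Sym n" using assms by (rule W_Sym)
  show "conv n (single s) young_sum w = young_sum w"
  proof (cases "w \<in> Sym n")
    case True
    have "inv' s \<circ> w \<in> W n unshadowed \<longleftrightarrow> w \<in> W n unshadowed"
      by (metis W_comp W_inv assms Sym_inv_o(4)[OF s])
    then show ?thesis using True s by (simp add: conv_single_left young_sum_def)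
  next
    case False
    then show ?thesis using s by (auto simp: conv_single_left young_sum_def dest: W_Sym)
  qed
qed

text \<open>
  The elements \<open>(i a)\<close> represent the cosets of the Young subgroup in the larger one that permutes the whole
  block; the coset of \<open>w\<close> is the one with \<open>a = w i\<close>.
\<close>

lemma block_sum_young_sum:
  assumes k: "k \<in> {2..m}"
  defines "i \<equiv> off k + 1"
  shows "(\<Sum>a\<in>block j k. conv n (single (transpose i a)) young_sum) w =
    (if w \<in> W n (unshadowed \<union> {i}) then 1 else (0 :: 'k :: {comm_ring, comm_monoid_mult}))"
proof -
  let ?J = "unshadowed \<union> {i}"
  have iI: "i \<in> I" using k by (simp add: i_def I_def)
  have J: "?J \<inter> off ` {2..m} = {}" using off_notin_unshadowed iI by auto
  have iNS: "i \<notin> unshadowed" using iI by (simp add: nonshadow_def)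
  have ib: "i \<in> block j k" using block_first[OF k] by (simp add: i_def)
  have tS: "transpose i a \<in> Sym n" if "a \<in> block j k" for a
    using that ib block_sub[of k] k by (intro Sym_transpose) auto
  have tW: "transpose i a \<in> W n ?J" if a: "a \<in> block j k" for a
  proof (rule W_transpose)
    show "1 \<le> i" "i \<le> a" "a \<le> n" using a block_sub[of k] k by (auto simp: i_def block_def)
    show "{i..<a} \<subseteq> ?J"
    proof
      fix d assume d: "d \<in> {i..<a}"
      show "d \<in> ?J"
      proof (cases "d = i")
        case False
        then have "d \<in> {off k + 1<..<off (k + 1)}" using d a k by (auto simp: i_def block_eq)
        then show ?thesis using block_rest_unshadowed[OF k] by blast
      qed simp
    qed
  qed
  have fin: "finite (block j k)" by (simp add: block_def)
  have sumf: "(\<Sum>a\<in>D. f a) w = (\<Sum>a\<in>D. f a w)" for D and f :: "nat \<Rightarrow> (nat \<Rightarrow> nat) \<Rightarrow> 'k"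
    by (induction D rule: infinite_finite_induct) auto
  have eq: "conv n (single (transpose i a)) young_sum w = (if w \<in> W n ?J \<and> a = w i then 1 else (0 :: 'k))"
    if a: "a \<in> block j k" for a
  proof (cases "w \<in> Sym n")
    case True
    have "transpose i a \<circ> w \<in> W n unshadowed \<longleftrightarrow> w \<in> W n ?J \<and> a = w i"
    proof
      assume *: "transpose i a \<circ> w \<in> W n unshadowed"
      then have "transpose i a \<circ> w \<in> W n ?J" using W_mono[of unshadowed ?J n] by blast
      then have "transpose i a \<circ> (transpose i a \<circ> w) \<in> W n ?J" by (rule W_comp[OF tW[OF a]])
      then have "w \<in> W n ?J" by (simp add: comp_assoc[symmetric])
      moreover have "transpose i a (w i) = i" using fixes_first[OF * iI] by simp
      then have "a = w i" by (metis transpose_apply_first transpose_involutory)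
      ultimately show "w \<in> W n ?J \<and> a = w i" ..
    next
      assume *: "w \<in> W n ?J \<and> a = w i"
      then have "transpose i a \<circ> w \<in> W n ?J" using W_comp[OF tW[OF a]] by blast
      then have "transpose i a \<circ> w \<in> W n (?J - I)"
        by (rule fix_in_W[OF _ J]) (use * in \<open>auto simp: nonshadow_def\<close>)
      then show "transpose i a \<circ> w \<in> W n unshadowed" using W_mono[of "?J - I" unshadowed n] iI by blast
    qed
    then show ?thesis using True tS[OF a] by (simp add: conv_single_left young_sum_def)
  next
    case False
    then show ?thesis using W_Sym[of w n ?J] by (auto simp: conv_def)
  qed
  have "(\<Sum>a\<in>block j k. conv n (single (transpose i a)) young_sum) w
      = (\<Sum>a\<in>block j k. if w \<in> W n ?J \<and> a = w i then 1 else (0 :: 'k))"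
    unfolding sumf by (rule sum.cong[OF refl eq])
  also have "\<dots> = (if w \<in> W n ?J then 1 else 0)"
    using W_block[of w ?J k i] J k ib fin by auto
  finally show ?thesis .
qed

end

section \<open>The subquotients of the filtration\<close>

locale fib_filtration = blocks n m j for n m :: nat and j :: "nat \<Rightarrow> nat" +
  fixes Q :: "nat \<Rightarrow> nat set" and i :: nat
  assumes Q_listing: "bij_betw Q {1..fib (n + 1)} {I. I \<subseteq> {1..n - 1} \<and> lacunar I}"
    and Q_sums: "\<And>a b. 1 \<le> a \<Longrightarrow> a \<le> b \<Longrightarrow> b \<le> fib (n + 1) \<Longrightarrow> \<Sum>(Q a) \<le> \<Sum>(Q b)"
    and i: "i \<in> {1..fib (n + 1)}" and Qi: "Q i = I"
begin

text \<open>
  For non-lacunar \<open>K\<close> this uses a lacunar set of no larger sum with fewer conditions.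
\<close>

lemma smaller_in_F_filt:
  assumes K: "K \<subseteq> {1..n - 1}" "\<Sum>K < \<Sum>I"
  shows "F n K \<subseteq> F_filt n Q (i - 1)"
proof -
  obtain L where L: "L \<subseteq> {1..n - 1}" "lacunar L" "\<Sum>L \<le> \<Sum>K" "nonshadow n L \<subseteq> nonshadow n K"
    using lacunar_refinement[OF K(1)] by blast
  then obtain t where t: "t \<in> {1..fib (n + 1)}" "Q t = L"
    using Q_listing unfolding bij_betw_def by (metis (mono_tags, lifting) image_iff mem_Collect_eq)
  have "t < i"
  proof (rule ccontr)
    assume "\<not> t < i"
    then have "\<Sum>I \<le> \<Sum>L" using Q_sums[of i t] i t Qi by simp
    then show False using L(3) K(2) by simp
  qed
  then have "F n (Q t) \<subseteq> F_filt n Q (i - 1)" using t by (intro F_subset_F_filt) auto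
  then show ?thesis using F_antimono[OF L(4)] t(2) by blast
qed

text \<open>
  Comparing the sums of \<open>Q\<^sub>t\<close> and \<open>I\<close> for \<open>t < i\<close> yields some \<open>l \<in> I\<close> such that \<open>F(Q\<^sub>t)\<close> is invariant under \<open>s\<^sub>l\<close>.
\<close>

lemma antisym_kills:
  fixes x :: "(nat \<Rightarrow> nat) \<Rightarrow> 'k :: {comm_ring, comm_monoid_mult}"
  assumes "x \<in> F_filt n Q (i - 1)"
  shows "antisym x = 0"
proof -
  obtain q where q: "x = (\<Sum>t\<in>{1..i - 1}. q t)" "\<forall>t\<in>{1..i - 1}. q t \<in> F n (Q t)"
    using assms unfolding F_filt_def by blast
  have 0: "antisym (q t) = 0" if t: "t \<in> {1..i - 1}" for t
  proof -
    have tf: "t \<in> {1..fib (n + 1)}" "t \<noteq> i" using t i by auto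
    have Qt: "Q t \<subseteq> {1..n - 1}" "lacunar (Q t)"
      using Q_listing tf(1) unfolding bij_betw_def by blast+
    have ne: "I \<noteq> Q t" using Q_listing tf i Qi unfolding bij_betw_def inj_on_def by metis
    have "\<Sum>(Q t) \<le> \<Sum>I" using Q_sums[of t i] t i Qi by auto
    then obtain l where l: "l \<in> I" "l \<notin> Q t" "l + 1 \<notin> Q t"
      using lacunar_sum_less[OF finite_I I_lacunar _ Qt(2) _ _ ne] Qt(1) finite_subset
      by (metis atLeastAtMost_iff finite_atLeastAtMost linorder_not_le not_one_le_zero subset_iff)
    then have "l \<in> nonshadow n (Q t)" using I_sub by (auto simp: nonshadow_def)
    then have "\<And>w. q t (w \<circ> adj l) = q t w" using q(2) t by (auto simp: F_iff)
    then show ?thesis unfolding antisym_def using l(1) I_lacunar by (intro foldr_rdiff_kill) auto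
  qed
  have "antisym (\<Sum>t\<in>D. q t) = 0" if "D \<subseteq> {1..i - 1}" for D
    using finite_subset[OF that finite_atLeastAtMost] that
    by (induction D rule: finite_induct)
      (simp_all add: 0[unfolded antisym_def] antisym_def foldr_rdiff_add del: plus_fun_apply zero_fun_apply)
  then show ?thesis using q(1) by blast
qed

text \<open>
  The annihilator of the class of \<open>e\<close> in \<open>F\<^sub>i/F\<^sub>i\<^sub>-\<^sub>1\<close>.
\<close>

lemma filtration_kernel:
  fixes p :: "(nat \<Rightarrow> nat) \<Rightarrow> 'k :: {comm_ring, comm_monoid_mult}"
  assumes p: "p \<in> free (Sym n)"
  shows "conv n p young_sum \<in> F_filt n Q (i - 1) \<longleftrightarrow> conv n p xi = 0"
proof -
  let ?N = "F_filt n Q (i - 1) :: ((nat \<Rightarrow> nat) \<Rightarrow> 'k) set"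
  let ?L = "{p \<in> free (Sym n). conv n p young_sum \<in> ?N}"
  note N = add_subgpD[OF F_filt_subgp]
  have "p \<in> ?L \<longleftrightarrow> conv n p xi = 0"
  proof (rule annihilator_eq[OF _ _ _ _ _ p])
    show "add_subgp ?L"
      unfolding add_subgp_def using N(1,2) by (auto simp: conv_diff_left)
    show "(\<lambda>x. c * p x) \<in> ?L" if "p \<in> ?L" for c and p :: "(nat \<Rightarrow> nat) \<Rightarrow> 'k"
    proof -
      have "conv n p young_sum \<in> free (Sym n)" by simp
      then have "conv n (\<lambda>x. c * single id x) (conv n p young_sum) = (\<lambda>x. c * conv n p young_sum x)"
        by (simp only: conv_scale_left conv_id_left)
      then show ?thesis using that F_filt_conv[of "conv n p young_sum" n Q "i - 1" "\<lambda>x. c * single id x"]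
        by (simp add: conv_scale_left)
    qed
    show "single g - single (g \<circ> adj l) \<in> ?L" if g: "g \<in> Sym n" and l: "l \<in> unshadowed" for g l
    proof -
      have ln: "l \<in> {1..n - 1}" using l nonshadow_subset by blast
      then have aW: "adj l \<in> W n unshadowed" using l by (intro W_transpose) auto
      have "conv n (single (g \<circ> adj l)) young_sum = conv n (single g) (conv n (single (adj l)) young_sum)"
        using g adj_Sym[OF ln] by (simp add: conv_single_single flip: conv_assoc)
      then have "conv n (single (g \<circ> adj l)) young_sum = conv n (single g) (young_sum :: _ \<Rightarrow> 'k)"
        by (simp only: conv_single_young_sum[OF aW])
      then show ?thesis using g Sym_adj_iff[OF ln] N(1) by (simp add: conv_diff_left)
    qed
    show "(\<Sum>a\<in>block j k. single (g \<circ> transpose (off k + 1) a)) \<in> ?L"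
      if g: "g \<in> Sym n" and k: "k \<in> {2..m}" for g k
    proof -
      let ?i = "off k + 1"
      (* Moving the element ?i of I one step down frees the position ?i and lowers the sum;
         the intersection discards the position 0. *)
      define K where "K = (I - {?i}) \<union> ({off k} \<inter> {1..})"
      have iI: "?i \<in> I" using k by (simp add: I_def)
      have tS: "transpose ?i a \<in> Sym n" if "a \<in> block j k" for a
        using that block_first[OF k] block_sub[of k] k by (intro Sym_transpose) auto
      have NSK: "nonshadow n K \<subseteq> unshadowed \<union> {?i}"
        by (auto simp: nonshadow_def K_def)
      have K1: "K \<subseteq> {1..n - 1}" using I_sub off_n[OF k] by (auto simp: K_def)
      have "\<Sum>K \<le> \<Sum>(I - {?i}) + \<Sum>({off k} \<inter> {1..})"
        unfolding K_def using sum_Un_nat[of "I - {?i}" "{off k} \<inter> {1..}" "\<lambda>x. x"] by simp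
      moreover have "\<Sum>({off k} \<inter> {1..}) \<le> off k" by (cases "off k = 0") auto
      moreover have "\<Sum>I = ?i + \<Sum>(I - {?i})" using iI by (simp add: sum.remove)
      ultimately have K2: "\<Sum>K < \<Sum>I" by linarith
      (* f is the sum of the larger Young subgroup, which contains adj ?i. *)
      define f where "f = (\<Sum>a\<in>block j k. conv n (single (transpose ?i a)) (young_sum :: _ \<Rightarrow> 'k))"
      have f: "f w = (if w \<in> W n (unshadowed \<union> {?i}) then 1 else 0)" for w
        unfolding f_def by (rule block_sum_young_sum[OF k])
      have "f \<in> F n K"
        unfolding F_iff
      proof (intro conjI ballI allI)
        show "f \<in> free (Sym n)" by (auto simp: mem_alg f dest: W_Sym)
        fix l w assume l: "l \<in> nonshadow n K"
        then have "l \<in> {1..n - 1}" using nonshadow_subset by blast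
        then have "adj l \<in> W n (unshadowed \<union> {?i})" using l NSK by (intro W_transpose) auto
        then have "w \<circ> adj l \<in> W n (unshadowed \<union> {?i}) \<longleftrightarrow> w \<in> W n (unshadowed \<union> {?i})"
          by (metis W_comp adj_adj)
        then show "f (w \<circ> adj l) = f w" by (simp add: f)
      qed
      then have "f \<in> ?N" using smaller_in_F_filt[OF K1 K2] by blast
      moreover have "conv n (\<Sum>a\<in>block j k. single (g \<circ> transpose ?i a)) young_sum = conv n (single g) f"
        unfolding f_def conv_sum_left conv_sum_right
        by (rule sum.cong) (use g tS in \<open>simp_all add: conv_single_single flip: conv_assoc\<close>)
      moreover have "(\<Sum>a\<in>block j k. single (g \<circ> transpose ?i a)) \<in> free (Sym n)"
        by (intro sum_in_free single_in_free Sym_comp g tS)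
      ultimately show ?thesis using F_filt_conv[of f n Q "i - 1" "single g"]
        by (simp only: mem_Collect_eq simp_thms)
    qed
    show "conv n p xi = 0" if "p \<in> ?L" for p :: "(nat \<Rightarrow> nat) \<Rightarrow> 'k"
      using antisym_kills[of "conv n p young_sum"] that by (simp add: antisym_conv antisym_young_sum)
  qed
  then show ?thesis using p by simp
qed

lemma filtration_generated:
  assumes "x \<in> F_filt n Q i"
  shows "\<exists>p\<in>free (Sym n). x - conv n p young_sum \<in> F_filt n Q (i - 1)"
proof -
  obtain y z where "y \<in> F_filt n Q (i - 1)" "z \<in> F n I" "x = y + z"
    using assms i Qi F_filt_step[of i x n Q] by auto
  then show ?thesis using F_generated[of z] by (metis add_diff_cancel_right')
qed

lemma conv_young_sum_F_filt: "conv n p young_sum \<in> F_filt n Q i"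
  using F_subset_F_filt[of i i n Q] i Qi F_conv[OF young_sum_F, of p] by auto

end

section \<open>Tensor products\<close>

lemma free_abelian_monoid: "abelian_monoid (free_module X)"
  by (rule abelian_monoidI) (auto simp: add.assoc add.commute simp del: plus_fun_apply)

lemma coset_cong_add:
  assumes "add_subgp N" "coset N a = coset N a'" "coset N b = coset N b'"
  shows "coset N (a + b) = coset N (a' + b')"
proof -
  have "(a + b) - (a' + b') = (a - a') + (b - b')" by (simp add: algebra_simps)
  then show ?thesis using assms add_subgpD(3)[OF assms(1), of "a - a'" "b - b'"]
    by (simp only: coset_eq_iff)
qed

lemma push_id_on:
  assumes f: "f \<in> free X" and h: "\<And>x. x \<in> X \<Longrightarrow> h x = x"
  shows "push h f = f"
  using f
proof (induction rule: free_induct)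
  case zero
  show "push h 0 = 0" by (rule push_zero)
next
  case (step f x c)
  have "push h f = f" by (rule step(3))
  then show "push h (f + (\<lambda>y. c * single x y)) = f + (\<lambda>y. c * single x y)"
    using step(1,2) by (simp add: push_add[of _ X] push_scale[of _ X] h del: plus_fun_apply)
qed

lemma finsum_in_carrier:
  assumes "abelian_monoid M" "\<And>h. h \<in> D \<Longrightarrow> f h \<in> carrier M"
  shows "finsum M f D \<in> carrier M"
proof -
  interpret abelian_monoid M by (rule assms(1))
  show ?thesis by (rule finsum_closed) (use assms(2) in auto)
qed

text \<open>
  Closure conditions under which the defining relations of \<^const>\<open>tensor\<close> lie in the free module.
\<close>

locale tensor_prod =
  fixes A :: "'a set" and M :: "('k :: {comm_ring, comm_monoid_mult}, 'm) module"
    and \<rho> :: "'m \<Rightarrow> 'a \<Rightarrow> 'm" and N :: "('a, 'n) module"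
  assumes M_add: "\<And>x x'. x \<in> carrier M \<Longrightarrow> x' \<in> carrier M \<Longrightarrow> x \<oplus>\<^bsub>M\<^esub> x' \<in> carrier M"
    and M_smult: "\<And>c x. x \<in> carrier M \<Longrightarrow> c \<odot>\<^bsub>M\<^esub> x \<in> carrier M"
    and M_act: "\<And>x a. x \<in> carrier M \<Longrightarrow> a \<in> A \<Longrightarrow> \<rho> x a \<in> carrier M"
    and N_add: "\<And>y y'. y \<in> carrier N \<Longrightarrow> y' \<in> carrier N \<Longrightarrow> y \<oplus>\<^bsub>N\<^esub> y' \<in> carrier N"
    and N_smult: "\<And>a y. a \<in> A \<Longrightarrow> y \<in> carrier N \<Longrightarrow> a \<odot>\<^bsub>N\<^esub> y \<in> carrier N"
begin

definition gens :: "('m \<times> 'n \<Rightarrow> 'k) set"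
  where "gens =
    {single (x \<oplus>\<^bsub>M\<^esub> x', y) - single (x, y) - single (x', y) | x x' y.
        x \<in> carrier M \<and> x' \<in> carrier M \<and> y \<in> carrier N} \<union>
     {single (x, y \<oplus>\<^bsub>N\<^esub> y') - single (x, y) - single (x, y') | x y y'.
        x \<in> carrier M \<and> y \<in> carrier N \<and> y' \<in> carrier N} \<union>
     {single (c \<odot>\<^bsub>M\<^esub> x, y) - (\<lambda>z. c * single (x, y) z) | c x y.
        x \<in> carrier M \<and> y \<in> carrier N} \<union>
     {single (\<rho> x a, y) - single (x, a \<odot>\<^bsub>N\<^esub> y) | x a y.
        x \<in> carrier M \<and> a \<in> A \<and> y \<in> carrier N}"

abbreviation X :: "('m \<times> 'n) set"
  where "X \<equiv> carrier M \<times> carrier N"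

abbreviation null :: "('m \<times> 'n \<Rightarrow> 'k) set"
  where "null \<equiv> tensor_null A M \<rho> N"

lemma null_eq: "null = lin_span (free_module X) gens"
  unfolding tensor_null_def tensor_free_def gens_def ..

lemma gens_cases:
  assumes "s \<in> gens"
  obtains (add_left) x x' y where "x \<in> carrier M" "x' \<in> carrier M" "y \<in> carrier N"
      "s = single (x \<oplus>\<^bsub>M\<^esub> x', y) - single (x, y) - single (x', y)"
  | (add_right) x y y' where "x \<in> carrier M" "y \<in> carrier N" "y' \<in> carrier N"
      "s = single (x, y \<oplus>\<^bsub>N\<^esub> y') - single (x, y) - single (x, y')"
  | (scale) c x y where "x \<in> carrier M" "y \<in> carrier N"
      "s = single (c \<odot>\<^bsub>M\<^esub> x, y) - (\<lambda>z. c * single (x, y) z)"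
  | (bal) x a y where "x \<in> carrier M" "a \<in> A" "y \<in> carrier N"
      "s = single (\<rho> x a, y) - single (x, a \<odot>\<^bsub>N\<^esub> y)"
  using assms unfolding gens_def by blast

lemma gens_free: "gens \<subseteq> free X"
proof
  fix s assume "s \<in> gens"
  then show "s \<in> free X"
    by (cases rule: gens_cases)
      (simp_all add: M_add M_smult M_act N_add N_smult del: plus_fun_apply)
qed

lemma null_subgp: "add_subgp null"
  unfolding null_eq by (rule lin_span_subgp)

lemma null_scale: "x \<in> null \<Longrightarrow> (\<lambda>z. c * x z) \<in> null"
  unfolding null_eq by (rule lin_span_scale)

definition pure :: "'m \<Rightarrow> 'n \<Rightarrow> ('m \<times> 'n \<Rightarrow> 'k) set"
  where "pure x y = coset null (single (x, y))"

lemma gens_null: "s \<in> gens \<Longrightarrow> s \<in> null"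
  unfolding null_eq by (rule lin_span_base)

lemma pure_add_left:
  assumes "x \<in> carrier M" "x' \<in> carrier M" "y \<in> carrier N"
  shows "pure (x \<oplus>\<^bsub>M\<^esub> x') y = coset null (single (x, y) + single (x', y))"
proof -
  have "single (x \<oplus>\<^bsub>M\<^esub> x', y) - single (x, y) - single (x', y) \<in> null"
    by (rule gens_null) (use assms in \<open>unfold gens_def, blast\<close>)
  then show ?thesis unfolding pure_def coset_eq_iff[OF null_subgp] by (simp add: algebra_simps)
qed

lemma pure_add_right:
  assumes "x \<in> carrier M" "y \<in> carrier N" "y' \<in> carrier N"
  shows "pure x (y \<oplus>\<^bsub>N\<^esub> y') = coset null (single (x, y) + single (x, y'))"
proof -
  have "single (x, y \<oplus>\<^bsub>N\<^esub> y') - single (x, y) - single (x, y') \<in> null"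
    by (rule gens_null) (use assms in \<open>unfold gens_def, blast\<close>)
  then show ?thesis unfolding pure_def coset_eq_iff[OF null_subgp] by (simp add: algebra_simps)
qed

lemma pure_scale:
  assumes "x \<in> carrier M" "y \<in> carrier N"
  shows "pure (c \<odot>\<^bsub>M\<^esub> x) y = coset null (\<lambda>z. c * single (x, y) z)"
proof -
  have "single (c \<odot>\<^bsub>M\<^esub> x, y) - (\<lambda>z. c * single (x, y) z) \<in> null"
    by (rule gens_null) (use assms in \<open>unfold gens_def, blast\<close>)
  then show ?thesis unfolding pure_def coset_eq_iff[OF null_subgp] .
qed

lemma pure_bal:
  assumes "x \<in> carrier M" "a \<in> A" "y \<in> carrier N"
  shows "pure (\<rho> x a) y = pure x (a \<odot>\<^bsub>N\<^esub> y)"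
proof -
  have "single (\<rho> x a, y) - single (x, a \<odot>\<^bsub>N\<^esub> y) \<in> null"
    by (rule gens_null) (use assms in \<open>unfold gens_def, blast\<close>)
  then show ?thesis unfolding pure_def coset_eq_iff[OF null_subgp] .
qed

lemma pure_zero_left:
  assumes "z \<in> carrier M" "z \<oplus>\<^bsub>M\<^esub> z = z" "y \<in> carrier N"
  shows "pure z y = null"
proof -
  have "coset null (single (z, y)) = coset null (single (z, y) + single (z, y))"
    using pure_add_left[of z z y] assms by (simp add: pure_def)
  then have "- single (z, y) \<in> null" unfolding coset_eq_iff[OF null_subgp] by simp
  then have "single (z, y) - 0 \<in> null" using add_subgpD(4)[OF null_subgp] by fastforce
  then show ?thesis unfolding pure_def using coset_eq_iff[OF null_subgp, of "single (z, y)" 0] by simp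
qed

lemma pure_zero_right:
  assumes "z \<in> carrier N" "z \<oplus>\<^bsub>N\<^esub> z = z" "x \<in> carrier M"
  shows "pure x z = null"
proof -
  have "coset null (single (x, z)) = coset null (single (x, z) + single (x, z))"
    using pure_add_right[of x z z] assms by (simp add: pure_def)
  then have "- single (x, z) \<in> null" unfolding coset_eq_iff[OF null_subgp] by simp
  then have "single (x, z) - 0 \<in> null" using add_subgpD(4)[OF null_subgp] by fastforce
  then show ?thesis unfolding pure_def using coset_eq_iff[OF null_subgp, of "single (x, z)" 0] by simp
qed

lemma carrier_tensor: "carrier (tensor A M \<rho> N) = coset null ` free X"
  unfolding tensor_def tensor_free_def by (rule quot_carrier) simp

lemma add_tensor: "coset null x \<oplus>\<^bsub>tensor A M \<rho> N\<^esub> coset null y = coset null (x + y)"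
  unfolding tensor_def tensor_free_def by (rule quot_add[OF null_subgp]) simp

lemma zero_tensor: "\<zero>\<^bsub>tensor A M \<rho> N\<^esub> = null"
  unfolding tensor_def by (rule quot_zero)

lemma smult_tensor: "c \<odot>\<^bsub>tensor A M \<rho> N\<^esub> coset null x = coset null (\<lambda>z. c * x z)"
  unfolding tensor_def tensor_free_def null_eq by (rule quot_smult_free)

lemma tensor_abelian_monoid: "abelian_monoid (tensor A M \<rho> N)"
  unfolding tensor_def tensor_free_def by (rule quot_abelian_monoid[OF null_subgp]) auto

lemma coset_val_tensor:
  assumes "\<And>x x' y. x \<in> carrier M \<Longrightarrow> x' \<in> carrier M \<Longrightarrow> y \<in> carrier N
      \<Longrightarrow> \<phi> (x \<oplus>\<^bsub>M\<^esub> x', y) = \<phi> (x, y) + \<phi> (x', y)"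
    and "\<And>x y y'. x \<in> carrier M \<Longrightarrow> y \<in> carrier N \<Longrightarrow> y' \<in> carrier N
      \<Longrightarrow> \<phi> (x, y \<oplus>\<^bsub>N\<^esub> y') = \<phi> (x, y) + \<phi> (x, y')"
    and "\<And>c x y. x \<in> carrier M \<Longrightarrow> y \<in> carrier N \<Longrightarrow> \<phi> (c \<odot>\<^bsub>M\<^esub> x, y) = c * \<phi> (x, y)"
    and "\<And>x a y. x \<in> carrier M \<Longrightarrow> a \<in> A \<Longrightarrow> y \<in> carrier N \<Longrightarrow> \<phi> (\<rho> x a, y) = \<phi> (x, a \<odot>\<^bsub>N\<^esub> y)"
  shows tensor_null_lin_ext: "f \<in> null \<Longrightarrow> lin_ext \<phi> f = 0"
    and "f \<in> free X \<Longrightarrow> coset_val (lin_ext \<phi>) (coset null f) = lin_ext \<phi> f"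
proof -
  have *: "lin_ext \<phi> s = 0" if "s \<in> gens" for s
    using that
  proof (cases rule: gens_cases)
    case (add_left x x' y)
    then show ?thesis using assms(1)
      by (simp add: lin_ext_diff[of _ X] M_add)
  next
    case (add_right x y y')
    then show ?thesis using assms(2)
      by (simp add: lin_ext_diff[of _ X] N_add)
  next
    case (scale c x y)
    then show ?thesis using assms(3)
      by (simp add: lin_ext_diff[of _ X] lin_ext_scale[of _ X] M_smult)
  next
    case (bal x a y)
    then show ?thesis using assms(4)
      by (simp add: lin_ext_diff[of _ X] M_act N_smult)
  qed
  show "f \<in> null \<Longrightarrow> lin_ext \<phi> f = 0"
    unfolding null_eq by (rule lin_span_lin_ext[OF gens_free *])
  show "f \<in> free X \<Longrightarrow> coset_val (lin_ext \<phi>) (coset null f) = lin_ext \<phi> f"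
    unfolding null_eq by (rule coset_val_lin_ext_coset[OF gens_free *])
qed

lemma tensor_map_coset:
  assumes f: "\<And>x. x \<in> carrier M \<Longrightarrow> f x \<in> carrier M"
    and h: "\<And>y. y \<in> carrier N \<Longrightarrow> h y \<in> carrier N"
    and "\<And>x x'. x \<in> carrier M \<Longrightarrow> x' \<in> carrier M \<Longrightarrow> f (x \<oplus>\<^bsub>M\<^esub> x') = f x \<oplus>\<^bsub>M\<^esub> f x'"
    and "\<And>y y'. y \<in> carrier N \<Longrightarrow> y' \<in> carrier N \<Longrightarrow> h (y \<oplus>\<^bsub>N\<^esub> y') = h y \<oplus>\<^bsub>N\<^esub> h y'"
    and "\<And>c x. x \<in> carrier M \<Longrightarrow> f (c \<odot>\<^bsub>M\<^esub> x) = c \<odot>\<^bsub>M\<^esub> f x"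
    and "\<And>x a. x \<in> carrier M \<Longrightarrow> a \<in> A \<Longrightarrow> f (\<rho> x a) = \<rho> (f x) a"
    and "\<And>a y. a \<in> A \<Longrightarrow> y \<in> carrier N \<Longrightarrow> h (a \<odot>\<^bsub>N\<^esub> y) = a \<odot>\<^bsub>N\<^esub> h y"
    and t: "t \<in> free X"
  shows "tensor_map A M \<rho> N f h (coset null t) = coset null (push (\<lambda>(x, y). (f x, h y)) t)"
  unfolding tensor_map_def tensor_free_def null_eq
proof (rule coset_map_push[OF gens_free _ t])
  let ?p = "\<lambda>(x, y). (f x, h y)"
  fix s assume "s \<in> gens"
  then have "push ?p s \<in> gens"
  proof (cases rule: gens_cases)
    case (add_left x x' y)
    then have "push ?p s = single (f x \<oplus>\<^bsub>M\<^esub> f x', h y) - single (f x, h y) - single (f x', h y)"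
      using assms(3) by (simp add: push_diff[of _ X] M_add)
    then show ?thesis using f h add_left(1-3) unfolding gens_def by blast
  next
    case (add_right x y y')
    then have "push ?p s = single (f x, h y \<oplus>\<^bsub>N\<^esub> h y') - single (f x, h y) - single (f x, h y')"
      using assms(4) by (simp add: push_diff[of _ X] N_add)
    then show ?thesis using f h add_right(1-3) unfolding gens_def by blast
  next
    case (scale c x y)
    then have "push ?p s = single (c \<odot>\<^bsub>M\<^esub> f x, h y) - (\<lambda>z. c * single (f x, h y) z)"
      using assms(5) by (simp add: push_diff[of _ X] push_scale[of _ X] M_smult)
    then show ?thesis using f h scale(1-2) unfolding gens_def by blast
  next
    case (bal x a y)
    then have "push ?p s = single (\<rho> (f x) a, h y) - single (f x, a \<odot>\<^bsub>N\<^esub> h y)"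
      using assms(6,7) by (simp add: push_diff[of _ X] M_act N_smult)
    then show ?thesis using f h bal(1-3) unfolding gens_def by blast
  qed
  then show "push ?p s \<in> lin_span (free_module X) gens" by (rule lin_span_base)
qed

end

text \<open>
  Closure conditions of the same kind for tensor products of families.
\<close>

locale mtensor_prod =
  fixes J :: "'i set" and M :: "'i \<Rightarrow> ('k :: {comm_ring, comm_monoid_mult}, 'v) module"
  assumes M_add: "\<And>i u v. i \<in> J \<Longrightarrow> u \<in> carrier (M i) \<Longrightarrow> v \<in> carrier (M i) \<Longrightarrow> u \<oplus>\<^bsub>M i\<^esub> v \<in> carrier (M i)"
    and M_smult: "\<And>i c u. i \<in> J \<Longrightarrow> u \<in> carrier (M i) \<Longrightarrow> c \<odot>\<^bsub>M i\<^esub> u \<in> carrier (M i)"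
begin

definition gens :: "(('i \<Rightarrow> 'v) \<Rightarrow> 'k) set"
  where "gens =
    {single (x(i := u \<oplus>\<^bsub>M i\<^esub> v)) - single (x(i := u)) - single (x(i := v)) | x i u v.
        x \<in> (\<Pi>\<^sub>E i\<in>J. carrier (M i)) \<and> i \<in> J \<and> u \<in> carrier (M i) \<and> v \<in> carrier (M i)} \<union>
     {single (x(i := c \<odot>\<^bsub>M i\<^esub> u)) - (\<lambda>z. c * single (x(i := u)) z) | c x i u.
        x \<in> (\<Pi>\<^sub>E i\<in>J. carrier (M i)) \<and> i \<in> J \<and> u \<in> carrier (M i)}"

abbreviation X :: "('i \<Rightarrow> 'v) set"
  where "X \<equiv> (\<Pi>\<^sub>E i\<in>J. carrier (M i))"

abbreviation null :: "(('i \<Rightarrow> 'v) \<Rightarrow> 'k) set"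
  where "null \<equiv> mtensor_null J M"

lemma null_eq: "null = lin_span (free_module X) gens"
  unfolding mtensor_null_def mtensor_free_def gens_def ..

lemma gens_cases:
  assumes "s \<in> gens"
  obtains (add) x i u v where "x \<in> X" "i \<in> J" "u \<in> carrier (M i)" "v \<in> carrier (M i)"
      "s = single (x(i := u \<oplus>\<^bsub>M i\<^esub> v)) - single (x(i := u)) - single (x(i := v))"
  | (scale) c x i u where "x \<in> X" "i \<in> J" "u \<in> carrier (M i)"
      "s = single (x(i := c \<odot>\<^bsub>M i\<^esub> u)) - (\<lambda>z. c * single (x(i := u)) z)"
  using assms unfolding gens_def by blast

lemma upd_X: "x \<in> X \<Longrightarrow> i \<in> J \<Longrightarrow> u \<in> carrier (M i) \<Longrightarrow> x(i := u) \<in> X"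
  by (auto simp: PiE_iff extensional_def)

lemma gens_free: "gens \<subseteq> free X"
proof
  fix s assume "s \<in> gens"
  then show "s \<in> free X"
    by (cases rule: gens_cases) (simp_all add: M_add M_smult upd_X)
qed

lemma null_subgp: "add_subgp null"
  unfolding null_eq by (rule lin_span_subgp)

definition pure :: "('i \<Rightarrow> 'v) \<Rightarrow> (('i \<Rightarrow> 'v) \<Rightarrow> 'k) set"
  where "pure x = coset null (single x)"

lemma gens_null: "s \<in> gens \<Longrightarrow> s \<in> null"
  unfolding null_eq by (rule lin_span_base)

lemma pure_add:
  assumes "x \<in> X" "i \<in> J" "u \<in> carrier (M i)" "v \<in> carrier (M i)"
  shows "pure (x(i := u \<oplus>\<^bsub>M i\<^esub> v)) = coset null (single (x(i := u)) + single (x(i := v)))"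
proof -
  have "single (x(i := u \<oplus>\<^bsub>M i\<^esub> v)) - single (x(i := u)) - single (x(i := v)) \<in> null"
    by (rule gens_null) (use assms in \<open>unfold gens_def, blast\<close>)
  then show ?thesis unfolding pure_def coset_eq_iff[OF null_subgp] by (simp add: algebra_simps)
qed

lemma pure_scale:
  assumes "x \<in> X" "i \<in> J" "u \<in> carrier (M i)"
  shows "pure (x(i := c \<odot>\<^bsub>M i\<^esub> u)) = coset null (\<lambda>z. c * single (x(i := u)) z)"
proof -
  have "single (x(i := c \<odot>\<^bsub>M i\<^esub> u)) - (\<lambda>z. c * single (x(i := u)) z) \<in> null"
    by (rule gens_null) (use assms in \<open>unfold gens_def, blast\<close>)
  then show ?thesis unfolding pure_def coset_eq_iff[OF null_subgp] .
qed

lemma carrier_mtensor: "carrier (mtensor J M) = coset null ` free X"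
  unfolding mtensor_def mtensor_free_def by (rule quot_carrier) simp

lemma add_mtensor: "coset null x \<oplus>\<^bsub>mtensor J M\<^esub> coset null y = coset null (x + y)"
  unfolding mtensor_def mtensor_free_def by (rule quot_add[OF null_subgp]) simp

lemma zero_mtensor: "\<zero>\<^bsub>mtensor J M\<^esub> = null"
  unfolding mtensor_def by (rule quot_zero)

lemma smult_mtensor: "c \<odot>\<^bsub>mtensor J M\<^esub> coset null x = coset null (\<lambda>z. c * x z)"
  unfolding mtensor_def mtensor_free_def null_eq by (rule quot_smult_free)

lemma mtensor_abelian_monoid: "abelian_monoid (mtensor J M)"
  unfolding mtensor_def mtensor_free_def by (rule quot_abelian_monoid[OF null_subgp]) auto

lemma coset_val_mtensor:
  assumes "\<And>x i u v. x \<in> X \<Longrightarrow> i \<in> J \<Longrightarrow> u \<in> carrier (M i) \<Longrightarrow> v \<in> carrier (M i)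
      \<Longrightarrow> \<phi> (x(i := u \<oplus>\<^bsub>M i\<^esub> v)) = \<phi> (x(i := u)) + \<phi> (x(i := v))"
    and "\<And>c x i u. x \<in> X \<Longrightarrow> i \<in> J \<Longrightarrow> u \<in> carrier (M i)
      \<Longrightarrow> \<phi> (x(i := c \<odot>\<^bsub>M i\<^esub> u)) = c * \<phi> (x(i := u))"
    and F: "f \<in> free X"
  shows "coset_val (lin_ext \<phi>) (coset null f) = lin_ext \<phi> f"
  unfolding null_eq
proof (rule coset_val_lin_ext_coset[OF gens_free _ F])
  fix s assume "s \<in> gens"
  then show "lin_ext \<phi> s = 0"
  proof (cases rule: gens_cases)
    case (add x i u v)
    then show ?thesis using assms(1) by (simp add: lin_ext_diff[of _ X] M_add upd_X)
  next
    case (scale c x i u)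
    then show ?thesis using assms(2)
      by (simp add: lin_ext_diff[of _ X] lin_ext_scale[of _ X] M_smult upd_X)
  qed
qed

lemma mtensor_map_coset:
  assumes f: "\<And>i u. i \<in> J \<Longrightarrow> u \<in> carrier (M i) \<Longrightarrow> f i u \<in> carrier (M i)"
    and "\<And>i u v. i \<in> J \<Longrightarrow> u \<in> carrier (M i) \<Longrightarrow> v \<in> carrier (M i)
      \<Longrightarrow> f i (u \<oplus>\<^bsub>M i\<^esub> v) = f i u \<oplus>\<^bsub>M i\<^esub> f i v"
    and "\<And>i c u. i \<in> J \<Longrightarrow> u \<in> carrier (M i) \<Longrightarrow> f i (c \<odot>\<^bsub>M i\<^esub> u) = c \<odot>\<^bsub>M i\<^esub> f i u"
    and t: "t \<in> free X"
  shows "mtensor_map J M f (coset null t) = coset null (push (\<lambda>x. \<lambda>i\<in>J. f i (x i)) t)"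
  unfolding mtensor_map_def mtensor_free_def null_eq
proof (rule coset_map_push[OF gens_free _ t])
  let ?p = "\<lambda>x. \<lambda>i\<in>J. f i (x i)"
  have p: "?p x \<in> X" if "x \<in> X" for x using that f by (auto simp: PiE_iff)
  have upd: "?p (x(i := u)) = (?p x)(i := f i u)" if "i \<in> J" for x i u
    using that by (auto simp: fun_eq_iff)
  fix s assume "s \<in> gens"
  then have "push ?p s \<in> gens"
  proof (cases rule: gens_cases)
    case (add x i u v)
    have "push ?p s = single (?p (x(i := u \<oplus>\<^bsub>M i\<^esub> v))) - single (?p (x(i := u))) - single (?p (x(i := v)))"
      using add by (simp only: push_diff[of _ X] push_single diff_in_free single_in_free upd_X M_add)
    also have "\<dots> = single ((?p x)(i := f i u \<oplus>\<^bsub>M i\<^esub> f i v)) - single ((?p x)(i := f i u))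
        - single ((?p x)(i := f i v))"
      using add assms(2) by (simp only: upd)
    finally show ?thesis using f p add(1-4) unfolding gens_def by blast
  next
    case (scale c x i u)
    have "push ?p s = single (?p (x(i := c \<odot>\<^bsub>M i\<^esub> u))) - (\<lambda>z. c * single (?p (x(i := u))) z)"
      using scale by (simp only: push_diff[of _ X] push_scale[of _ X] push_single scale_in_free
          single_in_free upd_X M_smult)
    also have "\<dots> = single ((?p x)(i := c \<odot>\<^bsub>M i\<^esub> f i u)) - (\<lambda>z. c * single ((?p x)(i := f i u)) z)"
      using scale assms(3) by (simp only: upd)
    finally show ?thesis using f p scale(1-3) unfolding gens_def by blast
  qed
  then show "push ?p s \<in> lin_span (free_module X) gens" by (rule lin_span_base)
qed

end

section \<open>The reflection quotient representation\<close>

lemma push_perm: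
  assumes g: "g \<in> Sym p" and f: "f \<in> free {1..p}"
  shows "push g f = f \<circ> inv' g"
proof
  fix y
  have gi: "g x = y \<longleftrightarrow> x = inv' g y" for x
    using permutes_inv_eq[of g "{1..p}" y x] g by (auto simp del: One_nat_def simp: mem_Sym)
  have "{x. f x \<noteq> 0 \<and> g x = y} = (if f (inv' g y) \<noteq> 0 then {inv' g y} else {})"
    by (auto simp: gi)
  then show "push g f y = (f \<circ> inv' g) y" by (simp add: push_def)
qed

definition const_vecs :: "nat \<Rightarrow> (nat \<Rightarrow> 'k :: {comm_ring, comm_monoid_mult}) set"
  where "const_vecs p = {(\<lambda>i. if i \<in> {1..p} then a else 0) | a. True}"

lemma const_vecs_subgp: "add_subgp (const_vecs p)"
  unfolding add_subgp_def
proof (intro conjI ballI)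
  have "(0 :: nat \<Rightarrow> 'a) = (\<lambda>i. if i \<in> {1..p} then 0 else 0)" by (simp add: fun_eq_iff)
  then show "(0 :: nat \<Rightarrow> 'a) \<in> const_vecs p" unfolding const_vecs_def by blast
  fix x y :: "nat \<Rightarrow> 'a" assume "x \<in> const_vecs p" "y \<in> const_vecs p"
  then obtain a b where "x = (\<lambda>i. if i \<in> {1..p} then a else 0)" "y = (\<lambda>i. if i \<in> {1..p} then b else 0)"
    unfolding const_vecs_def by blast
  then have "x - y = (\<lambda>i. if i \<in> {1..p} then a - b else 0)" by (simp add: fun_eq_iff)
  then show "x - y \<in> const_vecs p" unfolding const_vecs_def by blast
qed

lemma const_vecs_free: "const_vecs p \<subseteq> free {1..p}"
  unfolding const_vecs_def by (auto simp: mem_free_module intro: finite_subset[of _ "{1..p}"])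

lemma const_vecs_push:
  assumes "g \<in> Sym p" "x \<in> const_vecs p"
  shows "(\<lambda>i. c * push g x i) \<in> const_vecs p"
proof -
  obtain a where a: "x = (\<lambda>i. if i \<in> {1..p} then a else 0)" using assms(2) unfolding const_vecs_def by blast
  have "push g x = x \<circ> inv' g" by (rule push_perm) (use assms const_vecs_free in auto)
  then have "(\<lambda>i. c * push g x i) = (\<lambda>i. if i \<in> {1..p} then c * a else 0)"
    using Sym_in[OF Sym_inv[OF assms(1)]] by (simp add: a fun_eq_iff)
  then show ?thesis unfolding const_vecs_def by blast
qed

lemma perm_rep_simps [simp]:
  "carrier (perm_rep p) = free {1..p}" "add (perm_rep p) = (+)"
  by (simp_all add: perm_rep_def linearize_def)

lemma push_in_perm: "g \<in> Sym p \<Longrightarrow> v \<in> free {1..p} \<Longrightarrow> push g v \<in> free {1..p}"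
  by (rule push_in_free) (use Sym_in in blast)+

lemma perm_rep_act:
  assumes g: "g \<in> Sym p" and v: "v \<in> free {1..p}"
  shows "(\<lambda>h. c * single g h) \<odot>\<^bsub>perm_rep p\<^esub> v = (\<lambda>x. c * push g v x)"
proof -
  have "(\<lambda>h. c * single g h) \<odot>\<^bsub>perm_rep p\<^esub> v = c \<odot>\<^bsub>free_module {1..p}\<^esub> push g v"
    unfolding perm_rep_def
    by (rule linearize_single[OF free_abelian_monoid finite_Sym g])
      (use push_in_perm[OF g v] in \<open>auto simp: fun_eq_iff\<close>)
  then show ?thesis by simp
qed

lemma refl_quot_carrier: "carrier (refl_quot_rep p) = coset (const_vecs p) ` free {1..p}"
  unfolding refl_quot_rep_def const_vecs_def[symmetric] by (simp add: quot_carrier)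

lemma refl_quot_add: "coset (const_vecs p) u \<oplus>\<^bsub>refl_quot_rep p\<^esub> coset (const_vecs p) v = coset (const_vecs p) (u + v)"
  unfolding refl_quot_rep_def const_vecs_def[symmetric] by (simp add: quot_add const_vecs_subgp)

lemma refl_quot_act:
  assumes g: "g \<in> Sym p" and v: "v \<in> free {1..p}"
  shows "(\<lambda>h. c * single g h) \<odot>\<^bsub>refl_quot_rep p\<^esub> coset (const_vecs p) v = coset (const_vecs p) (\<lambda>x. c * push g v x)"
proof -
  have "(\<lambda>h. c * single g h) \<odot>\<^bsub>refl_quot_rep p\<^esub> coset (const_vecs p) v
      = coset (const_vecs p) ((\<lambda>h. c * single g h) \<odot>\<^bsub>perm_rep p\<^esub> v)"
    unfolding refl_quot_rep_def const_vecs_def[symmetric]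
  proof (rule quot_smult_coset[OF const_vecs_subgp])
    fix x :: "nat \<Rightarrow> 'a" assume x: "x \<in> const_vecs p"
    then have xf: "x \<in> free {1..p}" using const_vecs_free by blast
    have "(\<lambda>i. c * push g (x + v) i) - (\<lambda>i. c * push g v i) = (\<lambda>i. c * push g x i)"
      by (simp add: push_add[OF xf v] fun_eq_iff distrib_left)
    then show "(\<lambda>h. c * single g h) \<odot>\<^bsub>perm_rep p\<^esub> (x + v) - (\<lambda>h. c * single g h) \<odot>\<^bsub>perm_rep p\<^esub> v \<in> const_vecs p"
      using perm_rep_act[OF g v, of c] perm_rep_act[OF g add_in_free[OF xf v], of c] const_vecs_push[OF g x, of c]
      by (simp del: plus_fun_apply)
  qed simp
  then show ?thesis by (simp add: perm_rep_act[OF g v])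
qed

lemma refl_quot_act1:
  assumes "g \<in> Sym p" "v \<in> free {1..p}"
  shows "single g \<odot>\<^bsub>refl_quot_rep p\<^esub> coset (const_vecs p) v = coset (const_vecs p) (push g v)"
  using refl_quot_act[OF assms, of 1] by simp

abbreviation refl_quot_mod :: "nat \<Rightarrow> ('k :: {comm_ring, comm_monoid_mult}, (nat \<Rightarrow> 'k) set) module"
  where "refl_quot_mod p \<equiv> underlying (sym_group p) (refl_quot_rep p)"

lemma refl_quot_mod_carrier: "carrier (refl_quot_mod p) = coset (const_vecs p) ` free {1..p}"
  by (simp add: underlying_def refl_quot_carrier)

lemma refl_quot_mod_add: "coset (const_vecs p) u \<oplus>\<^bsub>refl_quot_mod p\<^esub> coset (const_vecs p) v = coset (const_vecs p) (u + v)"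
  by (simp add: underlying_def refl_quot_add)

lemma refl_quot_mod_smult:
  assumes "v \<in> free {1..p}"
  shows "c \<odot>\<^bsub>refl_quot_mod p\<^esub> coset (const_vecs p) v = coset (const_vecs p) (\<lambda>x. c * v x)"
proof -
  have "push id v = v" by (rule push_id_on[OF assms]) simp
  then show ?thesis using refl_quot_act[OF Sym_id assms, of c]
    by (simp add: underlying_def sym_group_one)
qed

text \<open>
  Constant vectors have coordinate differences \<open>0\<close>, so these functionals descend to the reflection
  quotient.
\<close>

definition coord_diff :: "nat \<Rightarrow> nat \<Rightarrow> (nat \<Rightarrow> 'k) set \<Rightarrow> 'k :: {comm_ring, comm_monoid_mult}"
  where "coord_diff a b = coset_val (\<lambda>v. v a - v b)"

lemma coord_diff_coset:
  assumes "a \<in> {1..p}" "b \<in> {1..p}"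
  shows "coord_diff a b (coset (const_vecs p) v) = v a - v b"
  unfolding coord_diff_def
proof (rule coset_val_coset[OF const_vecs_subgp])
  fix h :: "nat \<Rightarrow> 'a" assume "h \<in> const_vecs p"
  then show "(h + v) a - (h + v) b = v a - v b"
    unfolding const_vecs_def using assms by auto
qed

section \<open>The parabolic embedding\<close>

context blocks
begin

lemma par_block:
  assumes "k \<in> {1..m}" "x \<in> block j k"
  shows "parabolic m j \<sigma> x = off k + \<sigma> k (x - off k)"
proof -
  have "(THE k. k \<in> {1..m} \<and> x \<in> block j k) = k"
    using assms block_disjoint by (intro the_equality) blast+
  then show ?thesis using assms unfolding parabolic_def by (auto simp: Let_def)
qed

lemma par_out:
  assumes "\<And>k. k \<in> {1..m} \<Longrightarrow> x \<notin> block j k"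
  shows "parabolic m j \<sigma> x = x"
  using assms unfolding parabolic_def by auto

lemma block_shift: "x \<in> block j k \<longleftrightarrow> off k < x \<and> x - off k \<in> {1..j k}"
  by (auto simp: block_def)

lemma par_in_block:
  assumes "k \<in> {1..m}" "x \<in> block j k" "\<sigma> k \<in> Sym (j k)"
  shows "parabolic m j \<sigma> x \<in> block j k" "parabolic m j \<sigma> x - off k = \<sigma> k (x - off k)"
proof -
  have "\<sigma> k (x - off k) \<in> {1..j k}"
    using assms(2) Sym_in[OF assms(3), of "x - off k"] by (simp add: block_shift)
  then show "parabolic m j \<sigma> x \<in> block j k" "parabolic m j \<sigma> x - off k = \<sigma> k (x - off k)"
    unfolding par_block[OF assms(1,2)] block_shift by auto
qed

lemma par_comp:
  assumes "\<And>k. k \<in> {1..m} \<Longrightarrow> \<tau> k \<in> Sym (j k)"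
  shows "parabolic m j \<sigma> \<circ> parabolic m j \<tau> = parabolic m j (\<lambda>k. \<sigma> k \<circ> \<tau> k)"
proof
  fix x
  show "(parabolic m j \<sigma> \<circ> parabolic m j \<tau>) x = parabolic m j (\<lambda>k. \<sigma> k \<circ> \<tau> k) x"
  proof (cases "\<exists>k\<in>{1..m}. x \<in> block j k")
    case True
    then obtain k where k: "k \<in> {1..m}" "x \<in> block j k" by blast
    note t = par_in_block[of k x \<tau>, OF k assms[OF k(1)]]
    show ?thesis using par_block[OF k(1) t(1), of \<sigma>] t(2) par_block[OF k, of "\<lambda>k. \<sigma> k \<circ> \<tau> k"] by simp
  next
    case False
    then have "parabolic m j \<sigma> x = x" for \<sigma> by (intro par_out) blast
    then show ?thesis by simp
  qed
qed

lemma par_cong: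
  assumes "\<And>k. k \<in> {1..m} \<Longrightarrow> \<sigma> k = \<tau> k"
  shows "parabolic m j \<sigma> = parabolic m j \<tau>"
proof
  fix x
  show "parabolic m j \<sigma> x = parabolic m j \<tau> x"
  proof (cases "\<exists>k\<in>{1..m}. x \<in> block j k")
    case True
    then obtain k where k: "k \<in> {1..m}" "x \<in> block j k" by blast
    show ?thesis unfolding par_block[OF k] using assms[OF k(1)] by simp
  next
    case False
    then have "parabolic m j \<sigma> x = x" for \<sigma> by (intro par_out) blast
    then show ?thesis by simp
  qed
qed

lemma par_id:
  assumes "\<And>k. k \<in> {1..m} \<Longrightarrow> \<sigma> k = id"
  shows "parabolic m j \<sigma> = id"
proof
  fix x
  show "parabolic m j \<sigma> x = id x"
  proof (cases "\<exists>k\<in>{1..m}. x \<in> block j k")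
    case True
    then obtain k where k: "k \<in> {1..m}" "x \<in> block j k" by blast
    show ?thesis unfolding par_block[OF k] using assms[OF k(1)] k(2) by (simp add: block_shift)
  next
    case False
    then show ?thesis using par_out by auto
  qed
qed

lemma par_inv:
  assumes \<sigma>: "\<And>k. k \<in> {1..m} \<Longrightarrow> \<sigma> k \<in> Sym (j k)"
  shows "parabolic m j \<sigma> \<circ> parabolic m j (\<lambda>k. inv' (\<sigma> k)) = id"
    and "parabolic m j (\<lambda>k. inv' (\<sigma> k)) \<circ> parabolic m j \<sigma> = id"
    and "inv' (parabolic m j \<sigma>) = parabolic m j (\<lambda>k. inv' (\<sigma> k))"
proof -
  have i: "\<And>k. k \<in> {1..m} \<Longrightarrow> inv' (\<sigma> k) \<in> Sym (j k)" using \<sigma> by simp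
  show 1: "parabolic m j \<sigma> \<circ> parabolic m j (\<lambda>k. inv' (\<sigma> k)) = id"
    using par_comp[of "\<lambda>k. inv' (\<sigma> k)" \<sigma>, OF i] par_id[of "\<lambda>k. \<sigma> k \<circ> inv' (\<sigma> k)"]
      Sym_inv_o(2)[OF \<sigma>] by simp
  show 2: "parabolic m j (\<lambda>k. inv' (\<sigma> k)) \<circ> parabolic m j \<sigma> = id"
    using par_comp[of \<sigma> "\<lambda>k. inv' (\<sigma> k)", OF \<sigma>] par_id[of "\<lambda>k. inv' (\<sigma> k) \<circ> \<sigma> k"]
      Sym_inv_o(1)[OF \<sigma>] by simp
  show "inv' (parabolic m j \<sigma>) = parabolic m j (\<lambda>k. inv' (\<sigma> k))"
    by (rule inv_unique_comp[OF 1 2])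
qed

lemma par_H:
  assumes \<sigma>: "\<And>k. k \<in> {1..m} \<Longrightarrow> \<sigma> k \<in> Sym (j k)"
  shows "parabolic m j \<sigma> \<in> H"
  unfolding H_def W_def
proof (intro CollectI conjI ballI)
  have bij: "bij (parabolic m j \<sigma>)" using par_inv(1,2)[OF \<sigma>] o_bij by blast
  have "parabolic m j \<sigma> x = x" if "x \<notin> {1..n}" for x
    using that block_sub by (intro par_out) blast
  moreover have "\<exists>!x. parabolic m j \<sigma> x = y" for y using bij unfolding bij_iff by blast
  ultimately show "parabolic m j \<sigma> \<in> Sym n" by (auto simp: mem_Sym permutes_def)
  fix d x assume d: "d \<in> {1..n - 1} - ({1..n - 1} - off ` {2..m})" and x: "x \<in> {1..d}"
  then obtain k' where k': "k' \<in> {2..m}" "d = off k'" by blast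
  show "parabolic m j \<sigma> x \<in> {1..d}"
  proof (cases "\<exists>k\<in>{1..m}. x \<in> block j k")
    case True
    then obtain k where k: "k \<in> {1..m}" "x \<in> block j k" by blast
    have "k < k'"
    proof (rule ccontr)
      assume "\<not> k < k'"
      then have "off k' \<le> off k" by (intro off_mono) simp
      then show False using x k k' by (simp add: block_def)
    qed
    then have "off (Suc k) \<le> off k'" by (intro off_mono) simp
    then show ?thesis using par_in_block(1)[of k x \<sigma>, OF k \<sigma>[OF k(1)]] k k' by (auto simp: block_eq)
  next
    case False
    then show ?thesis using x par_out[of x \<sigma>] by auto
  qed
qed

lemma block_cover:
  assumes "x \<in> {1..n}"
  obtains k where "k \<in> {1..m}" "x \<in> block j k"
proof -
  have "\<exists>k\<in>{1..M}. x \<in> block j k" if "x \<in> {1..off (Suc M)}" for M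
    using that
  proof (induction M)
    case (Suc M)
    show ?case
    proof (cases "x \<le> off (Suc M)")
      case True
      then show ?thesis using Suc by fastforce
    next
      case False
      then have "x \<in> block j (Suc M)" using Suc.prems by (simp add: block_eq)
      then show ?thesis by fastforce
    qed
  qed simp
  from this[of m] show ?thesis using assms total that by auto
qed

lemma unshadowed_block:
  assumes l: "l \<in> unshadowed"
  obtains k where "k \<in> {1..m}" "l \<in> block j k" "l + 1 \<in> block j k"
    "k \<in> {2..m} \<Longrightarrow> l \<noteq> off k + 1"
proof -
  have ln: "l \<in> {1..n - 1}" using l nonshadow_subset by blast
  then have "l \<in> {1..n}" by auto
  then obtain k where k: "k \<in> {1..m}" "l \<in> block j k" by (rule block_cover)
  have "l + 1 \<in> block j k"
  proof (rule ccontr)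
    assume "l + 1 \<notin> block j k"
    then have lk: "l = off (Suc k)" using k by (auto simp: block_eq)
    have "k \<noteq> m" using lk total ln by auto
    then have "Suc k \<in> {2..m}" using k by auto
    then show False using off_notin_unshadowed[of "Suc k"] lk l by simp
  qed
  moreover have "l \<noteq> off k + 1" if "k \<in> {2..m}"
    using l that by (auto simp: nonshadow_def I_def)
  ultimately show ?thesis using that k by blast
qed

end

section \<open>The induced representation\<close>

text \<open>
  The parameter \<open>ty\<close> only fixes the base ring \<open>'k\<close>, so that the constants below need no type annotations.
\<close>

locale ind_blocks = blocks n m j for n m :: nat and j :: "nat \<Rightarrow> nat" +
  fixes ty :: "'k :: {comm_ring, comm_monoid_mult} itself"
begin

abbreviation J :: "nat set" where "J \<equiv> {2..m}"

text \<open>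
  The group \<open>S\<^bsub>j 2\<^esub> \<times> \<dots> \<times> S\<^bsub>j m\<^esub>\<close>, and the same with the factor \<open>S\<^bsub>j 1\<^esub>\<close> in front.
\<close>

definition prod_grp where "prod_grp = product_group J (\<lambda>k. sym_group (j k))"
definition par_grp where "par_grp = sym_group (j 1) \<times>\<times> prod_grp"

definition phi :: "(nat \<Rightarrow> nat) \<times> (nat \<Rightarrow> nat \<Rightarrow> nat) \<Rightarrow> nat \<Rightarrow> nat"
  where "phi = (\<lambda>(\<tau>, \<sigma>). parabolic m j (\<sigma>(1 := \<tau>)))"

lemma prod_grp_iff: "h \<in> carrier prod_grp \<longleftrightarrow> (\<forall>k\<in>J. h k \<in> Sym (j k)) \<and> h \<in> extensional J"
  by (auto simp: prod_grp_def PiE_iff)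

lemma par_grp_iff: "(g, h) \<in> carrier par_grp \<longleftrightarrow> g \<in> Sym (j 1) \<and> h \<in> carrier prod_grp"
  by (simp add: par_grp_def)

lemma par_grp_comp:
  assumes "(\<tau>, \<sigma>) \<in> carrier par_grp" "k \<in> {1..m}"
  shows "(\<sigma>(1 := \<tau>)) k \<in> Sym (j k)"
  using assms by (cases "k = 1") (auto simp: par_grp_iff prod_grp_iff)

lemma phi_H:
  assumes "gh \<in> carrier par_grp"
  shows "phi gh \<in> H"
proof -
  obtain g h where "gh = (g, h)" by (cases gh)
  then show ?thesis unfolding phi_def using par_H[of "h(1 := g)", OF par_grp_comp] assms by simp
qed

lemma phi_Sym: "gh \<in> carrier par_grp \<Longrightarrow> phi gh \<in> Sym n"
  using phi_H H_Sym by blast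

lemma finite_prod_grp [simp]: "finite (carrier prod_grp)"
  by (simp add: prod_grp_def finite_PiE)

lemma finite_par_grp [simp]: "finite (carrier par_grp)"
  by (simp add: par_grp_def)

definition one_P :: "nat \<Rightarrow> nat \<Rightarrow> nat"
  where "one_P = (\<lambda>k\<in>J. id)"

lemma one_P: "\<one>\<^bsub>prod_grp\<^esub> = one_P" "one_P \<in> carrier prod_grp"
  by (auto simp: one_P_def prod_grp_def sym_group_one)

lemma one_par_grp: "\<one>\<^bsub>par_grp\<^esub> = (id, one_P)" "(id, one_P) \<in> carrier par_grp"
  by (simp_all add: par_grp_def one_P sym_group_one)

lemma phi_one: "phi (id, one_P) = id"
  unfolding phi_def prod.case by (rule par_id) (auto simp: one_P_def)

definition Z_factor :: "nat \<Rightarrow> ('k, (nat \<Rightarrow> 'k) set) module"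
  where "Z_factor k = refl_quot_mod (j k)"

sublocale MT: mtensor_prod J Z_factor
proof
  fix i u v c
  assume u: "u \<in> carrier (Z_factor i)"
  then obtain u' where u': "u = coset (const_vecs (j i)) u'" "u' \<in> free {1..j i}"
    by (auto simp: Z_factor_def refl_quot_mod_carrier)
  then show "c \<odot>\<^bsub>Z_factor i\<^esub> u \<in> carrier (Z_factor i)" by (auto simp: Z_factor_def refl_quot_mod_smult refl_quot_mod_carrier)
  assume "v \<in> carrier (Z_factor i)"
  with u' show "u \<oplus>\<^bsub>Z_factor i\<^esub> v \<in> carrier (Z_factor i)"
    by (auto simp: Z_factor_def refl_quot_mod_carrier refl_quot_mod_add simp del: plus_fun_apply)
qed

abbreviation Z_tensor where "Z_tensor \<equiv> mtensor J Z_factor"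

text \<open>
  The action of \<open>h\<close> on tuples of elements of the reflection quotients.
\<close>

abbreviation hmap :: "(nat \<Rightarrow> nat \<Rightarrow> nat) \<Rightarrow> (nat \<Rightarrow> (nat \<Rightarrow> 'k) set) \<Rightarrow> nat \<Rightarrow> (nat \<Rightarrow> 'k) set"
  where "hmap h x \<equiv> \<lambda>i\<in>J. single (h i) \<odot>\<^bsub>refl_quot_rep (j i)\<^esub> x i"

text \<open>
  The representation \<open>Z\<^bsub>j 2\<^esub> \<otimes> \<dots> \<otimes> Z\<^bsub>j m\<^esub>\<close>.
\<close>

definition Z_rep :: "((nat \<Rightarrow> nat \<Rightarrow> nat) \<Rightarrow> 'k, ((nat \<Rightarrow> (nat \<Rightarrow> 'k) set) \<Rightarrow> 'k) set) module"
  where "Z_rep = rep_mtensor J (\<lambda>k. sym_group (j k)) (\<lambda>k. refl_quot_rep (j k))"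

lemma Z_rep_eq: "Z_rep = linearize prod_grp Z_tensor
    (\<lambda>g. mtensor_map J Z_factor (\<lambda>i v. single (g i) \<odot>\<^bsub>refl_quot_rep (j i)\<^esub> v))"
  unfolding Z_rep_def rep_mtensor_def Let_def prod_grp_def Z_factor_def[abs_def] ..

lemma Z_act_closed:
  assumes "g \<in> Sym (j k)" "u \<in> carrier (Z_factor k)"
  shows "single g \<odot>\<^bsub>refl_quot_rep (j k)\<^esub> u \<in> carrier (Z_factor k)"
proof -
  obtain v where v: "u = coset (const_vecs (j k)) v" "v \<in> free {1..j k}"
    using assms(2) by (auto simp: Z_factor_def refl_quot_mod_carrier)
  show ?thesis
    unfolding v(1) refl_quot_act1[OF assms(1) v(2)] Z_factor_def refl_quot_mod_carrier
    by (intro imageI push_in_perm assms(1) v(2))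
qed

lemma hmap_X: "h \<in> carrier prod_grp \<Longrightarrow> z \<in> MT.X \<Longrightarrow> hmap h z \<in> MT.X"
  by (auto simp: PiE_iff prod_grp_iff intro: Z_act_closed)

lemma mmap_coset:
  assumes h: "h \<in> carrier prod_grp" and f: "f \<in> free MT.X"
  shows "mtensor_map J Z_factor (\<lambda>i v. single (h i) \<odot>\<^bsub>refl_quot_rep (j i)\<^esub> v) (coset MT.null f)
    = coset MT.null (push (hmap h) f)"
proof (rule MT.mtensor_map_coset[OF _ _ _ f])
  fix i c and u v :: "(nat \<Rightarrow> 'k) set" assume i: "i \<in> J" and u: "u \<in> carrier (Z_factor i)"
  have hi: "h i \<in> Sym (j i)" using h i by (auto simp: prod_grp_iff)
  then show "single (h i) \<odot>\<^bsub>refl_quot_rep (j i)\<^esub> u \<in> carrier (Z_factor i)" using u by (rule Z_act_closed)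
  obtain u' where u': "u = coset (const_vecs (j i)) u'" "u' \<in> free {1..j i}"
    using u by (auto simp: Z_factor_def refl_quot_mod_carrier)
  show "single (h i) \<odot>\<^bsub>refl_quot_rep (j i)\<^esub> (c \<odot>\<^bsub>Z_factor i\<^esub> u)
      = c \<odot>\<^bsub>Z_factor i\<^esub> (single (h i) \<odot>\<^bsub>refl_quot_rep (j i)\<^esub> u)"
    unfolding u'(1) Z_factor_def refl_quot_mod_smult[OF u'(2)] refl_quot_act1[OF hi u'(2)]
      refl_quot_act1[OF hi scale_in_free[OF u'(2)]] refl_quot_mod_smult[OF push_in_perm[OF hi u'(2)]]
      push_scale[OF u'(2)] ..
  assume "v \<in> carrier (Z_factor i)"
  then obtain v' where v': "v = coset (const_vecs (j i)) v'" "v' \<in> free {1..j i}"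
    by (auto simp: Z_factor_def refl_quot_mod_carrier)
  show "single (h i) \<odot>\<^bsub>refl_quot_rep (j i)\<^esub> (u \<oplus>\<^bsub>Z_factor i\<^esub> v)
      = single (h i) \<odot>\<^bsub>refl_quot_rep (j i)\<^esub> u \<oplus>\<^bsub>Z_factor i\<^esub> single (h i) \<odot>\<^bsub>refl_quot_rep (j i)\<^esub> v"
    unfolding u'(1) v'(1) Z_factor_def refl_quot_mod_add refl_quot_act1[OF hi u'(2)] refl_quot_act1[OF hi v'(2)]
      refl_quot_act1[OF hi add_in_free[OF u'(2) v'(2)]] push_add[OF u'(2) v'(2)] ..
qed

lemma push_hmap_free:
  "h \<in> carrier prod_grp \<Longrightarrow> f \<in> free MT.X \<Longrightarrow> push (hmap h) f \<in> free MT.X"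
  by (rule push_in_free[where X = MT.X], assumption, rule hmap_X)

lemma coset_null_zero: "coset N (\<lambda>z. 0 * f z) = (N :: ('x \<Rightarrow> 'k) set)"
proof -
  have "(\<lambda>z. 0 * f z) = 0" by (simp add: fun_eq_iff)
  then show ?thesis by simp
qed

lemma Z_rep_act:
  assumes h: "h \<in> carrier prod_grp" and f: "f \<in> free MT.X"
  shows "(\<lambda>z. c * single h z) \<odot>\<^bsub>Z_rep\<^esub> coset MT.null f = coset MT.null (\<lambda>z. c * push (hmap h) f z)"
proof -
  have "(\<lambda>z. c * single h z) \<odot>\<^bsub>Z_rep\<^esub> coset MT.null f = c \<odot>\<^bsub>Z_tensor\<^esub>
      mtensor_map J Z_factor (\<lambda>i v. single (h i) \<odot>\<^bsub>refl_quot_rep (j i)\<^esub> v) (coset MT.null f)"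
    unfolding Z_rep_eq
  proof (rule linearize_single[OF MT.mtensor_abelian_monoid finite_prod_grp h])
    fix h' assume "h' \<in> carrier prod_grp"
    then show "0 \<odot>\<^bsub>Z_tensor\<^esub> mtensor_map J Z_factor (\<lambda>i v. single (h' i) \<odot>\<^bsub>refl_quot_rep (j i)\<^esub> v) (coset MT.null f)
        = \<zero>\<^bsub>Z_tensor\<^esub>"
      using mmap_coset[OF _ f, of h'] by (simp only: MT.smult_mtensor MT.zero_mtensor coset_null_zero)
  next
    show "c \<odot>\<^bsub>Z_tensor\<^esub> mtensor_map J Z_factor (\<lambda>i v. single (h i) \<odot>\<^bsub>refl_quot_rep (j i)\<^esub> v) (coset MT.null f)
        \<in> carrier Z_tensor"
      unfolding mmap_coset[OF h f] MT.smult_mtensor MT.carrier_mtensor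
      by (intro imageI scale_in_free push_hmap_free h f)
  qed
  then show ?thesis by (simp only: mmap_coset[OF h f] MT.smult_mtensor)
qed

lemma Z_rep_act1:
  assumes "h \<in> carrier prod_grp" "f \<in> free MT.X"
  shows "single h \<odot>\<^bsub>Z_rep\<^esub> coset MT.null f = coset MT.null (push (hmap h) f)"
  using Z_rep_act[OF assms, of 1] by simp

definition Z_mod where "Z_mod = underlying prod_grp Z_rep"
definition H_mod :: "('k, 'k) module" where "H_mod = underlying (sym_group (j 1)) (triv_rep (j 1))"
definition rho1 :: "'k \<Rightarrow> 'k \<Rightarrow> 'k" where "rho1 = (\<lambda>v c. c \<odot>\<^bsub>H_mod\<^esub> v)"

lemma Z_mod_carrier: "carrier Z_mod = coset MT.null ` free MT.X"
  unfolding Z_mod_def underlying_def Z_rep_eq linearize_def by (simp add: MT.carrier_mtensor)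

lemma Z_mod_add: "coset MT.null x \<oplus>\<^bsub>Z_mod\<^esub> coset MT.null y = coset MT.null (x + y)"
  unfolding Z_mod_def underlying_def Z_rep_eq linearize_def by (simp add: MT.add_mtensor)

lemma Z_mod_smult:
  assumes f: "f \<in> free MT.X"
  shows "c \<odot>\<^bsub>Z_mod\<^esub> coset MT.null f = coset MT.null (\<lambda>z. c * f z)"
proof -
  have "push (hmap one_P) f = f"
  proof (rule push_id_on[OF f])
    fix x assume x: "x \<in> MT.X"
    show "hmap one_P x = x"
    proof
      fix i
      show "hmap one_P x i = x i"
      proof (cases "i \<in> J")
        case True
        then have "x i \<in> carrier (Z_factor i)" using x by blast
        then obtain v where v: "x i = coset (const_vecs (j i)) v" "v \<in> free {1..j i}"
          by (auto simp: Z_factor_def refl_quot_mod_carrier)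
        have "push id v = v" by (rule push_id_on[OF v(2)]) simp
        then show ?thesis using True v refl_quot_act1[OF Sym_id v(2)] by (simp add: one_P_def)
      next
        case False
        then show ?thesis using x by (auto simp: PiE_iff extensional_def)
      qed
    qed
  qed
  then show ?thesis using Z_rep_act[OF one_P(2) f, of c] by (simp add: Z_mod_def underlying_def one_P)
qed

lemma triv_act: "g \<in> Sym (j 1) \<Longrightarrow> (\<lambda>z. c * single g z) \<odot>\<^bsub>triv_rep (j 1)\<^esub> v = c * (v :: 'k)"
proof -
  assume g: "g \<in> Sym (j 1)"
  have "abelian_monoid (ground_module :: ('k, 'k) module)"
    by (rule abelian_monoidI) (auto simp: ground_module_def algebra_simps)
  then have "(\<lambda>z. c * single g z) \<odot>\<^bsub>triv_rep (j 1)\<^esub> v = c \<odot>\<^bsub>ground_module\<^esub> v"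
    unfolding triv_rep_def
    by (rule linearize_single[OF _ finite_Sym g]) (auto simp: ground_module_def)
  then show ?thesis by (simp add: ground_module_def)
qed

lemma H_mod_simps [simp]: "carrier H_mod = UNIV" "add H_mod = (+)" "c \<odot>\<^bsub>H_mod\<^esub> v = c * v"
  using triv_act[OF Sym_id, of c v]
  by (simp_all add: H_mod_def underlying_def triv_rep_def linearize_def ground_module_def sym_group_one)

lemma rho1_eq: "rho1 v c = c * v"
  by (simp add: rho1_def)

sublocale T: tensor_prod UNIV H_mod rho1 Z_mod
proof
  fix y y' a assume y: "y \<in> carrier Z_mod"
  then show "a \<odot>\<^bsub>Z_mod\<^esub> y \<in> carrier Z_mod" unfolding Z_mod_carrier by (auto simp: Z_mod_smult)
  assume "y' \<in> carrier Z_mod"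
  with y show "y \<oplus>\<^bsub>Z_mod\<^esub> y' \<in> carrier Z_mod"
    unfolding Z_mod_carrier by (auto simp: Z_mod_add simp del: plus_fun_apply)
qed simp_all

abbreviation HZ_tensor where "HZ_tensor \<equiv> tensor UNIV H_mod rho1 Z_mod"

text \<open>
  The representation \<open>H\<^bsub>j 1\<^esub> \<otimes> Z\<^bsub>j 2\<^esub> \<otimes> \<dots> \<otimes> Z\<^bsub>j m\<^esub>\<close> that is induced; \<open>act\<close> is the group action that it
  linearizes.
\<close>

definition HZ_rep where "HZ_rep = rep_tensor (sym_group (j 1)) prod_grp (triv_rep (j 1)) Z_rep"

definition act where "act = (\<lambda>(g, h). tensor_map UNIV H_mod rho1 Z_mod
    (\<lambda>v. single g \<odot>\<^bsub>triv_rep (j 1)\<^esub> v) (\<lambda>w. single h \<odot>\<^bsub>Z_rep\<^esub> w))"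

lemma HZ_rep_eq: "HZ_rep = linearize par_grp HZ_tensor act"
  unfolding HZ_rep_def act_def rep_tensor_def Let_def par_grp_def rho1_def H_mod_def Z_mod_def ..

text \<open>
  The action on pure tensors: the trivial factor \<open>x\<close> stays fixed.
\<close>

abbreviation pmap :: "(nat \<Rightarrow> nat \<Rightarrow> nat) \<Rightarrow> 'k \<times> ((nat \<Rightarrow> (nat \<Rightarrow> 'k) set) \<Rightarrow> 'k) set \<Rightarrow>
    'k \<times> ((nat \<Rightarrow> (nat \<Rightarrow> 'k) set) \<Rightarrow> 'k) set"
  where "pmap h \<equiv> (\<lambda>(x, y). (x, single h \<odot>\<^bsub>Z_rep\<^esub> y))"

lemma Z_rep_act_closed:
  assumes h: "h \<in> carrier prod_grp" and "y \<in> carrier Z_mod"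
  shows "single h \<odot>\<^bsub>Z_rep\<^esub> y \<in> carrier Z_mod"
  using assms(2) unfolding Z_mod_carrier
  by (auto simp: Z_rep_act1[OF h] intro!: imageI push_hmap_free[OF h])

lemma act_coset:
  assumes g: "g \<in> Sym (j 1)" and h: "h \<in> carrier prod_grp" and t: "t \<in> free T.X"
  shows "act (g, h) (coset T.null t) = coset T.null (push (pmap h) t)"
proof -
  have f: "single g \<odot>\<^bsub>triv_rep (j 1)\<^esub> v = v" for v :: 'k
    using triv_act[OF g, of 1 v] by simp
  have "tensor_map UNIV H_mod rho1 Z_mod (\<lambda>v. v) (\<lambda>w. single h \<odot>\<^bsub>Z_rep\<^esub> w) (coset T.null t)
      = coset T.null (push (\<lambda>(x, y). (x, single h \<odot>\<^bsub>Z_rep\<^esub> y)) t)"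
  proof (rule T.tensor_map_coset[OF _ _ _ _ _ _ _ t])
    fix y y' a assume y: "y \<in> carrier Z_mod"
    then show "single h \<odot>\<^bsub>Z_rep\<^esub> y \<in> carrier Z_mod" by (rule Z_rep_act_closed[OF h])
    obtain f where f: "y = coset MT.null f" "f \<in> free MT.X" using y by (auto simp: Z_mod_carrier)
    show "single h \<odot>\<^bsub>Z_rep\<^esub> (a \<odot>\<^bsub>Z_mod\<^esub> y) = a \<odot>\<^bsub>Z_mod\<^esub> (single h \<odot>\<^bsub>Z_rep\<^esub> y)"
      unfolding f(1) Z_mod_smult[OF f(2)] Z_rep_act1[OF h f(2)] Z_rep_act1[OF h scale_in_free[OF f(2)]]
        Z_mod_smult[OF push_hmap_free[OF h f(2)]] push_scale[OF f(2)] ..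
    assume "y' \<in> carrier Z_mod"
    then obtain f' where f': "y' = coset MT.null f'" "f' \<in> free MT.X" by (auto simp: Z_mod_carrier)
    show "single h \<odot>\<^bsub>Z_rep\<^esub> (y \<oplus>\<^bsub>Z_mod\<^esub> y') = single h \<odot>\<^bsub>Z_rep\<^esub> y \<oplus>\<^bsub>Z_mod\<^esub> single h \<odot>\<^bsub>Z_rep\<^esub> y'"
      unfolding f(1) f'(1) Z_mod_add Z_rep_act1[OF h f(2)] Z_rep_act1[OF h f'(2)]
        Z_rep_act1[OF h add_in_free[OF f(2) f'(2)]] push_add[OF f(2) f'(2)] ..
  qed simp_all
  then show ?thesis unfolding act_def prod.case f .
qed

lemma HZ_rep_carrier: "carrier HZ_rep = coset T.null ` free T.X"
  by (simp add: HZ_rep_eq linearize_def T.carrier_tensor)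

lemma HZ_rep_add: "coset T.null x \<oplus>\<^bsub>HZ_rep\<^esub> coset T.null y = coset T.null (x + y)"
  by (simp add: HZ_rep_eq linearize_def T.add_tensor)

lemma HZ_rep_smult: "r \<odot>\<^bsub>HZ_rep\<^esub> t = (\<Oplus>\<^bsub>HZ_tensor\<^esub>gh\<in>carrier par_grp. r gh \<odot>\<^bsub>HZ_tensor\<^esub> act gh t)"
  by (simp only: HZ_rep_eq linearize_def module.simps)

lemma push_pmap_free:
  assumes "h \<in> carrier prod_grp" "t \<in> free T.X"
  shows "push (pmap h) t \<in> free T.X"
  by (rule push_in_free[OF assms(2)]) (use Z_rep_act_closed[OF assms(1)] in auto)

lemma act_closed:
  assumes "gh \<in> carrier par_grp" "t \<in> carrier HZ_rep"
  shows "c \<odot>\<^bsub>HZ_tensor\<^esub> act gh t \<in> carrier HZ_tensor"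
proof -
  obtain g h where gh: "gh = (g, h)" "g \<in> Sym (j 1)" "h \<in> carrier prod_grp" using assms(1) by (cases gh) (auto simp: par_grp_iff)
  obtain f where f: "t = coset T.null f" "f \<in> free T.X"
    using assms(2) unfolding HZ_rep_carrier by blast
  show ?thesis unfolding gh f(1) act_coset[OF gh(2,3) f(2)] T.smult_tensor T.carrier_tensor
    by (intro imageI scale_in_free push_pmap_free gh f)
qed

lemma HZ_rep_act:
  assumes g: "g \<in> Sym (j 1)" and h: "h \<in> carrier prod_grp" and t: "t \<in> free T.X"
  shows "(\<lambda>z. c * single (g, h) z) \<odot>\<^bsub>HZ_rep\<^esub> coset T.null t = coset T.null (\<lambda>z. c * push (pmap h) t z)"
proof -
  have gh: "(g, h) \<in> carrier par_grp" using g h by (simp add: par_grp_iff)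
  have tR: "coset T.null t \<in> carrier HZ_rep" using t by (simp add: HZ_rep_carrier)
  have "(\<lambda>z. c * single (g, h) z) \<odot>\<^bsub>HZ_rep\<^esub> coset T.null t = c \<odot>\<^bsub>HZ_tensor\<^esub> act (g, h) (coset T.null t)"
    unfolding HZ_rep_eq
  proof (rule linearize_single[OF T.tensor_abelian_monoid finite_par_grp gh])
    fix gh' assume "gh' \<in> carrier par_grp"
    then obtain g' h' where gh': "gh' = (g', h')" "g' \<in> Sym (j 1)" "h' \<in> carrier prod_grp"
      by (cases gh') (auto simp: par_grp_iff)
    show "0 \<odot>\<^bsub>HZ_tensor\<^esub> act gh' (coset T.null t) = \<zero>\<^bsub>HZ_tensor\<^esub>"
      unfolding gh'(1) act_coset[OF gh'(2,3) t] T.smult_tensor T.zero_tensor by (rule coset_null_zero)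
  qed (rule act_closed[OF gh tR])
  then show ?thesis unfolding act_coset[OF g h t] T.smult_tensor .
qed

lemma HZ_rep_act1:
  assumes "g \<in> Sym (j 1)" "h \<in> carrier prod_grp" "t \<in> free T.X"
  shows "single (g, h) \<odot>\<^bsub>HZ_rep\<^esub> coset T.null t = coset T.null (push (pmap h) t)"
  using HZ_rep_act[OF assms, of 1] by simp

lemma HZ_rep_scale:
  assumes t: "t \<in> free T.X"
  shows "(\<lambda>z. c * single (id, one_P) z) \<odot>\<^bsub>HZ_rep\<^esub> coset T.null t = coset T.null (\<lambda>z. c * t z)"
proof -
  have "push (pmap one_P) t = t"
  proof (rule push_id_on[OF t])
    fix xy assume "xy \<in> T.X"
    then obtain x f where xy: "xy = (x, coset MT.null f)" "f \<in> free MT.X"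
      by (auto simp: Z_mod_carrier)
    have "single one_P \<odot>\<^bsub>Z_rep\<^esub> coset MT.null f = 1 \<odot>\<^bsub>Z_mod\<^esub> coset MT.null f"
      by (simp add: Z_mod_def underlying_def one_P)
    then show "pmap one_P xy = xy" using Z_mod_smult[OF xy(2), of 1] xy(1) by simp
  qed
  then show ?thesis using HZ_rep_act[OF Sym_id one_P(2) t, of c] by simp
qed

definition par_alg :: "((nat \<Rightarrow> nat) \<times> (nat \<Rightarrow> nat \<Rightarrow> nat) \<Rightarrow> 'k) set"
  where "par_alg = carrier (group_alg par_grp)"
definition GA_mod :: "('k, (nat \<Rightarrow> nat) \<Rightarrow> 'k) module"
  where "GA_mod = underlying (sym_group n) (group_alg (sym_group n))"
definition rho2 :: "((nat \<Rightarrow> nat) \<Rightarrow> 'k) \<Rightarrow> ((nat \<Rightarrow> nat) \<times> (nat \<Rightarrow> nat \<Rightarrow> nat) \<Rightarrow> 'k) \<Rightarrow> (nat \<Rightarrow> nat) \<Rightarrow> 'k"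
  where "rho2 = (\<lambda>q r. q \<otimes>\<^bsub>group_alg (sym_group n)\<^esub> push phi r)"

lemma GA_mod_simps [simp]: "carrier GA_mod = free (Sym n)" "add GA_mod = (+)"
  "smult GA_mod = (\<lambda>c q. conv n (\<lambda>x. c * single id x) q)"
  by (simp_all add: GA_mod_def underlying_def group_alg_smult sym_group_one)

lemma rho2_eq: "rho2 q r = conv n q (push phi r)"
  by (simp add: rho2_def group_alg_mult)

sublocale ID: tensor_prod par_alg GA_mod rho2 HZ_rep
proof
  fix t t' r assume t: "t \<in> carrier HZ_rep"
  then obtain f where f: "t = coset T.null f" "f \<in> free T.X"
    unfolding HZ_rep_carrier by blast
  show "r \<odot>\<^bsub>HZ_rep\<^esub> t \<in> carrier HZ_rep"
    unfolding HZ_rep_smult using finsum_in_carrier[OF T.tensor_abelian_monoid act_closed[OF _ t]]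
    by (simp only: HZ_rep_carrier T.carrier_tensor)
  assume "t' \<in> carrier HZ_rep"
  then obtain f' where f': "t' = coset T.null f'" "f' \<in> free T.X"
    unfolding HZ_rep_carrier by blast
  show "t \<oplus>\<^bsub>HZ_rep\<^esub> t' \<in> carrier HZ_rep"
    unfolding f(1) f'(1) HZ_rep_add HZ_rep_carrier by (intro imageI add_in_free f f')
qed (simp_all add: rho2_eq del: plus_fun_apply)

end

context ind_blocks
begin

section \<open>The cyclic generator\<close>

lemma MT_pure_Z_mod: "z \<in> MT.X \<Longrightarrow> MT.pure z \<in> carrier Z_mod"
  unfolding MT.pure_def Z_mod_carrier by (intro imageI single_in_free)

lemma T_pure_HZ_rep: "y \<in> carrier Z_mod \<Longrightarrow> T.pure x y \<in> carrier HZ_rep"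
  unfolding T.pure_def HZ_rep_carrier by (intro imageI single_in_free) simp

definition one_tensor :: "(nat \<Rightarrow> (nat \<Rightarrow> 'k) set) \<Rightarrow> ('k \<times> ((nat \<Rightarrow> (nat \<Rightarrow> 'k) set) \<Rightarrow> 'k) set \<Rightarrow> 'k) set"
  where "one_tensor z = T.pure 1 (MT.pure z)"

abbreviation basis :: "(nat \<Rightarrow> nat) \<Rightarrow> nat \<Rightarrow> (nat \<Rightarrow> 'k) set"
  where "basis a \<equiv> (\<lambda>k\<in>J. coset (const_vecs (j k)) (single (a k)))"

text \<open>
  The vector \<open>1 \<otimes> e\<^sub>1 \<otimes> \<dots> \<otimes> e\<^sub>1\<close>; the induced representation is generated by \<open>1 \<otimes> gen\<close>.
\<close>

definition gen where "gen = one_tensor (basis (\<lambda>_. 1))"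

lemma basis_X: "(\<And>k. k \<in> J \<Longrightarrow> a k \<in> {1..j k}) \<Longrightarrow> basis a \<in> MT.X"
  by (auto simp: PiE_iff Z_factor_def refl_quot_mod_carrier simp del: One_nat_def intro!: imageI single_in_free)

lemma basis1_X: "basis (\<lambda>_. 1) \<in> MT.X"
  using j2 by (intro basis_X) force

lemma one_tensor_HZ_rep: "z \<in> MT.X \<Longrightarrow> one_tensor z \<in> carrier HZ_rep"
  unfolding one_tensor_def by (intro T_pure_HZ_rep MT_pure_Z_mod)

lemma gen_HZ_rep: "gen \<in> carrier HZ_rep"
  unfolding gen_def by (rule one_tensor_HZ_rep[OF basis1_X])

lemma one_tensor_add:
  assumes "z \<in> MT.X" "k \<in> J" "u \<in> carrier (Z_factor k)" "v \<in> carrier (Z_factor k)"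
  shows "one_tensor (z(k := u \<oplus>\<^bsub>Z_factor k\<^esub> v)) = one_tensor (z(k := u)) \<oplus>\<^bsub>HZ_rep\<^esub> one_tensor (z(k := v))"
proof -
  have "MT.pure (z(k := u \<oplus>\<^bsub>Z_factor k\<^esub> v)) = MT.pure (z(k := u)) \<oplus>\<^bsub>Z_mod\<^esub> MT.pure (z(k := v))"
    unfolding MT.pure_add[OF assms] unfolding MT.pure_def Z_mod_add ..
  then have "one_tensor (z(k := u \<oplus>\<^bsub>Z_factor k\<^esub> v)) = coset T.null (single (1, MT.pure (z(k := u))) + single (1, MT.pure (z(k := v))))"
    unfolding one_tensor_def using T.pure_add_right[OF _ MT_pure_Z_mod[OF MT.upd_X] MT_pure_Z_mod[OF MT.upd_X]] assms by simp
  then show ?thesis unfolding one_tensor_def T.pure_def HZ_rep_add .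
qed

text \<open>
  The multiple \<open>c \<cdot> 1\<close> of the unity of the group algebra; its action is the scalar multiplication by \<open>c\<close>.
\<close>

abbreviation scal :: "'k \<Rightarrow> (nat \<Rightarrow> nat) \<times> (nat \<Rightarrow> nat \<Rightarrow> nat) \<Rightarrow> 'k"
  where "scal c \<equiv> (\<lambda>x. c * single (id, one_P) x)"

lemma T_pure_scalar:
  assumes "y \<in> carrier Z_mod"
  shows "T.pure c y = scal c \<odot>\<^bsub>HZ_rep\<^esub> T.pure 1 y"
proof -
  have "(1, y) \<in> T.X" using assms by simp
  then have "scal c \<odot>\<^bsub>HZ_rep\<^esub> T.pure 1 y = coset T.null (\<lambda>z. c * single (1, y) z)"
    unfolding T.pure_def by (intro HZ_rep_scale single_in_free)
  also have "\<dots> = T.pure (c \<odot>\<^bsub>H_mod\<^esub> 1) y" by (rule T.pure_scale[symmetric]) (use assms in simp_all)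
  finally show ?thesis by simp
qed

lemma one_tensor_scale:
  assumes "z \<in> MT.X" "k \<in> J" "u \<in> carrier (Z_factor k)"
  shows "one_tensor (z(k := c \<odot>\<^bsub>Z_factor k\<^esub> u)) = scal c \<odot>\<^bsub>HZ_rep\<^esub> one_tensor (z(k := u))"
proof -
  have zu: "z(k := u) \<in> MT.X" by (rule MT.upd_X[OF assms])
  have "MT.pure (z(k := c \<odot>\<^bsub>Z_factor k\<^esub> u)) = c \<odot>\<^bsub>Z_mod\<^esub> MT.pure (z(k := u))"
    unfolding MT.pure_scale[OF assms] unfolding MT.pure_def by (rule Z_mod_smult[OF single_in_free[OF zu], symmetric])
  then have "one_tensor (z(k := c \<odot>\<^bsub>Z_factor k\<^esub> u)) = T.pure 1 (c \<odot>\<^bsub>Z_mod\<^esub> MT.pure (z(k := u)))" by (simp only: one_tensor_def)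
  also have "\<dots> = T.pure (rho1 1 c) (MT.pure (z(k := u)))"
    by (rule T.pure_bal[symmetric]) (use MT_pure_Z_mod[OF zu] in simp_all)
  also have "\<dots> = scal c \<odot>\<^bsub>HZ_rep\<^esub> one_tensor (z(k := u))"
    unfolding one_tensor_def using T_pure_scalar[OF MT_pure_Z_mod[OF zu], of c] by (simp only: rho1_eq mult_1_right)
  finally show ?thesis .
qed

lemma one_tensor_act:
  assumes g: "g \<in> Sym (j 1)" and h: "h \<in> carrier prod_grp" and z: "z \<in> MT.X"
  shows "single (g, h) \<odot>\<^bsub>HZ_rep\<^esub> one_tensor z = one_tensor (hmap h z)"
proof -
  have "(1, MT.pure z) \<in> T.X" using MT_pure_Z_mod[OF z] by simp
  then have "single (g, h) \<odot>\<^bsub>HZ_rep\<^esub> one_tensor z = coset T.null (push (pmap h) (single (1, MT.pure z)))"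
    unfolding one_tensor_def T.pure_def by (intro HZ_rep_act1 single_in_free g h)
  also have "\<dots> = T.pure 1 (single h \<odot>\<^bsub>Z_rep\<^esub> MT.pure z)" unfolding push_single prod.case T.pure_def ..
  also have "single h \<odot>\<^bsub>Z_rep\<^esub> MT.pure z = MT.pure (hmap h z)"
    unfolding MT.pure_def Z_rep_act1[OF h single_in_free[OF z]] push_single ..
  finally show ?thesis by (simp only: one_tensor_def)
qed

lemma hmap_basis:
  assumes h: "h \<in> carrier prod_grp" and a: "\<And>k. k \<in> J \<Longrightarrow> a k \<in> {1..j k}"
  shows "hmap h (basis a) = basis (\<lambda>k. h k (a k))"
proof (rule restrict_ext)
  fix k assume k: "k \<in> J"
  then have "h k \<in> Sym (j k)" using h by (simp add: prod_grp_iff)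
  from refl_quot_act1[OF this single_in_free[OF a[OF k]]]
  show "single (h k) \<odot>\<^bsub>refl_quot_rep (j k)\<^esub> basis a k = coset (const_vecs (j k)) (single (h k (a k)))"
    using k by simp
qed

abbreviation alg :: "((nat \<Rightarrow> nat) \<Rightarrow> 'k) set"
  where "alg \<equiv> free (Sym n)"

lemma single_par_alg: "gh \<in> carrier par_grp \<Longrightarrow> single gh \<in> par_alg"
  by (simp add: par_alg_def)

lemma scal_par_alg: "scal c \<in> par_alg"
  using one_par_grp(2) by (simp add: par_alg_def)

lemma ID_act:
  assumes "q \<in> alg" "gh \<in> carrier par_grp" "t \<in> carrier HZ_rep"
  shows "ID.pure q (single gh \<odot>\<^bsub>HZ_rep\<^esub> t) = ID.pure (conv n q (single (phi gh))) t"
  using ID.pure_bal[OF _ single_par_alg[OF assms(2)] assms(3), of q] assms(1)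
  by (simp add: rho2_eq)

lemma ID_scale:
  assumes "q \<in> alg" "t \<in> carrier HZ_rep"
  shows "ID.pure q (scal c \<odot>\<^bsub>HZ_rep\<^esub> t) = ID.pure (\<lambda>x. c * q x) t"
proof -
  have "push phi (scal c) = (\<lambda>x. c * single id x)"
    using push_scale[of "single (id, one_P)" UNIV phi c] by (simp add: phi_one)
  moreover have "conv n q (single id) = q"
  proof
    fix x
    show "conv n q (single id) x = q x"
      using assms(1) conv_in_alg[of n q "single id"] conv_single_right[OF Sym_id, of x n q]
      by (cases "x \<in> Sym n") (simp_all add: mem_alg)
  qed
  ultimately have "rho2 q (scal c) = (\<lambda>x. c * q x)" by (simp add: rho2_eq conv_scale_right)
  then show ?thesis using ID.pure_bal[OF _ scal_par_alg assms(2), of q c] assms(1) by simp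
qed

lemma pure_gen_add:
  "p \<in> alg \<Longrightarrow> p' \<in> alg \<Longrightarrow> ID.pure (p + p') gen = coset ID.null (single (p, gen) + single (p', gen))"
  using ID.pure_add_left[of p p' gen] gen_HZ_rep by simp

text \<open>
  All \<open>q \<otimes> t\<close> lie in the submodule generated by \<open>1 \<otimes> gen\<close>.  This property of \<open>t\<close> passes to sums, multiples
  and translates.
\<close>

definition generated where "generated t \<longleftrightarrow> (\<forall>q\<in>alg. \<exists>p\<in>alg. ID.pure q t = ID.pure p gen)"

lemma generated_add:
  assumes "t \<in> carrier HZ_rep" "t' \<in> carrier HZ_rep" "generated t" "generated t'"
  shows "generated (t \<oplus>\<^bsub>HZ_rep\<^esub> t')"
  unfolding generated_def
proof
  fix q assume q: "q \<in> alg"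
  then obtain p p' where p: "p \<in> alg" "p' \<in> alg" "ID.pure q t = ID.pure p gen" "ID.pure q t' = ID.pure p' gen"
    using assms(3,4) unfolding generated_def by blast
  have "ID.pure q (t \<oplus>\<^bsub>HZ_rep\<^esub> t') = coset ID.null (single (q, t) + single (q, t'))"
    by (rule ID.pure_add_right) (use q assms in simp_all)
  also have "\<dots> = coset ID.null (single (p, gen) + single (p', gen))"
    by (rule coset_cong_add[OF ID.null_subgp]) (use p(3,4) in \<open>simp_all only: ID.pure_def\<close>)
  also have "\<dots> = ID.pure (p + p') gen" by (rule pure_gen_add[symmetric, OF p(1,2)])
  finally show "\<exists>p\<in>alg. ID.pure q (t \<oplus>\<^bsub>HZ_rep\<^esub> t') = ID.pure p gen" using add_in_free[OF p(1,2)] by blast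
qed

lemma generated_scale:
  assumes "t \<in> carrier HZ_rep" "generated t"
  shows "generated (scal c \<odot>\<^bsub>HZ_rep\<^esub> t)"
  unfolding generated_def
proof
  fix q assume q: "q \<in> alg"
  then have "(\<lambda>x. c * q x) \<in> alg" by simp
  then show "\<exists>p\<in>alg. ID.pure q (scal c \<odot>\<^bsub>HZ_rep\<^esub> t) = ID.pure p gen"
    using ID_scale[OF q assms(1), of c] assms(2) unfolding generated_def by simp
qed

lemma generated_act:
  assumes "gh \<in> carrier par_grp" "t \<in> carrier HZ_rep" "generated t"
  shows "generated (single gh \<odot>\<^bsub>HZ_rep\<^esub> t)"
  unfolding generated_def
proof
  fix q assume q: "q \<in> alg"
  then show "\<exists>p\<in>alg. ID.pure q (single gh \<odot>\<^bsub>HZ_rep\<^esub> t) = ID.pure p gen"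
    unfolding ID_act[OF q assms(1,2)] using assms(3) conv_in_alg unfolding generated_def by blast
qed

lemma generated_gen: "generated gen"
  unfolding generated_def by blast

lemma HZ_rep_zero: "T.null \<in> carrier HZ_rep" "T.null \<oplus>\<^bsub>HZ_rep\<^esub> T.null = T.null"
proof -
  have "coset T.null 0 \<in> carrier HZ_rep" unfolding HZ_rep_carrier by (intro imageI zero_in_free)
  then show "T.null \<in> carrier HZ_rep" by simp
  show "T.null \<oplus>\<^bsub>HZ_rep\<^esub> T.null = T.null" using HZ_rep_add[of 0 0] by simp
qed

lemma pure_zero_gen: "ID.pure 0 gen = ID.null"
  by (rule ID.pure_zero_left) (use gen_HZ_rep in simp_all)

lemma generated_zero: "generated T.null"
  unfolding generated_def
proof
  fix q assume "q \<in> alg"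
  then have "ID.pure q T.null = ID.pure 0 gen"
    unfolding pure_zero_gen by (intro ID.pure_zero_right HZ_rep_zero) simp
  then show "\<exists>p\<in>alg. ID.pure q T.null = ID.pure p gen" using zero_in_free by blast
qed

text \<open>
  Transpositions in the factors of the parabolic subgroup take \<open>e\<^sub>1\<close> to the other basis vectors.
\<close>

lemma generated_one_tensor_basis:
  assumes a: "\<And>k. k \<in> J \<Longrightarrow> a k \<in> {1..j k}"
  shows "generated (one_tensor (basis a))"
proof -
  define h where "h = (\<lambda>k\<in>J. transpose 1 (a k))"
  have h: "h \<in> carrier prod_grp" unfolding prod_grp_iff h_def
    using a by (force intro!: Sym_transpose)
  have "hmap h (basis (\<lambda>_. 1)) = basis (\<lambda>k. h k 1)" by (rule hmap_basis[OF h]) (use a in force)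
  also have "\<dots> = basis a" by (rule restrict_ext) (simp add: h_def)
  finally have eq: "single (id, h) \<odot>\<^bsub>HZ_rep\<^esub> gen = one_tensor (basis a)"
    unfolding gen_def one_tensor_act[OF Sym_id h basis1_X] by (simp only:)
  have "(id, h) \<in> carrier par_grp" using h by (simp add: par_grp_iff)
  from generated_act[OF this gen_HZ_rep generated_gen] show ?thesis unfolding eq .
qed

text \<open>
  Multilinear expansion: the components of \<open>z\<close> at the positions in \<open>K\<close> are arbitrary and all others are
  classes of basis vectors; \<open>K\<close> grows from the empty set to the full index set.
\<close>

lemma generated_one_tensor:
  assumes z: "z \<in> MT.X"
  shows "generated (one_tensor z)"
proof -
  have "generated (one_tensor z)"
    if "finite K" "K \<subseteq> J" "z \<in> MT.X"
      "\<forall>k\<in>J - K. \<exists>a\<in>{1..j k}. z k = coset (const_vecs (j k)) (single a)" for K z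
    using that
  proof (induction K arbitrary: z rule: finite_induct)
    case empty
    then have "\<forall>k\<in>J. \<exists>a. a \<in> {1..j k} \<and> z k = coset (const_vecs (j k)) (single a)" by blast
    from bchoice[OF this] obtain a
      where a: "\<forall>k\<in>J. a k \<in> {1..j k} \<and> z k = coset (const_vecs (j k)) (single (a k))" ..
    have "z = basis a"
    proof (rule extensionalityI)
      show "z \<in> extensional J" using empty.prems(2) by (simp only: PiE_iff)
      fix k assume "k \<in> J"
      then show "z k = basis a k" using a by (simp only: restrict_apply if_True)
    qed (rule restrict_extensional)
    then show "generated (one_tensor z)" using generated_one_tensor_basis[of a] a by blast
  next
    case (insert k K)
    have k: "k \<in> J" using insert.prems by blast
    note zX = insert.prems(2)
    have "z k \<in> carrier (Z_factor k)" using zX k by blast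
    then obtain v where v: "z k = coset (const_vecs (j k)) v" "v \<in> free {1..j k}"
      unfolding Z_factor_def refl_quot_mod_carrier by blast
    have Z: "coset (const_vecs (j k)) u \<in> carrier (Z_factor k)" if "u \<in> free {1..j k}" for u
      unfolding Z_factor_def refl_quot_mod_carrier by (rule imageI[OF that])
    have gbasis: "generated (one_tensor (z(k := coset (const_vecs (j k)) (single a))))" if a: "a \<in> {1..j k}" for a
    proof (rule insert.IH)
      show "K \<subseteq> J" using insert.prems by blast
      show "z(k := coset (const_vecs (j k)) (single a)) \<in> MT.X"
        by (rule MT.upd_X[OF zX k Z[OF single_in_free[OF a]]])
      show "\<forall>l\<in>J - K. \<exists>b\<in>{1..j l}. (z(k := coset (const_vecs (j k)) (single a))) l = coset (const_vecs (j l)) (single b)"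
      proof
        fix l assume l: "l \<in> J - K"
        show "\<exists>b\<in>{1..j l}. (z(k := coset (const_vecs (j k)) (single a))) l = coset (const_vecs (j l)) (single b)"
        proof (cases "l = k")
          case True
          then show ?thesis using a by (intro bexI[of _ a]) (simp_all only: fun_upd_same)
        next
          case False
          then have "l \<in> J - insert k K" using l by blast
          from bspec[OF insert.prems(3) this] show ?thesis unfolding fun_upd_other[OF False] .
        qed
      qed
    qed
    have "generated (one_tensor (z(k := coset (const_vecs (j k)) v)))"
      using v(2)
    proof (induction rule: free_induct)
      case zero
      have 1: "1 \<in> {1..j k}" using j2[OF k] by simp
      have "0 \<odot>\<^bsub>Z_factor k\<^esub> coset (const_vecs (j k)) (single 1) = coset (const_vecs (j k)) 0"
        unfolding Z_factor_def refl_quot_mod_smult[OF single_in_free[OF 1]] by (simp only: mult_zero_left zero_fun_def)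
      then have "one_tensor (z(k := coset (const_vecs (j k)) 0)) = scal 0 \<odot>\<^bsub>HZ_rep\<^esub> one_tensor (z(k := coset (const_vecs (j k)) (single 1)))"
        using one_tensor_scale[OF zX k Z[OF single_in_free[OF 1]], of 0] by (simp only:)
      then show "generated (one_tensor (z(k := coset (const_vecs (j k)) 0)))"
        using generated_scale[OF one_tensor_HZ_rep[OF MT.upd_X[OF zX k Z[OF single_in_free[OF 1]]]] gbasis[OF 1], of 0]
        by (simp only:)
    next
      case (step f a c)
      note f = step(1) and a = step(2)
      have sa: "single a \<in> free {1..j k}" using a by (rule single_in_free)
      have "coset (const_vecs (j k)) (f + (\<lambda>y. c * single a y))
          = coset (const_vecs (j k)) f \<oplus>\<^bsub>Z_factor k\<^esub> (c \<odot>\<^bsub>Z_factor k\<^esub> coset (const_vecs (j k)) (single a))"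
        unfolding Z_factor_def refl_quot_mod_smult[OF sa] refl_quot_mod_add ..
      then have "one_tensor (z(k := coset (const_vecs (j k)) (f + (\<lambda>y. c * single a y)))) =
          one_tensor (z(k := coset (const_vecs (j k)) f)) \<oplus>\<^bsub>HZ_rep\<^esub> (scal c \<odot>\<^bsub>HZ_rep\<^esub> one_tensor (z(k := coset (const_vecs (j k)) (single a))))"
        by (simp only: one_tensor_add[OF zX k Z[OF f] MT.M_smult[OF k Z[OF sa]]] one_tensor_scale[OF zX k Z[OF sa]])
      moreover have "generated (one_tensor (z(k := coset (const_vecs (j k)) f)))" by (rule step(3))
      moreover have "one_tensor (z(k := coset (const_vecs (j k)) f)) \<in> carrier HZ_rep"
        "one_tensor (z(k := coset (const_vecs (j k)) (single a))) \<in> carrier HZ_rep"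
        by (rule one_tensor_HZ_rep[OF MT.upd_X[OF zX k Z[OF f]]], rule one_tensor_HZ_rep[OF MT.upd_X[OF zX k Z[OF sa]]])
      ultimately show "generated (one_tensor (z(k := coset (const_vecs (j k)) (f + (\<lambda>y. c * single a y)))))"
        using gbasis[OF a] by (simp only: generated_add generated_scale ID.N_smult[OF scal_par_alg])
    qed
    then show "generated (one_tensor z)" unfolding v(1)[symmetric] fun_upd_triv .
  qed
  from this[OF finite_atLeastAtMost subset_refl z] show ?thesis by (simp only: Diff_cancel ball_empty)
qed

lemma generated_br1:
  assumes "y \<in> carrier Z_mod"
  shows "generated (T.pure 1 y)"
proof -
  obtain f where f: "y = coset MT.null f" "f \<in> free MT.X" using assms by (auto simp: Z_mod_carrier)
  have N1z: "MT.null \<in> carrier Z_mod" "MT.null \<oplus>\<^bsub>Z_mod\<^esub> MT.null = MT.null"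
  proof -
    have "coset MT.null 0 \<in> carrier Z_mod" unfolding Z_mod_carrier by (intro imageI zero_in_free)
    then show "MT.null \<in> carrier Z_mod" by simp
    show "MT.null \<oplus>\<^bsub>Z_mod\<^esub> MT.null = MT.null" using Z_mod_add[of 0 0] by simp
  qed
  have "generated (T.pure 1 (coset MT.null f))" using f(2)
  proof (induction rule: free_induct)
    case zero
    have "T.pure 1 MT.null = T.null" by (rule T.pure_zero_right[OF N1z]) simp
    then show "generated (T.pure 1 (coset MT.null 0))" using generated_zero by simp
  next
    case (step f z c)
    note f = step(1) and z = step(2)
    have fN: "coset MT.null f \<in> carrier Z_mod" using f by (simp add: Z_mod_carrier)
    have zN: "MT.pure z \<in> carrier Z_mod" by (rule MT_pure_Z_mod[OF z])
    have czN: "c \<odot>\<^bsub>Z_mod\<^esub> MT.pure z \<in> carrier Z_mod" using T.N_smult[OF _ zN] by simp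
    have "coset MT.null (f + (\<lambda>y. c * single z y)) = coset MT.null f \<oplus>\<^bsub>Z_mod\<^esub> (c \<odot>\<^bsub>Z_mod\<^esub> MT.pure z)"
      unfolding MT.pure_def Z_mod_smult[OF single_in_free[OF z]] Z_mod_add ..
    then have "T.pure 1 (coset MT.null (f + (\<lambda>y. c * single z y))) =
        T.pure 1 (coset MT.null f) \<oplus>\<^bsub>HZ_rep\<^esub> T.pure 1 (c \<odot>\<^bsub>Z_mod\<^esub> MT.pure z)"
      using T.pure_add_right[OF _ fN czN, of 1] unfolding T.pure_def HZ_rep_add by simp
    also have "T.pure 1 (c \<odot>\<^bsub>Z_mod\<^esub> MT.pure z) = scal c \<odot>\<^bsub>HZ_rep\<^esub> one_tensor z"
      using T.pure_bal[OF _ _ zN, of 1 c] T_pure_scalar[OF zN, of c] by (simp add: rho1_eq one_tensor_def)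
    finally have eq: "T.pure 1 (coset MT.null (f + (\<lambda>y. c * single z y))) =
        T.pure 1 (coset MT.null f) \<oplus>\<^bsub>HZ_rep\<^esub> (scal c \<odot>\<^bsub>HZ_rep\<^esub> one_tensor z)" .
    have "generated (T.pure 1 (coset MT.null f))" by (rule step(3))
    then show "generated (T.pure 1 (coset MT.null (f + (\<lambda>y. c * single z y))))"
      unfolding eq by (intro generated_add generated_scale T_pure_HZ_rep fN ID.N_smult scal_par_alg one_tensor_HZ_rep z generated_one_tensor)
  qed
  then show ?thesis by (simp only: f(1))
qed

lemma generated_HZ_rep:
  assumes "t \<in> carrier HZ_rep"
  shows "generated t"
proof -
  have "t \<in> coset T.null ` free T.X" using assms by (simp only: HZ_rep_carrier)
  then obtain f where f: "t = coset T.null f" "f \<in> free T.X" by (rule imageE)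
  have "generated (coset T.null f)" using f(2)
  proof (induction rule: free_induct)
    case zero
    show "generated (coset T.null 0)" using generated_zero by simp
  next
    case (step f xy c)
    obtain x y where xy1: "xy = (x, y)" by (cases xy)
    have xy2: "y \<in> carrier Z_mod" using step(2) unfolding xy1 by simp
    note xy = xy1 xy2
    have fR: "coset T.null f \<in> carrier HZ_rep" using step(1) by (simp add: HZ_rep_carrier)
    have yR: "T.pure 1 y \<in> carrier HZ_rep" "T.pure x y \<in> carrier HZ_rep" by (rule T_pure_HZ_rep[OF xy(2)])+
    have gx: "generated (T.pure x y)"
      unfolding T_pure_scalar[OF xy(2), of x] by (rule generated_scale[OF yR(1) generated_br1[OF xy(2)]])
    have "coset T.null (f + (\<lambda>z. c * single xy z)) = coset T.null f \<oplus>\<^bsub>HZ_rep\<^esub> (scal c \<odot>\<^bsub>HZ_rep\<^esub> T.pure x y)"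
      unfolding T.pure_def HZ_rep_scale[OF single_in_free[OF step(2)[unfolded xy(1)]]] HZ_rep_add xy(1) ..
    moreover have "generated (coset T.null f)" by (rule step(3))
    ultimately show "generated (coset T.null (f + (\<lambda>z. c * single xy z)))"
      by (simp only:) (intro generated_add generated_scale fR ID.N_smult scal_par_alg yR gx)
  qed
  then show ?thesis by (simp only: f(1))
qed

lemma ID_cyclic:
  assumes f: "f \<in> free ID.X"
  shows "\<exists>p\<in>alg. coset ID.null f = ID.pure p gen"
  using f
proof (induction rule: free_induct)
  case zero
  show "\<exists>p\<in>alg. coset ID.null 0 = ID.pure p gen" using pure_zero_gen by (intro bexI[of _ 0]) simp_all
next
  case (step f qt c)
  obtain q t where qt1: "qt = (q, t)" by (cases qt)
  have "q \<in> alg" "t \<in> carrier HZ_rep" using step(2) unfolding qt1 by simp_all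
  note qt = qt1 this
  have "\<exists>p\<in>alg. coset ID.null f = ID.pure p gen" by (rule step(3))
  then obtain p where p: "p \<in> alg" "coset ID.null f = ID.pure p gen" by blast
  have cq: "c \<odot>\<^bsub>GA_mod\<^esub> q \<in> alg" by simp
  then obtain p' where p': "p' \<in> alg" "ID.pure (c \<odot>\<^bsub>GA_mod\<^esub> q) t = ID.pure p' gen"
    using generated_HZ_rep[OF qt(3)] unfolding generated_def by blast
  have "coset ID.null (\<lambda>z. c * single qt z) = ID.pure (c \<odot>\<^bsub>GA_mod\<^esub> q) t"
    unfolding qt(1) by (rule ID.pure_scale[symmetric]) (use qt in simp_all)
  then have "coset ID.null (f + (\<lambda>z. c * single qt z)) = coset ID.null (single (p, gen) + single (p', gen))"
    by (intro coset_cong_add[OF ID.null_subgp]) (use p(2) p'(2) in \<open>simp_all only: ID.pure_def\<close>)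
  also have "\<dots> = ID.pure (p + p') gen" by (rule pure_gen_add[symmetric, OF p(1) p'(1)])
  finally show "\<exists>p\<in>alg. coset ID.null (f + (\<lambda>z. c * single qt z)) = ID.pure p gen"
    using add_in_free[OF p(1) p'(1)] by blast
qed

end

context ind_blocks
begin

section \<open>Relations satisfied by the cyclic generator\<close>

lemma par_transpose:
  assumes k: "k \<in> {1..m}" and a: "a \<in> {1..j k}" and b: "b \<in> {1..j k}"
  shows "parabolic m j (\<lambda>l. if l = k then transpose a b else id) = transpose (off k + a) (off k + b)"
proof
  fix x
  have ab: "off k + a \<in> block j k" "off k + b \<in> block j k" using a b by (auto simp: block_def)
  show "parabolic m j (\<lambda>l. if l = k then transpose a b else id) x = transpose (off k + a) (off k + b) x"
  proof (cases "\<exists>l\<in>{1..m}. x \<in> block j l")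
    case True
    then obtain l where l: "l \<in> {1..m}" "x \<in> block j l" by blast
    show ?thesis
    proof (cases "l = k")
      case True
      then have "off k < x" using l(2) by (simp add: block_shift)
      then have "x - off k = a \<longleftrightarrow> x = off k + a" "x - off k = b \<longleftrightarrow> x = off k + b" by auto
      then show ?thesis unfolding par_block[OF l] using True \<open>off k < x\<close> by (simp add: transpose_def)
    next
      case False
      then have "x \<noteq> off k + a" "x \<noteq> off k + b" using ab block_disjoint[OF l(1) k l(2)] by auto
      then show ?thesis unfolding par_block[OF l] using False l(2)
        by (simp add: transpose_def block_shift)
    qed
  next
    case False
    then have "x \<noteq> off k + a" "x \<noteq> off k + b" using ab k by auto
    moreover have "parabolic m j (\<lambda>l. if l = k then transpose a b else id) x = x"
      using False by (intro par_out) blast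
    ultimately show ?thesis by (simp add: transpose_def)
  qed
qed

text \<open>
  The permutation \<open>\<pi>\<close> placed in the factor \<open>k\<close>; the first factor is stored separately.
\<close>

definition blk :: "nat \<Rightarrow> (nat \<Rightarrow> nat) \<Rightarrow> (nat \<Rightarrow> nat) \<times> (nat \<Rightarrow> nat \<Rightarrow> nat)"
  where "blk k \<pi> = (if k = 1 then (\<pi>, one_P) else (id, one_P(k := \<pi>)))"

lemma blk_par_grp:
  assumes "k \<in> {1..m}" "\<pi> \<in> Sym (j k)"
  shows "blk k \<pi> \<in> carrier par_grp"
  using assms by (auto simp: blk_def par_grp_iff prod_grp_iff one_P_def extensional_def)

lemma phi_blk:
  assumes "k \<in> {1..m}"
  shows "phi (blk k \<pi>) = parabolic m j (\<lambda>l. if l = k then \<pi> else id)"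
  unfolding phi_def blk_def using assms by (auto simp: one_P_def intro!: par_cong)

lemma blk_gen:
  assumes k: "k \<in> {1..m}" and p: "\<pi> \<in> Sym (j k)"
  shows "single (blk k \<pi>) \<odot>\<^bsub>HZ_rep\<^esub> gen = one_tensor (basis (\<lambda>l. if l = k then \<pi> 1 else 1))"
proof -
  obtain g h where gh: "blk k \<pi> = (g, h)" by (cases "blk k \<pi>")
  have "(g, h) \<in> carrier par_grp" using blk_par_grp[OF assms] gh by simp
  then have g: "g \<in> Sym (j 1)" and h: "h \<in> carrier prod_grp" by (simp_all add: par_grp_iff)
  have "hmap h (basis (\<lambda>_. 1)) = basis (\<lambda>l. h l 1)" by (rule hmap_basis[OF h]) (use j2 in force)
  also have "\<dots> = basis (\<lambda>l. if l = k then \<pi> 1 else 1)"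
  proof (rule restrict_ext)
    fix l assume l: "l \<in> J"
    then have "h l 1 = (if l = k then \<pi> 1 else 1)" using gh
      by (cases "k = 1") (auto simp: blk_def one_P_def)
    then show "coset (const_vecs (j l)) (single (h l 1)) = coset (const_vecs (j l)) (single (if l = k then \<pi> 1 else 1))"
      by (simp only:)
  qed
  finally show ?thesis unfolding gh gen_def one_tensor_act[OF g h basis1_X] by (simp only:)
qed

lemma pure_gen_eq_iff:
  assumes p: "p \<in> alg" and p': "p' \<in> alg"
  shows "ID.pure p gen = ID.pure p' gen \<longleftrightarrow> ID.pure (p - p') gen = ID.null"
proof -
  note eq = coset_eq_iff[OF ID.null_subgp]
  have "ID.pure p gen = coset ID.null (single (p - p', gen) + single (p', gen))"
    using pure_gen_add[OF diff_in_free[OF p p'] p'] by simp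
  then have "ID.pure p gen = ID.pure p' gen \<longleftrightarrow> single (p - p', gen) \<in> ID.null"
    unfolding ID.pure_def[of p' gen] by (simp add: eq)
  also have "\<dots> \<longleftrightarrow> ID.pure (p - p') gen = ID.null"
    unfolding ID.pure_def using eq[of "single (p - p', gen)" 0] by simp
  finally show ?thesis .
qed

text \<open>
  If neither \<open>l\<close> nor \<open>l + 1\<close> is in \<open>I\<close>, then \<open>s\<^sub>l\<close> acts on one tensor factor, either on the trivial one or by
  a transposition fixing \<open>e\<^sub>1\<close>.
\<close>

lemma ann_ascent:
  assumes g: "g \<in> Sym n" and l: "l \<in> unshadowed"
  shows "ID.pure (single g - single (g \<circ> adj l)) gen = ID.null"
proof -
  obtain k where k: "k \<in> {1..m}" "l \<in> block j k" "l + 1 \<in> block j k"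
    "k \<in> J \<Longrightarrow> l \<noteq> off k + 1" using unshadowed_block[OF l] by metis
  define a where "a = l - off k"
  have la: "l = off k + a" and a: "a \<in> {1..j k}" "a + 1 \<in> {1..j k}"
    using k(2,3) by (auto simp: a_def block_def)
  let ?t = "transpose a (a + 1)"
  have t: "?t \<in> Sym (j k)" using a by (rule Sym_transpose)
  have "phi (blk k ?t) = adj l"
    unfolding phi_blk[OF k(1)] par_transpose[OF k(1) a] by (simp add: la)
  moreover have "single (blk k ?t) \<odot>\<^bsub>HZ_rep\<^esub> gen = gen"
  proof -
    have "basis (\<lambda>x. if x = k then ?t 1 else 1) = basis (\<lambda>_. 1)"
    proof (rule restrict_ext)
      fix x assume x: "x \<in> J"
      have "(if x = k then ?t 1 else 1) = 1"
      proof (cases "x = k")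
        case True
        then have "a \<noteq> 1" using x k(4) la by simp
        then show ?thesis using a(1) by (auto simp: transpose_def)
      qed simp
      then show "coset (const_vecs (j x)) (single (if x = k then ?t 1 else 1)) = coset (const_vecs (j x)) (single 1)"
        by (simp only:)
    qed
    then show ?thesis unfolding blk_gen[OF k(1) t] by (simp only: gen_def)
  qed
  ultimately have "ID.pure (single g) gen = ID.pure (conv n (single g) (single (adj l))) gen"
    using ID_act[OF single_in_free[OF g] blk_par_grp[OF k(1) t] gen_HZ_rep] by simp
  moreover have al: "adj l \<in> Sym n" using l nonshadow_subset by (intro adj_Sym) blast
  ultimately have "ID.pure (single g) gen = ID.pure (single (g \<circ> adj l)) gen"
    by (simp only: conv_single_single[OF g al])
  then show ?thesis using pure_gen_eq_iff[of "single g" "single (g \<circ> adj l)"] g al by simp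
qed

lemma Zk: "k \<in> J \<Longrightarrow> u \<in> free {1..j k} \<Longrightarrow> coset (const_vecs (j k)) u \<in> carrier (Z_factor k)"
  unfolding Z_factor_def refl_quot_mod_carrier by (rule imageI)

lemma one_tensor_zero:
  assumes k: "k \<in> J" and z: "z \<in> MT.X"
  shows "one_tensor (z(k := coset (const_vecs (j k)) 0)) = T.null"
proof -
  let ?u = "coset (const_vecs (j k)) (single 1)"
  have 1: "single 1 \<in> free {1..j k}" using j2[OF k] by (intro single_in_free) simp
  have u: "?u \<in> carrier (Z_factor k)" by (rule Zk[OF k 1])
  have "0 \<odot>\<^bsub>Z_factor k\<^esub> ?u = coset (const_vecs (j k)) 0"
    unfolding Z_factor_def refl_quot_mod_smult[OF 1] by (simp only: mult_zero_left zero_fun_def)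
  then have "one_tensor (z(k := coset (const_vecs (j k)) 0)) = scal 0 \<odot>\<^bsub>HZ_rep\<^esub> one_tensor (z(k := ?u))"
    using one_tensor_scale[OF z k u, of 0] by (simp only:)
  also have "\<dots> = coset T.null (\<lambda>x. 0 * single (1, MT.pure (z(k := ?u))) x)"
    unfolding one_tensor_def T.pure_def
    by (rule HZ_rep_scale[OF single_in_free]) (use MT_pure_Z_mod[OF MT.upd_X[OF z k u]] in simp)
  also have "\<dots> = T.null" by (rule coset_null_zero)
  finally show ?thesis .
qed

text \<open>
  Moving \<open>(i a)\<close> across the tensor sign turns the sum into \<open>g \<otimes> (1 \<otimes> e\<^sub>1 \<otimes> \<dots> \<otimes> (e\<^sub>1 + \<dots> + e\<^sub>p) \<otimes> \<dots> \<otimes> e\<^sub>1)\<close>, and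
  \<open>e\<^sub>1 + \<dots> + e\<^sub>p\<close> is a constant vector.
\<close>

lemma ann_block:
  assumes g: "g \<in> Sym n" and k: "k \<in> J"
  shows "ID.pure (\<Sum>a\<in>block j k. single (g \<circ> transpose (off k + 1) a)) gen = ID.null"
proof -
  let ?z = "basis (\<lambda>_. 1)"
  let ?s = "\<lambda>a. single (g \<circ> transpose (off k + 1) (off k + a)) :: (nat \<Rightarrow> nat) \<Rightarrow> 'k"
  have gA: "single g \<in> alg" using g by (rule single_in_free)
  have k1: "k \<in> {1..m}" using k by simp
  have one: "1 \<in> {1..j k}" using j2[OF k] by simp
  have tS: "transpose (off k + 1) (off k + a) \<in> Sym n" if "a \<in> {1..j k}" for a
    using that one block_sub[OF k1] by (intro Sym_transpose) (auto simp: block_def)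
  have sA: "?s a \<in> alg" if "a \<in> {1..j k}" for a using g tS[OF that] by (intro single_in_free Sym_comp)
  have base: "ID.pure (?s a) gen = ID.pure (single g) (one_tensor (?z(k := coset (const_vecs (j k)) (single a))))"
    if a: "a \<in> {1..j k}" for a
  proof -
    let ?t = "transpose 1 a"
    have t: "?t \<in> Sym (j k)" using one a by (rule Sym_transpose)
    have "basis (\<lambda>l. if l = k then ?t 1 else 1) = ?z(k := coset (const_vecs (j k)) (single a))"
    proof
      fix l
      show "basis (\<lambda>l. if l = k then ?t 1 else 1) l = (?z(k := coset (const_vecs (j k)) (single a))) l"
        using k by (cases "l = k") auto
    qed
    then have "one_tensor (?z(k := coset (const_vecs (j k)) (single a))) = single (blk k ?t) \<odot>\<^bsub>HZ_rep\<^esub> gen"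
      unfolding blk_gen[OF k1 t] by (simp only:)
    then show ?thesis using ID_act[OF gA blk_par_grp[OF k1 t] gen_HZ_rep]
      by (simp only: phi_blk[OF k1] par_transpose[OF k1 one a] conv_single_single[OF g tS[OF a]])
  qed
  have main: "(\<Sum>a\<in>D. ?s a) \<in> alg \<and> (\<Sum>a\<in>D. single a :: nat \<Rightarrow> 'k) \<in> free {1..j k} \<and>
      ID.pure (\<Sum>a\<in>D. ?s a) gen = ID.pure (single g) (one_tensor (?z(k := coset (const_vecs (j k)) (\<Sum>a\<in>D. single a))))"
    if "finite D" "D \<subseteq> {1..j k}" for D
    using that
  proof (induction D rule: finite_induct)
    case empty
    have "ID.pure (single g) T.null = ID.null" by (rule ID.pure_zero_right[OF HZ_rep_zero]) (use gA in simp)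
    then show ?case unfolding sum.empty one_tensor_zero[OF k basis1_X] pure_zero_gen
      by (intro conjI zero_in_free) (rule sym)
  next
    case (insert a D)
    have a: "a \<in> {1..j k}" using insert.prems by simp
    have D: "D \<subseteq> {1..j k}" using insert.prems by simp
    note IH0 = insert.IH[OF D]
    have IH: "(\<Sum>a\<in>D. ?s a) \<in> alg" "(\<Sum>a\<in>D. single a :: nat \<Rightarrow> 'k) \<in> free {1..j k}"
      "ID.pure (\<Sum>a\<in>D. ?s a) gen = ID.pure (single g) (one_tensor (?z(k := coset (const_vecs (j k)) (\<Sum>a\<in>D. single a))))"
      using IH0 by blast+
    let ?u = "coset (const_vecs (j k)) (single a)" and ?v = "coset (const_vecs (j k)) (\<Sum>a\<in>D. single a)"
    have uv: "?u \<in> carrier (Z_factor k)" "?v \<in> carrier (Z_factor k)" by (rule Zk[OF k single_in_free[OF a]], rule Zk[OF k IH(2)])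
    have "coset (const_vecs (j k)) (single a + (\<Sum>a\<in>D. single a)) = ?u \<oplus>\<^bsub>Z_factor k\<^esub> ?v"
      unfolding Z_factor_def refl_quot_mod_add ..
    then have "ID.pure (single g) (one_tensor (?z(k := coset (const_vecs (j k)) (single a + (\<Sum>a\<in>D. single a)))))
        = coset ID.null (single (single g, one_tensor (?z(k := ?u))) + single (single g, one_tensor (?z(k := ?v))))"
      using ID.pure_add_right[OF _ one_tensor_HZ_rep[OF MT.upd_X[OF basis1_X k uv(1)]] one_tensor_HZ_rep[OF MT.upd_X[OF basis1_X k uv(2)]],
          of "single g"] gA
      by (simp only: one_tensor_add[OF basis1_X k uv] GA_mod_simps)
    also have "\<dots> = coset ID.null (single (?s a, gen) + single (\<Sum>a\<in>D. ?s a, gen))"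
      by (rule coset_cong_add[OF ID.null_subgp]) (use base[OF a] IH(3) in \<open>simp_all only: ID.pure_def\<close>)
    also have "\<dots> = ID.pure (?s a + (\<Sum>a\<in>D. ?s a)) gen" by (rule pure_gen_add[symmetric, OF sA[OF a] IH(1)])
    finally have pure_eq: "ID.pure (?s a + (\<Sum>a\<in>D. ?s a)) gen =
      ID.pure (single g) (one_tensor (?z(k := coset (const_vecs (j k)) (single a + (\<Sum>a\<in>D. single a)))))" ..
    show ?case unfolding sum.insert[OF insert.hyps]
      by (intro conjI add_in_free sA a IH(1,2) single_in_free pure_eq)
  qed
  have "(\<Sum>a\<in>{1..j k}. single a) = ((\<lambda>x. if x \<in> {1..j k} then 1 else 0) :: nat \<Rightarrow> 'k)"
  proof
    fix x :: nat
    have "(\<Sum>a\<in>D. single a) x = (if x \<in> D then 1 else (0 :: 'k))" if "finite D" for D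
      using that by (induction D rule: finite_induct) (auto simp: single_def)
    then show "(\<Sum>a\<in>{1..j k}. single a) x = (if x \<in> {1..j k} then 1 else (0 :: 'k))" by blast
  qed
  then have "(\<Sum>a\<in>{1..j k}. single a) - 0 \<in> (const_vecs (j k) :: (nat \<Rightarrow> 'k) set)"
    unfolding const_vecs_def by auto
  then have "coset (const_vecs (j k)) (\<Sum>a\<in>{1..j k}. single a :: nat \<Rightarrow> 'k) = coset (const_vecs (j k)) (0 :: nat \<Rightarrow> 'k)"
    by (simp only: coset_eq_iff[OF const_vecs_subgp])
  then have "ID.pure (\<Sum>a\<in>{1..j k}. ?s a) gen = ID.pure (single g) T.null"
    using main[of "{1..j k}"] one_tensor_zero[OF k basis1_X] by (simp only: finite_atLeastAtMost subset_refl simp_thms)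
  also have "\<dots> = ID.null" by (rule ID.pure_zero_right[OF HZ_rep_zero]) (use gA in simp)
  finally have "ID.pure (\<Sum>a\<in>{1..j k}. ?s a) gen = ID.null" .
  moreover have "(\<Sum>a\<in>block j k. single (g \<circ> transpose (off k + 1) a)) = (\<Sum>a\<in>{1..j k}. ?s a)"
    by (rule sum.reindex_bij_witness[of _ "\<lambda>a. off k + a" "\<lambda>a. a - off k"]) (auto simp: block_def)
  ultimately show ?thesis by (simp only:)
qed

section \<open>A map from the induced representation to the group algebra\<close>

text \<open>
  The value at \<open>w\<close> of the product of the factors \<open>v\<^sub>k(w i) - v\<^sub>k(w (i + 1))\<close>, where \<open>i = off k + 1\<close> and
  positions are counted from the beginning of the block.  For \<open>w \<in> H\<close> and the tuple \<open>(e\<^sub>1, \<dots>, e\<^sub>1)\<close> this is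
  \<open>\<xi>(w)\<close>.
\<close>

definition diff_prod :: "(nat \<Rightarrow> nat) \<Rightarrow> (nat \<Rightarrow> (nat \<Rightarrow> 'k) set) \<Rightarrow> 'k"
  where "diff_prod w z = (\<Prod>k\<in>J. coord_diff (w (off k + 1) - off k) (w (off k + 2) - off k) (z k))"

definition mtensor_val :: "(nat \<Rightarrow> nat) \<Rightarrow> ((nat \<Rightarrow> (nat \<Rightarrow> 'k) set) \<Rightarrow> 'k) set \<Rightarrow> 'k"
  where "mtensor_val w = coset_val (lin_ext (diff_prod w))"

text \<open>
  The map from the inducing representation to \<open>A\<close>.  By \<open>theta_smult\<close> it is linear over the group algebra of
  the parabolic subgroup, hence extends to an \<open>A\<close>-linear map on the induced representation.
\<close>

definition theta :: "('k \<times> ((nat \<Rightarrow> (nat \<Rightarrow> 'k) set) \<Rightarrow> 'k) set \<Rightarrow> 'k) set \<Rightarrow> (nat \<Rightarrow> nat) \<Rightarrow> 'k"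
  where "theta t w = (if w \<in> H then coset_val (lin_ext (\<lambda>(c, y). c * mtensor_val w y)) t else 0)"

lemma H_pos:
  assumes w: "w \<in> H" and k: "k \<in> J"
  shows "w (off k + 1) - off k \<in> {1..j k}" "w (off k + 2) - off k \<in> {1..j k}"
  using H_block[OF w, of k "off k + 1"] H_block[OF w, of k "off k + 2"] block_first[OF k] k
  by (simp_all add: block_shift)

lemma Z_factor_elim:
  assumes "u \<in> carrier (Z_factor k)"
  obtains v where "u = coset (const_vecs (j k)) v" "v \<in> free {1..j k}"
  using assms unfolding Z_factor_def refl_quot_mod_carrier by blast

lemma coord_diff_add:
  assumes "a \<in> {1..j k}" "b \<in> {1..j k}" "u \<in> carrier (Z_factor k)" "v \<in> carrier (Z_factor k)"
  shows "coord_diff a b (u \<oplus>\<^bsub>Z_factor k\<^esub> v) = coord_diff a b u + coord_diff a b v"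
proof -
  obtain u' v' where "u = coset (const_vecs (j k)) u'" "v = coset (const_vecs (j k)) v'"
    using assms(3,4) by (metis Z_factor_elim)
  then show ?thesis by (simp add: Z_factor_def refl_quot_mod_add coord_diff_coset[OF assms(1,2)])
qed

lemma coord_diff_scale:
  assumes "a \<in> {1..j k}" "b \<in> {1..j k}" "u \<in> carrier (Z_factor k)"
  shows "coord_diff a b (c \<odot>\<^bsub>Z_factor k\<^esub> u) = c * coord_diff a b u"
proof -
  obtain u' where "u = coset (const_vecs (j k)) u'" "u' \<in> free {1..j k}"
    using assms(3) by (rule Z_factor_elim)
  then show ?thesis by (simp add: Z_factor_def refl_quot_mod_smult coord_diff_coset[OF assms(1,2)] right_diff_distrib)
qed

lemma diff_prod_upd:
  assumes "i \<in> J"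
  shows "diff_prod w (x(i := u)) = coord_diff (w (off i + 1) - off i) (w (off i + 2) - off i) u *
    (\<Prod>k\<in>J - {i}. coord_diff (w (off k + 1) - off k) (w (off k + 2) - off k) (x k))"
proof -
  have "diff_prod w (x(i := u)) = coord_diff (w (off i + 1) - off i) (w (off i + 2) - off i) u *
    (\<Prod>k\<in>J - {i}. coord_diff (w (off k + 1) - off k) (w (off k + 2) - off k) ((x(i := u)) k))"
    unfolding diff_prod_def prod.remove[OF finite_atLeastAtMost assms] fun_upd_same ..
  also have "(\<Prod>k\<in>J - {i}. coord_diff (w (off k + 1) - off k) (w (off k + 2) - off k) ((x(i := u)) k)) =
    (\<Prod>k\<in>J - {i}. coord_diff (w (off k + 1) - off k) (w (off k + 2) - off k) (x k))"
    by (rule prod.cong) auto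
  finally show ?thesis .
qed

lemma mtensor_val_coset:
  assumes w: "w \<in> H" and f: "f \<in> free MT.X"
  shows "mtensor_val w (coset MT.null f) = lin_ext (diff_prod w) f"
  unfolding mtensor_val_def
proof (rule MT.coset_val_mtensor[OF _ _ f])
  fix x :: "nat \<Rightarrow> (nat \<Rightarrow> 'k) set" and i u v c assume i: "i \<in> J" and u: "u \<in> carrier (Z_factor i)"
  show "diff_prod w (x(i := c \<odot>\<^bsub>Z_factor i\<^esub> u)) = c * diff_prod w (x(i := u))"
    unfolding diff_prod_upd[OF i] coord_diff_scale[OF H_pos[OF w i] u] by (simp only: mult.assoc)
  assume v: "v \<in> carrier (Z_factor i)"
  show "diff_prod w (x(i := u \<oplus>\<^bsub>Z_factor i\<^esub> v)) = diff_prod w (x(i := u)) + diff_prod w (x(i := v))"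
    unfolding diff_prod_upd[OF i] coord_diff_add[OF H_pos[OF w i] u v] by (simp only: distrib_right)
qed

lemma Z_mod_elim:
  assumes "y \<in> carrier Z_mod"
  obtains f where "y = coset MT.null f" "f \<in> free MT.X"
  using assms unfolding Z_mod_carrier by (rule imageE)

lemma HZ_rep_elim:
  assumes "t \<in> carrier HZ_rep"
  obtains f where "t = coset T.null f" "f \<in> free T.X"
  using assms unfolding HZ_rep_carrier by (rule imageE)

lemma mtensor_val_add:
  assumes w: "w \<in> H" and "y \<in> carrier Z_mod" "y' \<in> carrier Z_mod"
  shows "mtensor_val w (y \<oplus>\<^bsub>Z_mod\<^esub> y') = mtensor_val w y + mtensor_val w y'"
proof -
  obtain f where f: "y = coset MT.null f" "f \<in> free MT.X" using assms(2) by (rule Z_mod_elim)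
  obtain f' where f': "y' = coset MT.null f'" "f' \<in> free MT.X" using assms(3) by (rule Z_mod_elim)
  show ?thesis unfolding f(1) f'(1) Z_mod_add mtensor_val_coset[OF w f(2)] mtensor_val_coset[OF w f'(2)]
      mtensor_val_coset[OF w add_in_free[OF f(2) f'(2)]] by (rule lin_ext_add[OF f(2) f'(2)])
qed

lemma mtensor_val_scale:
  assumes w: "w \<in> H" and "y \<in> carrier Z_mod"
  shows "mtensor_val w (c \<odot>\<^bsub>Z_mod\<^esub> y) = c * mtensor_val w y"
proof -
  obtain f where f: "y = coset MT.null f" "f \<in> free MT.X" using assms(2) by (rule Z_mod_elim)
  show ?thesis unfolding f(1) Z_mod_smult[OF f(2)] mtensor_val_coset[OF w f(2)]
      mtensor_val_coset[OF w scale_in_free[OF f(2)]] by (rule lin_ext_scale[OF f(2)])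
qed

lemma theta_coset:
  assumes w: "w \<in> H" and f: "f \<in> free T.X"
  shows "theta (coset T.null f) w = lin_ext (\<lambda>(c, y). c * mtensor_val w y) f"
proof -
  have "coset_val (lin_ext (\<lambda>(c, y). c * mtensor_val w y)) (coset T.null f) = lin_ext (\<lambda>(c, y). c * mtensor_val w y) f"
  proof (rule T.coset_val_tensor(2)[OF _ _ _ _ f])
    fix x y y' assume "y \<in> carrier Z_mod" "y' \<in> carrier Z_mod"
    then show "(case (x, y \<oplus>\<^bsub>Z_mod\<^esub> y') of (c, y) \<Rightarrow> c * mtensor_val w y) =
        (case (x, y) of (c, y) \<Rightarrow> c * mtensor_val w y) + (case (x, y') of (c, y) \<Rightarrow> c * mtensor_val w y)"
      by (simp add: mtensor_val_add[OF w] distrib_left)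
  next
    fix x a y assume "y \<in> carrier Z_mod"
    then show "(case (rho1 x a, y) of (c, y) \<Rightarrow> c * mtensor_val w y) = (case (x, a \<odot>\<^bsub>Z_mod\<^esub> y) of (c, y) \<Rightarrow> c * mtensor_val w y)"
      by (simp add: mtensor_val_scale[OF w] rho1_eq mult_ac)
  qed (simp_all add: distrib_right mult.assoc)
  then show ?thesis using w by (simp add: theta_def)
qed

lemma theta_out: "w \<notin> H \<Longrightarrow> theta t w = 0"
  by (simp add: theta_def)

lemma theta_add:
  assumes "t \<in> carrier HZ_rep" "t' \<in> carrier HZ_rep"
  shows "theta (t \<oplus>\<^bsub>HZ_rep\<^esub> t') = theta t + theta t'"
proof
  fix w
  obtain f where f: "t = coset T.null f" "f \<in> free T.X" using assms(1) by (rule HZ_rep_elim)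
  obtain f' where f': "t' = coset T.null f'" "f' \<in> free T.X" using assms(2) by (rule HZ_rep_elim)
  show "theta (t \<oplus>\<^bsub>HZ_rep\<^esub> t') w = (theta t + theta t') w"
  proof (cases "w \<in> H")
    case True
    have "theta (coset T.null (f + f')) w = theta (coset T.null f) w + theta (coset T.null f') w"
      unfolding theta_coset[OF True f(2)] theta_coset[OF True f'(2)] theta_coset[OF True add_in_free[OF f(2) f'(2)]]
      by (rule lin_ext_add[OF f(2) f'(2)])
    then show ?thesis
      unfolding f(1) f'(1) HZ_rep_add plus_fun_apply[of "theta (coset T.null f)" "theta (coset T.null f')" w] .
  qed (simp add: theta_out)
qed

lemma phi_inv_pos:
  assumes gh: "(g, h) \<in> carrier par_grp" and w: "w \<in> H" and k: "k \<in> J" and x: "x \<in> block j k"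
  shows "(inv' (phi (g, h)) \<circ> w) x - off k = inv' (h k) (w x - off k)"
proof -
  have k1: "k \<in> {1..m}" "k \<noteq> 1" using k by auto
  have i: "inv' ((h(1 := g)) k) \<in> Sym (j k)" using par_grp_comp[OF gh k1(1)] by (rule Sym_inv)
  have "inv' (phi (g, h)) = parabolic m j (\<lambda>k. inv' ((h(1 := g)) k))"
    unfolding phi_def prod.case by (rule par_inv(3)) (rule par_grp_comp[OF gh])
  then show ?thesis
    using par_in_block(2)[of k "w x" "\<lambda>k. inv' ((h(1 := g)) k)", OF k1(1) H_block[OF w k1(1) x] i] k1(2)
    by (simp only: o_apply fun_upd_other[OF k1(2)])
qed

text \<open>
  Acting on the vectors \<open>v\<^sub>k\<close> moves their coordinates by the inverse permutations, and these are the
  components of the inverse of the embedded permutation.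
\<close>

lemma diff_prod_act:
  assumes gh: "(g, h) \<in> carrier par_grp" and w: "w \<in> H" and z: "z \<in> MT.X"
  shows "diff_prod w (hmap h z) = diff_prod (inv' (phi (g, h)) \<circ> w) z"
  unfolding diff_prod_def
proof (rule prod.cong[OF refl])
  fix k assume k: "k \<in> J"
  let ?w = "inv' (phi (g, h)) \<circ> w"
  have h: "h k \<in> Sym (j k)" using gh k by (simp add: par_grp_iff prod_grp_iff)
  have "?w \<in> H" using phi_H[OF gh] w unfolding H_def by (intro W_comp W_inv)
  note p = H_pos[OF w k] and p' = H_pos[OF this k]
  have "z k \<in> carrier (Z_factor k)" using z k by blast
  then obtain v where v: "z k = coset (const_vecs (j k)) v" "v \<in> free {1..j k}" by (rule Z_factor_elim)
  have "hmap h z k = coset (const_vecs (j k)) (push (h k) v)"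
    using k refl_quot_act1[OF h v(2)] by (simp add: v(1))
  then have "coord_diff (w (off k + 1) - off k) (w (off k + 2) - off k) (hmap h z k)
      = v (inv' (h k) (w (off k + 1) - off k)) - v (inv' (h k) (w (off k + 2) - off k))"
    by (simp only: coord_diff_coset[OF p] push_perm[OF h v(2)] o_apply)
  also have "\<dots> = v (?w (off k + 1) - off k) - v (?w (off k + 2) - off k)"
    using phi_inv_pos[OF gh w k] block_first[OF k] by (simp only:)
  also have "\<dots> = coord_diff (?w (off k + 1) - off k) (?w (off k + 2) - off k) (z k)"
    unfolding v(1) by (rule coord_diff_coset[OF p', symmetric])
  finally show "coord_diff (w (off k + 1) - off k) (w (off k + 2) - off k) (hmap h z k)
      = coord_diff (?w (off k + 1) - off k) (?w (off k + 2) - off k) (z k)" .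
qed

lemma mtensor_val_act:
  assumes gh: "(g, h) \<in> carrier par_grp" and w: "w \<in> H" and y: "y \<in> carrier Z_mod"
  shows "mtensor_val w (single h \<odot>\<^bsub>Z_rep\<^esub> y) = mtensor_val (inv' (phi (g, h)) \<circ> w) y"
proof -
  have h: "h \<in> carrier prod_grp" using gh by (simp add: par_grp_iff)
  have w': "inv' (phi (g, h)) \<circ> w \<in> H" using phi_H[OF gh] w unfolding H_def by (intro W_comp W_inv)
  obtain f where f: "y = coset MT.null f" "f \<in> free MT.X" using y by (rule Z_mod_elim)
  show ?thesis
    unfolding f(1) Z_rep_act1[OF h f(2)] mtensor_val_coset[OF w push_hmap_free[OF h f(2)]] mtensor_val_coset[OF w' f(2)]
      lin_ext_push[OF f(2)]
    by (rule lin_ext_cong[OF _ f(2)]) (rule diff_prod_act[OF gh w])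
qed

lemma theta_act:
  assumes gh: "gh \<in> carrier par_grp" and t: "t \<in> carrier HZ_rep"
  shows "theta (act gh t) w = theta t (inv' (phi gh) \<circ> w)"
proof -
  obtain g h where gh': "gh = (g, h)" by (cases gh)
  have gh2: "(g, h) \<in> carrier par_grp" using gh gh' by simp
  have g: "g \<in> Sym (j 1)" and h: "h \<in> carrier prod_grp" using gh2 by (simp_all add: par_grp_iff)
  obtain f where f: "t = coset T.null f" "f \<in> free T.X" using t by (rule HZ_rep_elim)
  let ?w = "inv' (phi (g, h)) \<circ> w"
  have pH: "phi (g, h) \<in> H" by (rule phi_H[OF gh2])
  have iff: "?w \<in> H \<longleftrightarrow> w \<in> H"
    using pH W_comp W_inv Sym_inv_o(4)[OF phi_Sym[OF gh2], of w] unfolding H_def by metis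
  show ?thesis
  proof (cases "w \<in> H")
    case True
    have "lin_ext (\<lambda>xy. case pmap h xy of (c, y) \<Rightarrow> c * mtensor_val w y) f = lin_ext (\<lambda>(c, y). c * mtensor_val ?w y) f"
    proof (rule lin_ext_cong[OF _ f(2)])
      fix xy assume xy: "xy \<in> T.X"
      obtain x y where "xy = (x, y)" by (cases xy)
      then show "(case pmap h xy of (c, y) \<Rightarrow> c * mtensor_val w y) = (case xy of (c, y) \<Rightarrow> c * mtensor_val ?w y)"
        using xy mtensor_val_act[OF gh2 True, of y] by simp
    qed
    then show ?thesis
      unfolding gh' f(1) act_coset[OF g h f(2)] theta_coset[OF True push_pmap_free[OF h f(2)]]
        theta_coset[OF iff[THEN iffD2, OF True] f(2)] lin_ext_push[OF f(2)] .
  next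
    case False
    then have "?w \<notin> H" using iff by simp
    then show ?thesis unfolding gh' theta_out[OF False] using theta_out by metis
  qed
qed

lemma theta_smult:
  assumes r: "r \<in> par_alg" and t: "t \<in> carrier HZ_rep"
  shows "theta (r \<odot>\<^bsub>HZ_rep\<^esub> t) = conv n (push phi r) (theta t)"
proof
  fix w
  have rf: "r \<in> free (carrier par_grp)" using r by (simp add: par_alg_def)
  have HZ_tensor_HZ_rep: "carrier HZ_tensor = carrier HZ_rep" by (simp only: HZ_rep_carrier T.carrier_tensor)
  have scal_theta: "theta (c \<odot>\<^bsub>HZ_tensor\<^esub> s) w = c * theta s w" if s: "s \<in> carrier HZ_rep" for c s
  proof -
    obtain f where f: "s = coset T.null f" "f \<in> free T.X" using s by (rule HZ_rep_elim)
    show ?thesis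
    proof (cases "w \<in> H")
      case True
      show ?thesis unfolding f(1) T.smult_tensor theta_coset[OF True f(2)] theta_coset[OF True scale_in_free[OF f(2)]]
        by (rule lin_ext_scale[OF f(2)])
    qed (simp add: theta_out)
  qed
  have act_HZ_rep: "act gh t \<in> carrier HZ_rep" if gh: "gh \<in> carrier par_grp" for gh
  proof -
    obtain g h where gh': "gh = (g, h)" "g \<in> Sym (j 1)" "h \<in> carrier prod_grp"
      using gh by (cases gh) (auto simp: par_grp_iff)
    obtain f where f: "t = coset T.null f" "f \<in> free T.X" using t by (rule HZ_rep_elim)
    show ?thesis unfolding gh'(1) f(1) act_coset[OF gh'(2,3) f(2)] HZ_rep_carrier
      by (intro imageI push_pmap_free gh' f)
  qed
  have "theta (r \<odot>\<^bsub>HZ_rep\<^esub> t) w = (\<Sum>gh\<in>carrier par_grp. theta (r gh \<odot>\<^bsub>HZ_tensor\<^esub> act gh t) w)"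
    unfolding HZ_rep_smult
  proof (rule finsum_additive[OF T.tensor_abelian_monoid finite_par_grp, of _ "\<lambda>t. theta t w"])
    show "r gh \<odot>\<^bsub>HZ_tensor\<^esub> act gh t \<in> carrier HZ_tensor" if "gh \<in> carrier par_grp" for gh by (rule act_closed[OF that t])
    have "theta (T.null) w = 0"
    proof (cases "w \<in> H")
      case True
      then show ?thesis using theta_coset[OF True zero_in_free] by simp
    qed (rule theta_out)
    then show "theta \<zero>\<^bsub>HZ_tensor\<^esub> w = 0" by (simp only: T.zero_tensor)
    fix x y assume xy: "x \<in> carrier HZ_tensor" "y \<in> carrier HZ_tensor"
    have "x \<oplus>\<^bsub>HZ_tensor\<^esub> y = x \<oplus>\<^bsub>HZ_rep\<^esub> y" by (simp add: HZ_rep_eq linearize_def)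
    then show "theta (x \<oplus>\<^bsub>HZ_tensor\<^esub> y) w = theta x w + theta y w" using theta_add[of x y] xy by (simp add: HZ_tensor_HZ_rep)
  qed
  also have "\<dots> = (\<Sum>gh\<in>carrier par_grp. r gh * theta t (inv' (phi gh) \<circ> w))"
    by (rule sum.cong[OF refl]) (simp only: scal_theta act_HZ_rep theta_act[OF _ t])
  also have "\<dots> = conv n (push phi r) (theta t) w"
  proof (cases "w \<in> Sym n")
    case True
    have "(\<Sum>gh\<in>carrier par_grp. r gh * theta t (inv' (phi gh) \<circ> w)) = lin_ext (\<lambda>gh. theta t (inv' (phi gh) \<circ> w)) r"
      by (rule lin_ext_superset[symmetric]) (use rf in \<open>auto simp: mem_free_module\<close>)
    also have "\<dots> = lin_ext (\<lambda>g. theta t (inv' g \<circ> w)) (push phi r)" by (rule lin_ext_push[OF rf, symmetric])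
    also have "\<dots> = (\<Sum>g\<in>Sym n. push phi r g * theta t (inv' g \<circ> w))"
      by (rule lin_ext_superset[OF finite_Sym])
        (use push_in_free[OF rf, of phi "Sym n"] phi_Sym in \<open>auto simp: mem_free_module\<close>)
    finally show ?thesis using True by (simp add: conv_def)
  next
    case False
    have "inv' (phi gh) \<circ> w \<notin> H" if "gh \<in> carrier par_grp" for gh
    proof
      assume "inv' (phi gh) \<circ> w \<in> H"
      then have "phi gh \<circ> (inv' (phi gh) \<circ> w) \<in> Sym n" by (intro Sym_comp phi_Sym that H_Sym)
      then show False using False Sym_inv_o(4)[OF phi_Sym[OF that], of w] by simp
    qed
    then show ?thesis using False by (simp add: conv_def theta_out)
  qed
  finally show "theta (r \<odot>\<^bsub>HZ_rep\<^esub> t) w = conv n (push phi r) (theta t) w" .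
qed

lemma theta_gen: "theta gen = xi"
proof
  fix w
  show "theta gen w = xi w"
  proof (cases "w \<in> H")
    case True
    have X: "(1, MT.pure (basis (\<lambda>_. 1))) \<in> T.X" using MT_pure_Z_mod[OF basis1_X] by simp
    have "theta gen w = 1 * mtensor_val w (MT.pure (basis (\<lambda>_. 1)))"
      unfolding gen_def one_tensor_def T.pure_def theta_coset[OF True single_in_free[OF X]] lin_ext_single prod.case ..
    also have "\<dots> = diff_prod w (basis (\<lambda>_. 1))"
      unfolding MT.pure_def mtensor_val_coset[OF True single_in_free[OF basis1_X]] lin_ext_single by simp
    also have "\<dots> = (\<Prod>k\<in>J. single (off k + 1) (w (off k + 1)) - single (off k + 1) (w (off k + 2)))"
      unfolding diff_prod_def
    proof (rule prod.cong[OF refl])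
      fix k assume k: "k \<in> J"
      have b: "off k < w (off k + 1)" "off k < w (off k + 2)"
        using H_block[OF True, of k] block_first[OF k] k by (auto simp: block_shift)
      have "single 1 (x - off k) = (single (off k + 1) x :: 'k)" if "off k < x" for x
        using that by (auto simp: single_def)
      then show "coord_diff (w (off k + 1) - off k) (w (off k + 2) - off k) (basis (\<lambda>_. 1) k)
          = single (off k + 1) (w (off k + 1)) - single (off k + 1) (w (off k + 2))"
        using k b coord_diff_coset[OF H_pos[OF True k], of "single 1 :: nat \<Rightarrow> 'k"] by (simp only: restrict_apply if_True)
    qed
    also have "\<dots> = (\<Prod>i\<in>I. single i (w i) - single i (w (i + 1)))"
    proof -
      have "inj_on (\<lambda>k. off k + 1) J" using off_inj by (auto simp: inj_on_def)
      then show ?thesis unfolding I_def by (subst prod.reindex) (simp_all add: o_def)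
    qed
    finally show ?thesis using True by (simp add: xi_def)
  next
    case False
    then show ?thesis by (simp add: theta_out xi_def)
  qed
qed

text \<open>
  The functional \<open>q \<otimes> t \<mapsto> (q \<cdot> theta t)(u)\<close> respects the relations of the tensor product over the group algebra
  of the parabolic subgroup, and it takes \<open>p \<otimes> gen\<close> to \<open>(p\<xi>)(u)\<close>.
\<close>

lemma ann_xi:
  assumes p: "p \<in> alg" and 0: "ID.pure p gen = ID.null"
  shows "conv n p xi = 0"
proof
  fix u
  have "single (p, gen) \<in> ID.null"
    using 0 coset_eq_iff[OF ID.null_subgp, of "single (p, gen)" 0] by (simp add: ID.pure_def)
  then have "lin_ext (\<lambda>(q, t). conv n q (theta t) u) (single (p, gen)) = 0"
  proof (rule ID.tensor_null_lin_ext[rotated -1])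
    fix x x' y assume "y \<in> carrier HZ_rep"
    show "(case (x \<oplus>\<^bsub>GA_mod\<^esub> x', y) of (q, t) \<Rightarrow> conv n q (theta t) u) =
        (case (x, y) of (q, t) \<Rightarrow> conv n q (theta t) u) + (case (x', y) of (q, t) \<Rightarrow> conv n q (theta t) u)"
      by (simp add: conv_add_left)
  next
    fix x y y' assume "y \<in> carrier HZ_rep" "y' \<in> carrier HZ_rep"
    then show "(case (x, y \<oplus>\<^bsub>HZ_rep\<^esub> y') of (q, t) \<Rightarrow> conv n q (theta t) u) =
        (case (x, y) of (q, t) \<Rightarrow> conv n q (theta t) u) + (case (x, y') of (q, t) \<Rightarrow> conv n q (theta t) u)"
      by (simp add: theta_add conv_add_right)
  next
    fix c x y assume "x \<in> carrier GA_mod" "y \<in> carrier HZ_rep"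
    then show "(case (c \<odot>\<^bsub>GA_mod\<^esub> x, y) of (q, t) \<Rightarrow> conv n q (theta t) u) =
        c * (case (x, y) of (q, t) \<Rightarrow> conv n q (theta t) u)"
      by (simp add: conv_scale_left)
  next
    fix x a y assume "x \<in> carrier GA_mod" "a \<in> par_alg" "y \<in> carrier HZ_rep"
    then show "(case (rho2 x a, y) of (q, t) \<Rightarrow> conv n q (theta t) u) =
        (case (x, a \<odot>\<^bsub>HZ_rep\<^esub> y) of (q, t) \<Rightarrow> conv n q (theta t) u)"
      by (simp add: theta_smult rho2_eq conv_assoc)
  qed
  then show "conv n p xi u = 0 u" by (simp add: theta_gen)
qed

text \<open>
  The annihilator of the generator of the induced representation.
\<close>

lemma ind_kernel:
  assumes p: "p \<in> alg"
  shows "ID.pure p gen = ID.null \<longleftrightarrow> conv n p xi = 0"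
proof -
  let ?L = "{p \<in> alg. ID.pure p gen = ID.null}"
  have "p \<in> ?L \<longleftrightarrow> conv n p xi = 0"
  proof (rule annihilator_eq[OF _ _ _ _ _ p])
    show "add_subgp ?L"
      unfolding add_subgp_def
    proof (intro conjI ballI)
      show "0 \<in> ?L" using pure_zero_gen by simp
      fix x y assume "x \<in> ?L" "y \<in> ?L"
      then show "x - y \<in> ?L" using pure_gen_eq_iff[of x y] by simp
    qed
    show "(\<lambda>x. c * p x) \<in> ?L" if "p \<in> ?L" for c p
    proof -
      from that have p: "p \<in> alg" and p0: "ID.pure p gen = ID.null" by auto
      have "(\<lambda>x. c * p x) = c \<odot>\<^bsub>GA_mod\<^esub> p" using p by (simp add: conv_scale_left)
      then have "ID.pure (\<lambda>x. c * p x) gen = coset ID.null (\<lambda>z. c * single (p, gen) z)"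
        using ID.pure_scale[of p gen c] p gen_HZ_rep by (simp only: GA_mod_simps)
      also have "single (p, gen) \<in> ID.null"
        using p0 coset_eq_iff[OF ID.null_subgp, of "single (p, gen)" 0] by (simp add: ID.pure_def)
      then have "(\<lambda>z. c * single (p, gen) z) - 0 \<in> ID.null" using ID.null_scale by simp
      then have "coset ID.null (\<lambda>z. c * single (p, gen) z) = ID.null"
        using coset_eq_iff[OF ID.null_subgp, of "\<lambda>z. c * single (p, gen) z" 0] by simp
      finally show ?thesis using p by simp
    qed
    show "single g - single (g \<circ> adj l) \<in> ?L" if g: "g \<in> Sym n" and l: "l \<in> unshadowed" for g l
    proof -
      have "adj l \<in> Sym n" using l nonshadow_subset by (intro adj_Sym) blast
      then show ?thesis using ann_ascent[OF g l] g by simp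
    qed
    show "(\<Sum>a\<in>block j k. single (g \<circ> transpose (off k + 1) a)) \<in> ?L"
      if g: "g \<in> Sym n" and k: "k \<in> J" for g k
    proof -
      have tS: "transpose (off k + 1) a \<in> Sym n" if "a \<in> block j k" for a
        using that block_first[OF k] block_sub[of k] k by (intro Sym_transpose) auto
      have "(\<Sum>a\<in>block j k. single (g \<circ> transpose (off k + 1) a)) \<in> alg"
        by (intro sum_in_free single_in_free Sym_comp g tS)
      then show ?thesis using ann_block[OF g k] by blast
    qed
    show "conv n p xi = 0" if "p \<in> ?L" for p using ann_xi that by blast
  qed
  then show ?thesis using p by simp
qed

end


section \<open>Cyclic representations\<close>

text \<open>
  Sending \<open>P p\<close> to \<open>P' p\<close> is well defined and injective because \<open>P\<close> and \<open>P'\<close> identify the same elements.  For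
  cyclic modules, \<open>P\<close> and \<open>P'\<close> are the multiplications on the two generators.
\<close>

lemma rep_iso_cyclic:
  assumes V: "carrier V = P ` A" and U: "carrier U = P' ` A"
    and add: "\<And>p q. p \<in> A \<Longrightarrow> q \<in> A \<Longrightarrow> p + q \<in> A"
      "\<And>p q. p \<in> A \<Longrightarrow> q \<in> A \<Longrightarrow> P p \<oplus>\<^bsub>V\<^esub> P q = P (p + q)"
      "\<And>p q. p \<in> A \<Longrightarrow> q \<in> A \<Longrightarrow> P' p \<oplus>\<^bsub>U\<^esub> P' q = P' (p + q)"
    and act: "\<And>r p. r \<in> carrier (group_alg G) \<Longrightarrow> p \<in> A \<Longrightarrow> app r p \<in> A"
      "\<And>r p. r \<in> carrier (group_alg G) \<Longrightarrow> p \<in> A \<Longrightarrow> r \<odot>\<^bsub>V\<^esub> P p = P (app r p)"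
      "\<And>r p. r \<in> carrier (group_alg G) \<Longrightarrow> p \<in> A \<Longrightarrow> r \<odot>\<^bsub>U\<^esub> P' p = P' (app r p)"
    and eq: "\<And>p q. p \<in> A \<Longrightarrow> q \<in> A \<Longrightarrow> P p = P q \<longleftrightarrow> P' p = P' q"
  shows "rep_iso G V U"
proof -
  (* The choice of p does not matter, by eq. *)
  define f where "f v = P' (SOME p. p \<in> A \<and> P p = v)" for v
  have f: "f (P p) = P' p" if "p \<in> A" for p
  proof -
    have "(SOME q. q \<in> A \<and> P q = P p) \<in> A \<and> P (SOME q. q \<in> A \<and> P q = P p) = P p"
      by (rule someI[of _ p]) (use that in simp)
    then show ?thesis using eq that unfolding f_def by blast
  qed
  have "f \<in> iso (add_monoid V) (add_monoid U)"
  proof (rule isoI)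
    show "f \<in> hom (add_monoid V) (add_monoid U)"
      by (rule homI) (use V U f add in auto)
    have "inj_on f (carrier V)" unfolding V inj_on_def using f eq by auto
    moreover have "f ` carrier V = carrier U" unfolding V U image_image using f by simp
    ultimately show "bij_betw f (carrier (add_monoid V)) (carrier (add_monoid U))"
      by (simp add: bij_betw_def)
  qed
  moreover have "f (r \<odot>\<^bsub>V\<^esub> v) = r \<odot>\<^bsub>U\<^esub> f v"
    if "r \<in> carrier (group_alg G)" "v \<in> carrier V" for r v
    using that act f unfolding V by auto
  ultimately show ?thesis unfolding rep_iso_def by blast
qed

section \<open>The isomorphism\<close>

text \<open>
  The offset of the block \<open>k\<close> is \<open>i\<^sub>k\<^sub>-\<^sub>1 - 1\<close>, by telescoping.  All differences after the first are at least \<open>2\<close>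
  because \<open>R\<close> is lacunar and its elements are less than \<open>n\<close>.
\<close>

lemma fibonacci_blocks:
  fixes n m :: nat and R :: "nat set" and idx j :: "nat \<Rightarrow> nat"
  assumes R: "R \<subseteq> {1..n - 1}" "lacunar R"
    and idx_mono: "strict_mono_on {1..m} idx"
    and idx_image: "idx ` {1..m} = R \<union> {n + 1}"
    and idx_0: "idx 0 = 1"
    and j: "\<And>k. k \<in> {1..m} \<Longrightarrow> j k = idx k - idx (k - 1)"
  shows "blocks n m j" "R = blocks.I m j"
proof -
  have less: "idx a < idx b" if "a \<in> {1..m}" "b \<in> {1..m}" "a < b" for a b
    using idx_mono that by (auto simp: strict_mono_on_def)
  have m: "1 \<le> m" using idx_image by (cases m) auto
  have Rb: "1 \<le> x \<and> x + 1 \<le> n" if "x \<in> R" for x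
  proof -
    have "x \<in> {1..n - 1}" using that R(1) by blast
    then show ?thesis by auto
  qed
  have pos: "1 \<le> idx k" if "k \<in> {1..m}" for k
  proof -
    have "idx k \<in> R \<union> {n + 1}" using idx_image that by blast
    then show ?thesis using Rb by auto
  qed
  have le: "idx (k - 1) \<le> idx k" if "k \<in> {1..m}" for k
  proof (cases "k = 1")
    case True
    then show ?thesis using pos[OF that] idx_0 by simp
  next
    case False
    then show ?thesis using less[of "k - 1" k] that by fastforce
  qed
  have off: "block_offset j (Suc k) = idx k - 1" if "k \<le> m" for k
    using that
  proof (induction k)
    case 0
    then show ?case by (simp add: block_offset_def idx_0)
  next
    case (Suc k)
    have k: "Suc k \<in> {1..m}" using Suc.prems by simp
    have "1 \<le> idx k" using pos[of k] idx_0 Suc.prems by (cases "k = 0") auto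
    moreover have "block_offset j (Suc (Suc k)) = block_offset j (Suc k) + j (Suc k)"
      by (simp add: block_offset_def)
    ultimately show ?case using Suc j[OF k] le[OF k] by simp
  qed
  have idx_m: "idx m = n + 1"
  proof -
    obtain k where k: "k \<in> {1..m}" "idx k = n + 1" using idx_image by (metis UnCI imageE singletonI)
    have "idx m \<in> R \<union> {n + 1}" using idx_image m by auto
    then have "idx m \<le> n + 1" using Rb[of "idx m"] by auto
    then show ?thesis using less[of k m] k m by (cases "k = m") auto
  qed
  have inQ: "idx k \<in> R" if "k \<in> {1..m}" "k \<noteq> m" for k
  proof -
    have "idx k \<in> R \<union> {n + 1}" using idx_image that by blast
    moreover have "idx k < n + 1" using less[of k m] that idx_m by auto
    ultimately show ?thesis by auto
  qed
  show blocks: "blocks n m j"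
  proof
    show "1 \<le> m" by (rule m)
    show "block_offset j (m + 1) = n" using off[of m] idx_m by simp
    fix k assume k: "k \<in> {2..m}"
    then have k': "k \<in> {1..m}" "k - 1 \<in> {1..m}" "k - 1 \<noteq> m" by auto
    have lt: "idx (k - 1) < idx k" using less[OF k'(2,1)] k by auto
    have q: "idx (k - 1) \<in> R" by (rule inQ[OF k'(2,3)])
    have "idx k \<noteq> idx (k - 1) + 1"
    proof (cases "k = m")
      case True
      then show ?thesis using Rb[OF q] idx_m by auto
    next
      case False
      then show ?thesis using inQ[OF k'(1)] q R(2) by (auto simp: lacunar_def)
    qed
    then show "2 \<le> j k" using j[OF k'(1)] lt by simp
  qed
  show "R = blocks.I m j"
  proof -
    have "x \<in> R \<longleftrightarrow> (\<exists>k\<in>{2..m}. x = idx (k - 1))" for x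
    proof
      assume x: "x \<in> R"
      then obtain k where k: "k \<in> {1..m}" "x = idx k" using idx_image by blast
      moreover have "k \<noteq> m" using Rb[OF x] k idx_m by auto
      ultimately show "\<exists>k\<in>{2..m}. x = idx (k - 1)" by (intro bexI[of _ "k + 1"]) auto
    next
      assume "\<exists>k\<in>{2..m}. x = idx (k - 1)"
      then obtain k where k: "k \<in> {2..m}" "x = idx (k - 1)" by blast
      then have "k - 1 \<in> {1..m}" "k - 1 \<noteq> m" by auto
      then show "x \<in> R" unfolding k(2) by (rule inQ)
    qed
    moreover have "block_offset j k + 1 = idx (k - 1)" if "k \<in> {2..m}" for k
    proof -
      have "k - 1 \<in> {1..m}" "k - 1 \<le> m" "Suc (k - 1) = k" using that by auto
      then show ?thesis using off[of "k - 1"] pos[of "k - 1"] by (simp del: atLeastAtMost_iff)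
    qed
    ultimately show ?thesis unfolding blocks.I_def[OF blocks] by auto
  qed
qed

theorem theorem1p2:
  fixes n m i :: nat and Q :: "nat \<Rightarrow> nat set" and idx j :: "nat \<Rightarrow> nat"
  assumes Q_listing: "bij_betw Q {1..fib (n + 1)} {I. I \<subseteq> {1..n - 1} \<and> lacunar I}"
    and Q_sums: "\<And>a b. 1 \<le> a \<Longrightarrow> a \<le> b \<Longrightarrow> b \<le> fib (n + 1) \<Longrightarrow> \<Sum>(Q a) \<le> \<Sum>(Q b)"
    and i: "i \<in> {1..fib (n + 1)}"
    and idx_mono: "strict_mono_on {1..m} idx"
    and idx_image: "idx ` {1..m} = Q i \<union> {n + 1}"
    and idx_0: "idx 0 = 1"
    and j: "\<And>k. k \<in> {1..m} \<Longrightarrow> j k = idx k - idx (k - 1)"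
  shows "rep_iso (sym_group n)
    (quot_module
      (group_alg (sym_group n)\<lparr>carrier := F_filt n Q i\<rparr>
         :: ((nat \<Rightarrow> nat) \<Rightarrow> 'k :: {comm_ring, comm_monoid_mult}, _) module)
      (F_filt n Q (i - 1)))
    (Ind (sym_group (j 1) \<times>\<times> product_group {2..m} (\<lambda>k. sym_group (j k))) (sym_group n)
      (\<lambda>(\<tau>, \<sigma>). parabolic m j (\<sigma>(1 := \<tau>)))
      (rep_tensor (sym_group (j 1)) (product_group {2..m} (\<lambda>k. sym_group (j k)))
        (triv_rep (j 1))
        (rep_mtensor {2..m} (\<lambda>k. sym_group (j k)) (\<lambda>k. refl_quot_rep (j k)))))"
    (is "rep_iso _ ?V ?U")
proof -
  have Qi: "Q i \<subseteq> {1..n - 1}" "lacunar (Q i)"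
    using Q_listing i unfolding bij_betw_def by blast+
  note b = fibonacci_blocks[of "Q i" n m idx j, OF Qi idx_mono idx_image idx_0 j]
  interpret blocks n m j by (rule b(1))
  interpret fib_filtration n m j Q i
    by unfold_locales (use Q_listing Q_sums i b(2) in auto)
  interpret ind_blocks n m j "TYPE('k)" ..
  let ?M = "group_alg (sym_group n)\<lparr>carrier := F_filt n Q i\<rparr> :: ((nat \<Rightarrow> nat) \<Rightarrow> 'k, _) module"
  let ?N = "F_filt n Q (i - 1) :: ((nat \<Rightarrow> nat) \<Rightarrow> 'k) set"
  let ?A = "free (Sym n) :: ((nat \<Rightarrow> nat) \<Rightarrow> 'k) set"
  let ?P = "\<lambda>p. coset ?N (conv n p young_sum)"
  let ?P' = "\<lambda>p. ID.pure p gen"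
  note N = F_filt_subgp[of n Q "i - 1", where 'k = 'k]
  have Madd: "add ?M = (+)" and Msmult: "smult ?M = conv n"
    by (simp_all add: group_alg_smult)
  have U: "?U = \<lparr>carrier = carrier (tensor par_alg GA_mod rho2 HZ_rep), mult = undefined, one = undefined,
      zero = \<zero>\<^bsub>tensor par_alg GA_mod rho2 HZ_rep\<^esub>, add = add (tensor par_alg GA_mod rho2 HZ_rep),
      smult = (\<lambda>r. tensor_map par_alg GA_mod rho2 HZ_rep (\<lambda>q. r \<otimes>\<^bsub>group_alg (sym_group n)\<^esub> q) (\<lambda>v. v))\<rparr>"
    unfolding Ind_def Let_def par_alg_def GA_mod_def rho2_def HZ_rep_def Z_rep_def par_grp_def prod_grp_def phi_def ..
  show ?thesis
  proof (rule rep_iso_cyclic[where A = ?A and P = ?P and P' = ?P' and app = "conv n"])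
    show "carrier ?V = ?P ` ?A"
    proof -
      have "coset ?N x \<in> ?P ` ?A" if x: "x \<in> F_filt n Q i" for x
      proof -
        obtain p where "p \<in> ?A" "x - conv n p young_sum \<in> ?N" using filtration_generated[OF x] by blast
        then show ?thesis using coset_eq_iff[OF N, of x "conv n p young_sum"] by blast
      qed
      then show ?thesis unfolding quot_carrier[of ?M, OF Madd] using conv_young_sum_F_filt by auto
    qed
    show "carrier ?U = ?P' ` ?A"
    proof -
      have "ID.pure p gen \<in> coset ID.null ` free ID.X" if "p \<in> ?A" for p
        unfolding ID.pure_def using that gen_HZ_rep by (intro imageI single_in_free) simp
      then show ?thesis using ID_cyclic unfolding U ID.carrier_tensor[symmetric] by (force simp: ID.carrier_tensor)
    qed
    fix p q :: "(nat \<Rightarrow> nat) \<Rightarrow> 'k" assume p: "p \<in> ?A" and q: "q \<in> ?A"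
    show "p + q \<in> ?A" using p q by (rule add_in_free)
    show "?P p \<oplus>\<^bsub>?V\<^esub> ?P q = ?P (p + q)"
      unfolding quot_add[of ?N ?M, OF N Madd] conv_add_left ..
    show "?P' p \<oplus>\<^bsub>?U\<^esub> ?P' q = ?P' (p + q)"
      unfolding U pure_gen_add[OF p q] by (simp add: ID.pure_def ID.add_tensor del: plus_fun_apply)
    have "?P p = ?P q \<longleftrightarrow> conv n (p - q) young_sum \<in> ?N"
      unfolding coset_eq_iff[OF N] conv_diff_left ..
    also have "\<dots> \<longleftrightarrow> conv n (p - q) xi = 0" by (rule filtration_kernel) (rule diff_in_free[OF p q])
    also have "\<dots> \<longleftrightarrow> ?P' p = ?P' q" unfolding pure_gen_eq_iff[OF p q] ind_kernel[OF diff_in_free[OF p q]] ..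
    finally show "?P p = ?P q \<longleftrightarrow> ?P' p = ?P' q" .
  next
    fix r p :: "(nat \<Rightarrow> nat) \<Rightarrow> 'k" assume p: "p \<in> ?A"
    show "conv n r p \<in> ?A" by (rule conv_in_alg)
    have "r \<odot>\<^bsub>?V\<^esub> ?P p = coset ?N (r \<odot>\<^bsub>?M\<^esub> conv n p young_sum)"
      by (rule quot_smult_coset[OF N Madd]) (simp only: Msmult conv_add_right add_diff_cancel_right' F_filt_conv)
    then show "r \<odot>\<^bsub>?V\<^esub> ?P p = ?P (conv n r p)" by (simp only: Msmult conv_assoc)
    have "(p, gen) \<in> ID.X" using p gen_HZ_rep by simp
    then have "tensor_map par_alg GA_mod rho2 HZ_rep (conv n r) (\<lambda>v. v) (coset ID.null (single (p, gen)))
        = coset ID.null (push (\<lambda>(x, y). (conv n r x, y)) (single (p, gen)))"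
      by (intro ID.tensor_map_coset)
        (simp_all add: conv_add_right conv_scale_left conv_scale_right rho2_eq conv_assoc)
    then show "r \<odot>\<^bsub>?U\<^esub> ?P' p = ?P' (conv n r p)"
      unfolding U by (simp add: ID.pure_def group_alg_mult)
  qed
qed

end
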